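(* Let $n\ge 0$ and let $-\infty<\alpha_1<\beta_1<\alpha_2<\beta_2<\dots<\alpha_{n+1}<\beta_{n+1}<+\infty$. Put $e=\{\alpha_j,\beta_j\}_{j=1}^{n+1}$, $\mathfrak{e}=\bigcup_{j=1}^{n+1}[\alpha_j,\beta_j]$, and $\Omega=\bar{\mathbb{C}}\setminus\mathfrak{e}$. Let $f$ be analytic in $\Omega$ (including at $\infty$) with $|f(\infty)|=1$, and suppose that for some $p,q\ge 0$ and some constant $K_1>0$, $$\log|f(\lambda)|\le \frac{K_1}{\operatorname{dist}^p(\lambda,\mathfrak{e})\,\operatorname{dist}^q(\lambda,e)},\qquad \lambda\in\Omega\setminus\{\infty\}.$$ Then for every $0<\varepsilon<1$, $$\sum_{\lambda\in Z_f}\operatorname{dist}^{p+1+\varepsilon}(\lambda,\mathfrak{e})\,\operatorname{dist}^{a(p,q,\varepsilon)}(\lambda,e)\,(1+|\lambda|)^{b(p,q,\varepsilon)}\le C\cdot K_1,$$ where $$a(p,q,\varepsilon)=\frac{(p+2q-1+\varepsilon)_+-(p+1+\varepsilon)}{2},\qquad b(p,q,\varepsilon)=(p+q-1+\varepsilon)_+-\frac{(p+2q-1+\varepsilon)_++p+1+\varepsilon}{2},$$ and $C=C(\mathfrak{e},p,q,\varepsilon)>0$ depends only on $\mathfrak{e},p,q,\varepsilon$.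
   Context: $Z_f$ denotes the zero set of $f$ in $\Omega$, each zero repeated according to its multiplicity. $\operatorname{dist}(\lambda,M)$ is the Euclidean distance from $\lambda$ to a set $M$, and $x_+=\max\{x,0\}$. *)

theory Defs
  imports "HOL-Complex_Analysis.Complex_Analysis"
begin

definition frak_e :: "nat \<Rightarrow> (nat \<Rightarrow> real) \<Rightarrow> (nat \<Rightarrow> real) \<Rightarrow> complex set" where
  "frak_e n \<alpha> \<beta> = complex_of_real ` (\<Union>j\<le>n. {\<alpha> j..\<beta> j})"

definition endpts :: "nat \<Rightarrow> (nat \<Rightarrow> real) \<Rightarrow> (nat \<Rightarrow> real) \<Rightarrow> complex set" where
  "endpts n \<alpha> \<beta> = complex_of_real ` (\<Union>j\<le>n. {\<alpha> j, \<beta> j})"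

definition pos_part :: "real \<Rightarrow> real" where
  "pos_part x = max x 0"

definition exp_a :: "real \<Rightarrow> real \<Rightarrow> real \<Rightarrow> real" where
  "exp_a p q \<epsilon> = (pos_part (p + 2*q - 1 + \<epsilon>) - (p + 1 + \<epsilon>)) / 2"

definition exp_b :: "real \<Rightarrow> real \<Rightarrow> real \<Rightarrow> real" where
  "exp_b p q \<epsilon> = pos_part (p + q - 1 + \<epsilon>) - (pos_part (p + 2*q - 1 + \<epsilon>) + p + 1 + \<epsilon>) / 2"

text \<open>f analytic in the complement of the set E in the extended plane, including at infinity,
  with value c at infinity: f is holomorphic on the complement of E and w \<mapsto> f(1/w) extends
  holomorphically to a neighbourhood of 0 with value c at 0.\<close>
definition analytic_ext_at_inf :: "(complex \<Rightarrow> complex) \<Rightarrow> complex set \<Rightarrow> complex \<Rightarrow> bool" where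
  "analytic_ext_at_inf f E c \<longleftrightarrow> f holomorphic_on (- E) \<and>
     (\<exists>r>0. \<exists>g. g holomorphic_on ball 0 r \<and> g 0 = c \<and>
        (\<forall>w\<in>ball 0 r - {0}. inverse w \<notin> E \<and> g w = f (inverse w)))"

end

(* Weighted zero sums are estimated locally.  On the unit disc, Jensen's inequality on the circles
   |w| = 1 - c 2^(-k) bounds the zeros of a function with ln |F| <= M (1 - |w|)^(-p) and
   |F(w0)| >= exp (-M).  A Riemann map transports this to the rectangle |Re z| < 1, |Im z| < pi, where
   the distance to the horizontal sides replaces 1 - |w| (Harnack's inequality in both directions).
   Affine copies of the rectangle cover neighbourhoods of points of the domain and of inner points of
   the intervals; near an endpoint w the copies are the images of shifted rectangles under
   Y -> w - s exp Y, one for each dyadic scale, and their contributions form a geometric series.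

   Each copy needs a base point with ln |f| >= -C K (C K r^(-B) at scale r near an endpoint).  Since
   |f| = 1 at infinity, such points are found near every point of the domain by moving from disc to
   disc: the product of f over the k-th roots of unity rotations of a circle is at least |f(centre)|^k
   somewhere, which gives a large value on every arc of length 2 pi r / k.  Down to the scale r of an
   endpoint one uses the two constants theorem on a rectangle in logarithmic coordinates.
   At infinity, Jensen's inequality on dyadic discs in 1/z suffices. *)
theory Submission
  imports Defs
begin

text \<open>Exponents decide whether the sum over scales converges. At distance r from an endpoint
  the weight carries r to the power \<open>gam\<close>, which works out as max (p+q+\<epsilon>)
  ((p+1+\<epsilon>)/2). The hypothesis costs a factor r^(-(p+q)); carrying a base point down to
  scale r costs slightly more than r^(-max(p+q, 1/2)), where 1/2 is the decay exponent of harmonic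
  measure at the tip of a slit. As \<open>gam\<close> exceeds both p+q and 1/2, a positive power of
  r survives. The gap is needed twice: the hypothesis blows up along the cut, so the two constants
  theorem is applied on a strip of half-height \<Theta> < pi, where 1/2 becomes g = pi/(2 \<Theta>),
  chosen close to 1/2. The zeros of f are arbitrary, so no lower bound can hold at a prescribed
  finite point. Hence lower bounds are claimed only somewhere in a neighbourhood, and the local zero
  sums accept a base point anywhere in a fixed compact set. At infinity the weight has exponent max
  (p+q-1+\<epsilon>) 0, against a decay with exponent p+q. It is smaller by \<epsilon> < 1, except
  if p+q = 0; then both vanish and no sum over scales is required.\<close>

section \<open>Multiplicity of zeros as local divisibility\<close>

text \<open>The cofactor \<open>g\<close> may vanish at \<open>z\<close>, so \<open>m\<close> is
  only a lower bound for the order. This weak form survives composition with any holomorphic map,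
  injective or not, and is all that Jensen's inequality needs.\<close>

definition vanishes_to :: "(complex \<Rightarrow> complex) \<Rightarrow> complex \<Rightarrow> nat \<Rightarrow> bool" where
  "vanishes_to F z m \<longleftrightarrow>
     (\<exists>r>0. \<exists>g. g holomorphic_on ball z r \<and> (\<forall>w\<in>ball z r. F w = (w - z) ^ m * g w))"

lemma vanishes_to_zorder:
  assumes "f holomorphic_on U" "open U" "connected U" "z \<in> U" "\<exists>w\<in>U. f w \<noteq> 0"
  shows "vanishes_to f z (nat (zorder f z))"
proof -
  from zorder_exist_zero[OF assms] obtain r where r: "r > 0" "zor_poly f z holomorphic_on cball z r"
    "\<forall>w\<in>cball z r. f w = zor_poly f z w * (w - z) ^ nat (zorder f z)"
    by blast
  have "zor_poly f z holomorphic_on ball z r"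
    using r(2) holomorphic_on_subset ball_subset_cball by blast
  then show ?thesis
    unfolding vanishes_to_def using r
    by (intro exI[of _ r] conjI exI[of _ "zor_poly f z"]) (auto simp: mult.commute)
qed

text \<open>The quotient on the punctured set and the local cofactor agree where both are defined,
  so they glue over two open sets to one holomorphic function.\<close>

lemma vanishes_to_divide:
  assumes F: "F holomorphic_on U" and U: "open U" "z \<in> U" and v: "vanishes_to F z m"
  obtains G where "G holomorphic_on U" "\<And>w. w \<in> U \<Longrightarrow> F w = (w - z) ^ m * G w"
proof -
  obtain r g where r: "r > 0" "g holomorphic_on ball z r"
    "\<And>w. w \<in> ball z r \<Longrightarrow> F w = (w - z) ^ m * g w"
    using v unfolding vanishes_to_def by blast
  define G where "G = (\<lambda>w. if w = z then g z else F w / (w - z) ^ m)"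
  have Gg: "G w = g w" if "w \<in> ball z r" for w
    using r(3)[OF that] by (auto simp: G_def)
  have "G holomorphic_on ball z r"
    using r(2) Gg holomorphic_cong by (metis (no_types, lifting))
  moreover have "G holomorphic_on (U - {z})"
  proof -
    have "(\<lambda>w. F w / (w - z) ^ m) holomorphic_on (U - {z})"
      by (intro holomorphic_intros holomorphic_on_subset[OF F]) auto
    then show ?thesis
      by (rule holomorphic_transform) (auto simp: G_def)
  qed
  ultimately have "G holomorphic_on (ball z r \<union> (U - {z}))"
    using U by (intro holomorphic_on_Un) (auto simp: open_delete)
  then have "G holomorphic_on U"
    by (rule holomorphic_on_subset) (use r in auto)
  moreover have "F w = (w - z) ^ m * G w" if "w \<in> U" for w
    using r(3)[of z] r(1) by (auto simp: G_def)
  ultimately show ?thesis by (rule that)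
qed

text \<open>The factor (w - a)^k is invertible near \<open>z\<close>, so it can be moved into the
  cofactor. With k = 0 the lemma transfers vanishing between functions that agree on
  \<open>U\<close>.\<close>

lemma vanishes_to_cofactor:
  assumes U: "open U" "z \<in> U" and v: "vanishes_to F z m" and "z \<noteq> a"
    and F: "\<And>w. w \<in> U \<Longrightarrow> F w = (w - a) ^ k * G w"
  shows "vanishes_to G z m"
proof -
  obtain r g where r: "r > 0" "g holomorphic_on ball z r"
    "\<And>w. w \<in> ball z r \<Longrightarrow> F w = (w - z) ^ m * g w"
    using v unfolding vanishes_to_def by blast
  have "open (U - {a})" "z \<in> U - {a}" using U \<open>z \<noteq> a\<close> by (auto simp: open_delete)
  then obtain s where s: "s > 0" "ball z s \<subseteq> U - {a}" using open_contains_ball by blast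
  show ?thesis unfolding vanishes_to_def
  proof (intro exI[of _ "min r s"] conjI exI[of _ "\<lambda>w. g w / (w - a) ^ k"] ballI)
    show "(\<lambda>w. g w / (w - a) ^ k) holomorphic_on ball z (min r s)"
      using s by (intro holomorphic_intros holomorphic_on_subset[OF r(2)]) auto
    fix w assume w: "w \<in> ball z (min r s)"
    then have "w \<in> U" "w \<noteq> a" using s by auto
    then show "G w = (w - z) ^ m * (g w / (w - a) ^ k)"
      using F[of w] r(3)[of w] w by (simp add: field_simps)
  qed (use r s in auto)
qed

lemma vanishes_to_factor:
  assumes "finite S" "F holomorphic_on U" "open U" "S \<subseteq> U" "\<And>z. z \<in> S \<Longrightarrow> vanishes_to F z (m z)"
  shows "\<exists>G. G holomorphic_on U \<and> (\<forall>w\<in>U. F w = (\<Prod>z\<in>S. (w - z) ^ m z) * G w)"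
  using assms
proof (induction S arbitrary: F rule: finite_induct)
  case empty
  then show ?case by auto
next
  case (insert a S)
  have "vanishes_to F a (m a)" "a \<in> U" using insert.prems by auto
  then obtain H where H: "H holomorphic_on U" "\<And>w. w \<in> U \<Longrightarrow> F w = (w - a) ^ m a * H w"
    using vanishes_to_divide[OF insert.prems(1,2)] by metis
  have "vanishes_to H z (m z)" if "z \<in> S" for z
    using vanishes_to_cofactor[OF insert.prems(2) _ _ _ H(2)] insert that by (metis insertCI subsetD)
  with insert.IH[of H] H insert.prems obtain G where
    "G holomorphic_on U" "\<And>w. w \<in> U \<Longrightarrow> H w = (\<Prod>z\<in>S. (w - z) ^ m z) * G w"
    by auto
  with H insert.hyps show ?case by (intro exI[of _ G]) (auto simp: mult.assoc)
qed

text \<open>Writing \<phi> w - \<phi> a = (w - a) k(w) turns the m-th power of the left side into (w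
  - a)^m times a holomorphic factor. A critical point of \<phi> only raises the order.\<close>

lemma vanishes_to_compose:
  assumes v: "vanishes_to F (\<phi> a) m" and \<phi>: "\<phi> holomorphic_on V" and V: "open V" "a \<in> V"
  shows "vanishes_to (\<lambda>w. F (\<phi> w)) a m"
proof -
  obtain r g where r: "r > 0" "g holomorphic_on ball (\<phi> a) r"
    "\<And>w. w \<in> ball (\<phi> a) r \<Longrightarrow> F w = (w - \<phi> a) ^ m * g w"
    using v unfolding vanishes_to_def by blast
  have "vanishes_to (\<lambda>w. \<phi> w - \<phi> a) a 1"
  proof -
    obtain s where s: "s > 0" "ball a s \<subseteq> V" using V open_contains_ball by blast
    have "(\<lambda>w. \<phi> w - \<phi> a) holomorphic_on ball a s"
      using s by (intro holomorphic_intros holomorphic_on_subset[OF \<phi>])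
    \<comment> \<open>\<open>Schwarz3\<close> divides out a zero at the origin only, hence the
      translation and its undoing below.\<close>
    then have "((\<lambda>w. \<phi> w - \<phi> a) \<circ> (\<lambda>w. w + a)) holomorphic_on ball 0 s"
      by (intro holomorphic_on_compose_gen[of _ _ _ "ball a s"])
        (auto intro!: holomorphic_intros simp: dist_norm norm_minus_commute)
    then obtain h where h: "h holomorphic_on ball 0 s"
      "\<And>w. norm w < s \<Longrightarrow> \<phi> (w + a) - \<phi> a = w * h w"
      by (rule Schwarz3) (auto simp: o_def)
    have "(h \<circ> (\<lambda>w. w - a)) holomorphic_on ball a s"
      by (intro holomorphic_on_compose_gen[OF _ h(1)] holomorphic_intros)
        (auto simp: dist_norm norm_minus_commute)
    then show ?thesis unfolding vanishes_to_def
      using s h(2)[of "w - a" for w]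
      by (intro exI[of _ s] conjI exI[of _ "h \<circ> (\<lambda>w. w - a)"]) (auto simp: dist_norm norm_minus_commute)
  qed
  then obtain s k where s: "s > 0" "k holomorphic_on ball a s"
    "\<And>w. w \<in> ball a s \<Longrightarrow> \<phi> w - \<phi> a = (w - a) * k w"
    unfolding vanishes_to_def by auto
  have "continuous_on V \<phi>" using \<phi> holomorphic_on_imp_continuous_on by blast
  then have "open (V \<inter> \<phi> -` ball (\<phi> a) r)" using V by (simp add: continuous_open_preimage)
  moreover have "a \<in> V \<inter> \<phi> -` ball (\<phi> a) r" using V r by auto
  ultimately obtain t where t: "t > 0" "ball a t \<subseteq> V \<inter> \<phi> -` ball (\<phi> a) r"
    using open_contains_ball by blast
  have tV: "ball a t \<subseteq> V" and tb: "\<And>w. w \<in> ball a t \<Longrightarrow> \<phi> w \<in> ball (\<phi> a) r" using t by auto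
  show ?thesis unfolding vanishes_to_def
  proof (intro exI[of _ "min s t"] conjI exI[of _ "\<lambda>w. k w ^ m * g (\<phi> w)"] ballI)
    have "(g \<circ> \<phi>) holomorphic_on ball a t"
      by (rule holomorphic_on_compose_gen[OF holomorphic_on_subset[OF \<phi> tV] r(2)]) (use tb in auto)
    then have "(\<lambda>w. g (\<phi> w)) holomorphic_on ball a (min s t)"
      unfolding o_def by (rule holomorphic_on_subset) auto
    then show "(\<lambda>w. k w ^ m * g (\<phi> w)) holomorphic_on ball a (min s t)"
      by (intro holomorphic_intros holomorphic_on_subset[OF s(2)]) auto
    fix w assume w: "w \<in> ball a (min s t)"
    show "F (\<phi> w) = (w - a) ^ m * (k w ^ m * g (\<phi> w))"
      using r(3)[OF tb[of w]] s(3)[of w] w by (simp add: power_mult_distrib)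
  qed (use s t in auto)
qed

section \<open>Jensen's inequality and zero sums on the disc\<close>

text \<open>Replacing each factor w - a by its Blaschke counterpart leaves the modulus on the circle
  unchanged, so the maximum principle bounds the new function \<open>H\<close> by exp L at
  \<open>w0\<close>. Going back to \<open>F\<close> costs the factor \<beta> a per zero, the
  pseudohyperbolic distance of \<open>a\<close> and \<open>w0\<close>, and -ln (\<beta> a) is at
  least the stated term.\<close>

lemma jensen_bound:
  fixes F :: "complex \<Rightarrow> complex" and m :: "complex \<Rightarrow> nat"
  assumes F: "F holomorphic_on U" "open U" "cball 0 R \<subseteq> U" and R: "R > 0"
    and S: "finite S" "S \<subseteq> ball 0 R" "\<And>a. a \<in> S \<Longrightarrow> vanishes_to F a (m a)"
    and w0: "norm w0 < R" "F w0 \<noteq> 0"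
    and L: "\<And>w. norm w = R \<Longrightarrow> F w \<noteq> 0 \<Longrightarrow> ln (norm (F w)) \<le> L"
  shows "(\<Sum>a\<in>S. m a * ((R - norm a) * (R - norm w0) / (8 * R\<^sup>2))) \<le> L - ln (norm (F w0))"
proof -
  have SU: "S \<subseteq> U" using S F ball_subset_cball by blast
  obtain G where G: "G holomorphic_on U" "\<And>w. w \<in> U \<Longrightarrow> F w = (\<Prod>a\<in>S. (w - a) ^ m a) * G w"
    using vanishes_to_factor[OF S(1) F(1,2) SU S(3)] by blast
  \<comment> \<open>The reflected factor: no zero in the closed disc, and modulus |w - a| on the
    circle |w| = R.\<close>
  define b where "b = (\<lambda>a w. (of_real (R\<^sup>2) - cnj a * w) / of_real R :: complex)"
  have b0: "b a w \<noteq> 0" if "a \<in> S" "norm w \<le> R" for a w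
  proof -
    have "norm (cnj a * w) \<le> norm a * R" using that by (simp add: norm_mult mult_left_mono)
    also have "\<dots> < R * R" using S that R by (intro mult_strict_right_mono) auto
    finally have "norm (cnj a * w) < norm (of_real (R\<^sup>2) :: complex)"
      using R by (simp add: power2_eq_square norm_mult)
    then show ?thesis using R by (auto simp: b_def)
  qed
  define H where "H = (\<lambda>w. G w * (\<Prod>a\<in>S. b a w ^ m a))"
  have "H holomorphic_on U" unfolding H_def b_def by (intro holomorphic_intros G) (use R in auto)
  then have H: "H holomorphic_on interior (cball 0 R)" "continuous_on (closure (cball 0 R)) H"
    using F(3) holomorphic_on_subset holomorphic_on_imp_continuous_on interior_subset 
      closure_closed by (metis subset_trans, metis closed_cball continuous_on_subset)
  have bn: "norm (b a w) = norm (w - a)" if "norm w = R" for a w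
  proof -
    have "of_real (R\<^sup>2) = w * cnj w" using that by (simp add: complex_norm_square[symmetric])
    then have "b a w = w * cnj (w - a) / of_real R" unfolding b_def by (simp add: algebra_simps)
    then have "norm (b a w) = norm (cnj (w - a))" using that R by (simp add: norm_mult norm_divide)
    then show ?thesis by (simp only: complex_mod_cnj)
  qed
  have HF: "norm (H w) = norm (F w)" if "norm w = R" for w
  proof -
    have "w \<in> U" using that F by auto
    then show ?thesis using G(2)[of w] bn[OF that]
      by (simp add: H_def norm_mult prod_norm[symmetric] norm_power mult.commute)
  qed
  have "norm (H w0) \<le> exp L"
  proof (rule maximum_modulus_frontier[OF H])
    fix w assume "w \<in> frontier (cball 0 R :: complex set)"
    then have w: "norm w = R" using R by (simp add: frontier_cball)
    show "norm (H w) \<le> exp L"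
    proof (cases "F w = 0")
      case False
      then show ?thesis using L[OF w False] HF[OF w]
        by (metis exp_ln exp_le_cancel_iff zero_less_norm_iff)
    qed (use HF[OF w] in auto)
  qed (use w0 in auto)
  define \<beta> where "\<beta> = (\<lambda>a. norm (w0 - a) / norm (b a w0))"
  have w0U: "w0 \<in> U" using w0 F by auto
  have ne: "w0 - a \<noteq> 0" if "a \<in> S" "m a \<noteq> 0" for a
  proof
    assume "w0 - a = 0"
    then have "(\<Prod>a\<in>S. (w0 - a) ^ m a) = 0" using that S(1) by (auto simp: prod_zero_iff)
    then show False using G(2)[OF w0U] w0 by simp
  qed
  have FH: "norm (F w0) = norm (H w0) * (\<Prod>a\<in>S. \<beta> a ^ m a)"
  proof -
    have "norm (F w0) = norm (G w0) * (\<Prod>a\<in>S. norm (w0 - a) ^ m a)"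
      using G(2)[OF w0U] by (simp add: norm_mult prod_norm[symmetric] norm_power)
    also have "(\<Prod>a\<in>S. norm (w0 - a) ^ m a) = (\<Prod>a\<in>S. norm (b a w0) ^ m a * \<beta> a ^ m a)"
      using b0 w0 by (intro prod.cong) (auto simp: \<beta>_def field_simps)
    also have "norm (G w0) * \<dots> = norm (H w0) * (\<Prod>a\<in>S. \<beta> a ^ m a)"
      by (simp add: H_def norm_mult prod_norm[symmetric] norm_power prod.distrib)
    finally show ?thesis .
  qed
  have H0: "H w0 \<noteq> 0" using FH w0 by auto
  have pos: "\<beta> a ^ m a > 0" if "a \<in> S" for a
    using ne[OF that] b0[OF that, of w0] w0 by (cases "m a = 0") (auto simp: \<beta>_def)
  have "ln (norm (F w0)) = ln (norm (H w0)) + (\<Sum>a\<in>S. ln (\<beta> a ^ m a))"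
  proof -
    have "ln (\<Prod>a\<in>S. \<beta> a ^ m a) = (\<Sum>a\<in>S. ln (\<beta> a ^ m a))"
    proof (rule ln_prod[OF S(1)])
      show "\<beta> a ^ m a \<noteq> 0" if "a \<in> S" for a using pos[OF that] by linarith
    qed
    moreover have "(\<Prod>a\<in>S. \<beta> a ^ m a) > 0" using pos by (simp add: prod_pos)
    ultimately show ?thesis unfolding FH using H0 by (subst ln_mult_pos) auto
  qed
  also have "(\<Sum>a\<in>S. ln (\<beta> a ^ m a)) \<le> (\<Sum>a\<in>S. - (m a * ((R - norm a) * (R - norm w0) / (8 * R\<^sup>2))))"
  proof (rule sum_mono)
    fix a assume a: "a \<in> S"
    show "ln (\<beta> a ^ m a) \<le> - (m a * ((R - norm a) * (R - norm w0) / (8 * R\<^sup>2)))"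
    proof (cases "m a = 0")
      case False
      define D where "D = norm (of_real (R\<^sup>2) - cnj a * w0 :: complex)"
      have aR: "norm a < R" using a S by auto
      have D: "D > 0" using b0[OF a, of w0] w0 R by (auto simp: b_def D_def)
      have "D \<le> R\<^sup>2 + norm a * norm w0"
        unfolding D_def using norm_triangle_ineq4[of "of_real (R\<^sup>2)" "cnj a * w0"] 
        by (simp add: norm_mult norm_power)
      also have "\<dots> \<le> R\<^sup>2 + R * R" using aR w0 R by (intro add_left_mono mult_mono) auto
      finally have D2: "D \<le> 2 * R\<^sup>2" by (simp add: power2_eq_square)
      have \<beta>eq: "\<beta> a = R * norm (w0 - a) / D"
        unfolding \<beta>_def b_def D_def using R by (simp add: norm_divide)
      \<comment> \<open>The identity behind the pseudohyperbolic distance. With D at most 2 R^2 it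
        gives 1 - \<beta>^2 a lower bound with denominator 4 R^2; halving the logarithm of the
        square makes this 8 R^2.\<close>
      have key: "D\<^sup>2 - (R * norm (w0 - a))\<^sup>2 = (R\<^sup>2 - (norm a)\<^sup>2) * (R\<^sup>2 - (norm w0)\<^sup>2)"
        unfolding D_def by (simp add: cmod_def power_mult_distrib) (simp add: power2_eq_square algebra_simps)
      have \<beta>pos: "\<beta> a > 0" using pos[OF a] False by (metis ne[OF a False] D R \<beta>eq divide_pos_pos mult_pos_pos zero_less_norm_iff)
      have "2 * ln (\<beta> a) = ln ((\<beta> a)\<^sup>2)" using \<beta>pos by (simp add: ln_realpow)
      also have "\<dots> \<le> (\<beta> a)\<^sup>2 - 1" using \<beta>pos by (intro ln_le_minus_one) auto
      also have "\<dots> = - ((R\<^sup>2 - (norm a)\<^sup>2) * (R\<^sup>2 - (norm w0)\<^sup>2) / D\<^sup>2)"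
        unfolding key[symmetric] \<beta>eq using D by (simp add: power_divide diff_divide_distrib)
      also have "\<dots> \<le> - ((R * (R - norm a)) * (R * (R - norm w0)) / (2 * R\<^sup>2)\<^sup>2)"
      proof -
        have *: "R * (R - x) \<le> R\<^sup>2 - x\<^sup>2" "0 \<le> R * (R - x)" if "0 \<le> x" "x < R" for x
        proof -
          have "x * x \<le> R * x" using that by (intro mult_right_mono) auto
          then show "R * (R - x) \<le> R\<^sup>2 - x\<^sup>2" by (simp add: power2_eq_square algebra_simps)
        qed (use that R in auto)
        show ?thesis
          unfolding neg_le_iff_le using aR w0 R D D2 *(2)[of "norm a"] *(2)[of "norm w0"]
          by (intro frac_le mult_mono * power_mono) (auto intro: order_trans[OF *(2) *(1)] mult_nonneg_nonneg)
      qed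
      also have "\<dots> = - (2 * ((R - norm a) * (R - norm w0) / (8 * R\<^sup>2)))"
        using R by (simp add: power2_eq_square field_simps)
      finally have "ln (\<beta> a) \<le> - ((R - norm a) * (R - norm w0) / (8 * R\<^sup>2))" by simp
      then have "m a * ln (\<beta> a) \<le> m a * - ((R - norm a) * (R - norm w0) / (8 * R\<^sup>2))"
        by (intro mult_left_mono) auto
      then show ?thesis using \<beta>pos by (simp add: ln_realpow)
    qed auto
  qed
  also have "ln (norm (H w0)) \<le> L"
    using \<open>norm (H w0) \<le> exp L\<close> H0 by (metis ln_exp ln_le_cancel_iff exp_gt_zero zero_less_norm_iff)
  finally show ?thesis by (simp add: sum_negf)
qed

text \<open>The device for all sums over scales: \<kappa> assigns a scale to each point, and since S
  is finite only finitely many scales occur.\<close>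

lemma sum_le_geometric:
  fixes h :: "'a \<Rightarrow> real" and \<kappa> :: "'a \<Rightarrow> nat"
  assumes S: "finite S" and A: "A \<ge> 0" and q: "0 \<le> q" "q < 1"
    and le: "\<And>k. (\<Sum>a\<in>{a\<in>S. \<kappa> a = k}. h a) \<le> A * q ^ k"
  shows "(\<Sum>a\<in>S. h a) \<le> A / (1 - q)"
proof -
  have "(\<Sum>a\<in>S. h a) = (\<Sum>k\<in>\<kappa> ` S. \<Sum>a\<in>{a\<in>S. \<kappa> a = k}. h a)"
    by (rule sum.image_gen[OF S])
  also have "\<dots> \<le> (\<Sum>k\<in>\<kappa> ` S. A * q ^ k)"
    using le by (rule sum_mono)
  also have "\<dots> \<le> (\<Sum>k. A * q ^ k)"
    using S A q by (intro sum_le_suminf summable_mult summable_geometric) auto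
  also have "\<dots> = A / (1 - q)"
    using q by (simp add: suminf_mult suminf_geometric summable_geometric)
  finally show ?thesis .
qed

text \<open>In the shell where 1 - |a| is comparable to t = 2^(-k), Jensen bounds the number of
  zeros by a constant times M t^(-p-1). The weight t^(p+1+\<epsilon>) leaves t^\<epsilon>, and this
  is what makes the series over k converge.\<close>

lemma disc_zero_sum:
  fixes p \<epsilon> \<rho> :: real
  assumes p: "p \<ge> 0" and \<epsilon>: "\<epsilon> > 0" and \<rho>: "0 \<le> \<rho>" "\<rho> < 1"
  obtains C where "C > 0" and
    "\<And>F M w0 S m. F holomorphic_on ball 0 1 \<Longrightarrow> M > 0 \<Longrightarrow> norm w0 \<le> \<rho> \<Longrightarrow> F w0 \<noteq> 0 \<Longrightarrow>
       ln (norm (F w0)) \<ge> - M \<Longrightarrow>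
       (\<And>w. norm w < 1 \<Longrightarrow> F w \<noteq> 0 \<Longrightarrow> ln (norm (F w)) \<le> M / (1 - norm w) powr p) \<Longrightarrow>
       finite S \<Longrightarrow> S \<subseteq> ball 0 1 \<Longrightarrow> (\<And>a. a \<in> S \<Longrightarrow> vanishes_to F a (m a)) \<Longrightarrow>
       (\<Sum>a\<in>S. real (m a) * (1 - norm a) powr (p + 1 + \<epsilon>)) \<le> C * M"
proof -
  define c where "c = 128 / (1 - \<rho>) * (4 / (1 - \<rho>)) powr p"
  define q :: real where "q = 2 powr (- \<epsilon>)"
  have c: "c > 0" using \<rho> by (simp add: c_def)
  have q: "0 < q" "q < 1" using \<epsilon> by (auto simp: q_def powr_less_one)
  have main: "(\<Sum>a\<in>S. real (m a) * (1 - norm a) powr (p + 1 + \<epsilon>)) \<le> c / (1 - q) * M"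
    if F: "F holomorphic_on ball 0 1" and M: "M > 0" and w0: "norm w0 \<le> \<rho>" "F w0 \<noteq> 0" "ln (norm (F w0)) \<ge> - M"
      and up: "\<And>w. norm w < 1 \<Longrightarrow> F w \<noteq> 0 \<Longrightarrow> ln (norm (F w)) \<le> M / (1 - norm w) powr p"
      and S: "finite S" "S \<subseteq> ball 0 1" and m: "\<And>a. a \<in> S \<Longrightarrow> vanishes_to F a (m a)" for F M w0 S m
  proof -
    \<comment> \<open>The truncation by \<open>nat\<close> is harmless because 1 - |a| is at most
      1.\<close>
    define \<kappa> where "\<kappa> = (\<lambda>a::complex. nat \<lfloor>- log 2 (1 - norm a)\<rfloor>)"
    have "(\<Sum>a\<in>S. real (m a) * (1 - norm a) powr (p + 1 + \<epsilon>)) \<le> (c * M) / (1 - q)"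
    proof (rule sum_le_geometric[OF S(1)])
      fix k
      define t :: real where "t = 2 powr (- real k)"
      define T where "T = {a\<in>S. \<kappa> a = k}"
      \<comment> \<open>With 1 - R = u/4 both demands are met: R - |a| stays above t/4 for zeros of
        the shell, and R - |w0| above (1 - \<rho>)/2 for every base point.\<close>
      define u where "u = (1 - \<rho>) * t"
      define R where "R = 1 - u / 4"
      have t: "0 < t" "t \<le> 1" by (auto simp: t_def powr_le_one_le powr_minus_divide ge_one_powr_ge_zero)
      have T: "t / 2 < 1 - norm a" "1 - norm a \<le> t" if "a \<in> T" for a
      proof -
        have a1: "0 < 1 - norm a" "1 - norm a \<le> 1" using that S(2) by (auto simp: T_def)
        then have "- log 2 (1 - norm a) \<ge> 0" by (simp add: log_le_zero_cancel_iff)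
        then have "\<lfloor>- log 2 (1 - norm a)\<rfloor> = int k" using that by (auto simp: T_def \<kappa>_def)
        then have "real k \<le> - log 2 (1 - norm a)" "- log 2 (1 - norm a) < real k + 1" by linarith+
        then have l: "log 2 (1 - norm a) \<le> - real k" "- real k - 1 < log 2 (1 - norm a)" by linarith+
        from l(1) have "1 - norm a \<le> t" unfolding t_def using a1 by (subst (asm) log_le_iff) auto
        moreover from l(2) have "2 powr (- real k - 1) < 1 - norm a" using a1 by (subst (asm) less_log_iff) auto
        ultimately show "t / 2 < 1 - norm a" "1 - norm a \<le> t" by (auto simp: t_def powr_diff)
      qed
      have t4: "u \<le> t" "u \<le> 1 - \<rho>"
        unfolding u_def using t \<rho> by (auto simp: mult_left_le mult_left_le_one_le mult_le_cancel_right1)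
      have "u > 0" using t \<rho> by (simp add: u_def)
      then have R: "0 < R" "R < 1" "1 - R = u / 4" using t(2) t4(1) unfolding R_def by linarith+
      have jb: "(\<Sum>a\<in>T. m a * ((R - norm a) * (R - norm w0) / (8 * R\<^sup>2))) \<le> M / (1 - R) powr p - ln (norm (F w0))"
      proof (rule jensen_bound[OF F])
        show "T \<subseteq> ball 0 R"
        proof
          fix a assume "a \<in> T"
          then have "t / 2 < 1 - norm a" using T by auto
          then have "norm a < R" unfolding R_def using t4(1) t by linarith
          then show "a \<in> ball 0 R" by simp
        qed
        show "norm w0 < R" unfolding R_def using w0(1) t4(2) \<rho> by linarith
        show "ln (norm (F w)) \<le> M / (1 - R) powr p" if "norm w = R" "F w \<noteq> 0" for w
          using up[of w] that R(2) by simp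
      qed (use R S m w0 in \<open>auto simp: T_def\<close>)
      have A: "1 \<le> 1 / (1 - R) powr p" using R p by (simp add: powr_le1)
      have "(\<Sum>a\<in>T. m a * (t * (1 - \<rho>) / 64)) \<le> (\<Sum>a\<in>T. m a * ((R - norm a) * (R - norm w0) / (8 * R\<^sup>2)))"
      proof (intro sum_mono mult_left_mono)
        fix a assume a: "a \<in> T"
        have "t / 4 \<le> R - norm a" unfolding R_def using T(1)[OF a] t4(1) by linarith
        moreover have "(1 - \<rho>) / 2 \<le> R - norm w0" unfolding R_def using w0(1) t4(2) \<rho> by argo
        ultimately have "t / 4 * ((1 - \<rho>) / 2) \<le> (R - norm a) * (R - norm w0)"
          using t \<rho> by (intro mult_mono) auto
        moreover have "R\<^sup>2 \<le> 1" using R by (simp add: power_le_one)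
        moreover have "0 \<le> t / 4 * ((1 - \<rho>) / 2)" using t \<rho> by simp
        ultimately have "t / 4 * ((1 - \<rho>) / 2) / 8 \<le> (R - norm a) * (R - norm w0) / (8 * R\<^sup>2)"
          using R(1) by (intro frac_le) (linarith | simp)+
        then show "t * (1 - \<rho>) / 64 \<le> (R - norm a) * (R - norm w0) / (8 * R\<^sup>2)" by simp
      qed auto
      also note jb
      \<comment> \<open>The loss M at the base point is absorbed because (1 - R)^(-p) is at least
        1.\<close>
      also have "M / (1 - R) powr p - ln (norm (F w0)) \<le> 2 * M / (1 - R) powr p"
        using w0 mult_left_mono[OF A, of M] M by simp
      also have "\<dots> = 2 * M * ((4 / (1 - \<rho>)) powr p * t powr (- p))"
      proof -
        have "1 - R = (1 - \<rho>) / 4 * t" using R(3) by (simp add: u_def)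
        then have "(1 - R) powr p = ((1 - \<rho>) / 4) powr p * t powr p"
          using \<rho> t by (simp only: powr_mult)
        moreover have "(4 / (1 - \<rho>)) powr p = 1 / ((1 - \<rho>) / 4) powr p"
          using \<rho> by (simp add: powr_divide)
        ultimately show ?thesis by (simp add: powr_minus field_simps)
      qed
      finally have n: "(\<Sum>a\<in>T. m a * (t * (1 - \<rho>) / 64)) \<le> \<dots>" .
      have "(\<Sum>a\<in>T. real (m a) * (1 - norm a) powr (p + 1 + \<epsilon>)) \<le> (\<Sum>a\<in>T. real (m a) * t powr (p + 1 + \<epsilon>))"
      proof (intro sum_mono mult_left_mono powr_mono2)
        fix a assume "a \<in> T"
        then show "0 \<le> 1 - norm a" "1 - norm a \<le> t" using T[of a] t by linarith+
      qed (use p \<epsilon> in auto)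
      also have "\<dots> = (\<Sum>a\<in>T. m a * (t * (1 - \<rho>) / 64)) * (64 / (1 - \<rho>) * t powr (p + \<epsilon>))"
        unfolding sum_distrib_right using t \<rho> by (intro sum.cong) (auto simp: powr_add field_simps)
      also have "\<dots> \<le> 2 * M * ((4 / (1 - \<rho>)) powr p * t powr (- p)) * (64 / (1 - \<rho>) * t powr (p + \<epsilon>))"
        using n \<rho> by (intro mult_right_mono) auto
      also have "\<dots> = c * M * (t powr (- p) * t powr (p + \<epsilon>))" by (simp add: c_def)
      also have "t powr (- p) * t powr (p + \<epsilon>) = t powr \<epsilon>" by (simp add: powr_add[symmetric])
      also have "t powr \<epsilon> = q ^ k"
        unfolding t_def q_def by (simp add: powr_powr powr_realpow[symmetric] mult.commute)
      finally show "(\<Sum>a\<in>{a\<in>S. \<kappa> a = k}. real (m a) * (1 - norm a) powr (p + 1 + \<epsilon>)) \<le> c * M * q ^ k"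
        unfolding T_def .
    qed (use c M q in auto)
    then show ?thesis by simp
  qed
  show ?thesis
  proof (rule that)
    show "c / (1 - q) > 0" using c q by simp
  qed (rule main, assumption+)
qed

section \<open>Harnack's inequality and transfer to the rectangle\<close>

text \<open>The Cayley transform that sends the right half-plane to the disc and h(c) to 0 reduces
  the claim to Schwarz's lemma. The usual factor (1 - x)/(1 + x) is weakened to (1 - x)/2.\<close>

lemma harnack_ball:
  assumes h: "h holomorphic_on ball c r" and pos: "\<And>z. z \<in> ball c r \<Longrightarrow> Re (h z) > 0" and z: "z \<in> ball c r"
  shows "Re (h z) \<ge> Re (h c) * (1 - dist c z / r) / 2"
proof -
  have r: "r > 0" using z by (metis ball_eq_empty empty_iff not_le)
  have in_ball: "c + of_real r * w \<in> ball c r" if "norm w < 1" for w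
    using that r by (simp add: dist_norm norm_mult)
  define a where "a = h c"
  have a: "Re a > 0" using pos[of c] r by (simp add: a_def)
  define k where "k = (\<lambda>w. h (c + of_real r * w))"
  have "(h \<circ> (\<lambda>w. c + of_real r * w)) holomorphic_on ball 0 1"
    by (rule holomorphic_on_compose_gen[OF _ h]) (auto intro!: holomorphic_intros in_ball)
  then have k: "k holomorphic_on ball 0 1" by (simp add: k_def o_def)
  have kpos: "Re (k w) > 0" if "norm w < 1" for w using pos[OF in_ball[OF that]] by (simp add: k_def)
  have ne: "k w + cnj a \<noteq> 0" if "norm w < 1" for w
    using kpos[OF that] a by (auto simp: complex_eq_iff)
  define g where "g = (\<lambda>w. (k w - a) / (k w + cnj a))"
  have id: "(norm (k w + cnj a))\<^sup>2 - (norm (k w - a))\<^sup>2 = 4 * Re (k w) * Re a" for w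
    unfolding cmod_power2 by (simp add: power2_eq_square algebra_simps)
  have g1: "norm (g w) < 1" if "norm w < 1" for w
  proof -
    have "(norm (k w - a))\<^sup>2 < (norm (k w + cnj a))\<^sup>2" using id[of w] kpos[OF that] a by (smt (verit) mult_pos_pos)
    then have "norm (k w - a) < norm (k w + cnj a)" by (rule power2_less_imp_less) auto
    then show ?thesis using ne[OF that] by (simp add: g_def norm_divide)
  qed
  define w where "w = (z - c) / of_real r"
  have w: "norm w = dist c z / r" "c + of_real r * w = z" "norm w < 1"
    using r z by (auto simp: w_def dist_norm norm_divide norm_minus_commute)
  have gw: "norm (g w) \<le> norm w"
  proof (rule Schwarz_Lemma(1)[OF _ _ g1 w(3)])
    show "g holomorphic_on ball 0 1" unfolding g_def using ne by (intro holomorphic_intros k) auto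
    show "g 0 = 0" by (simp add: g_def k_def a_def)
  qed
  have g1': "norm (g w) < 1" "g w \<noteq> 1" using g1[OF w(3)] by auto
  \<comment> \<open>Inverse Cayley transform; together with \<open>id\<close> it expresses Re (k w)
    as Re a times the Poisson-type quotient (1 - |g|^2) / |1 - g|^2.\<close>
  have kw: "k w + cnj a = of_real (2 * Re a) / (1 - g w)"
  proof -
    have "1 - g w = (cnj a + a) / (k w + cnj a)" using ne[OF w(3)] by (simp add: g_def field_simps)
    also have "cnj a + a = of_real (2 * Re a)" by (simp add: complex_eq_iff)
    finally show ?thesis using ne[OF w(3)] a g1'(2) by (simp add: field_simps)
  qed
  have "4 * Re (k w) * Re a = (norm (k w + cnj a))\<^sup>2 * (1 - (norm (g w))\<^sup>2)"
    unfolding id[symmetric] g_def using ne[OF w(3)] by (simp add: norm_divide power_divide field_simps)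
  also have "\<dots> = (2 * Re a)\<^sup>2 * ((1 - (norm (g w))\<^sup>2) / (norm (1 - g w))\<^sup>2)"
    unfolding kw using a by (simp add: norm_divide power_divide)
  also have "\<dots> \<ge> (2 * Re a)\<^sup>2 * ((1 - norm w) / 2)"
  proof (rule mult_left_mono)
    define x where "x = norm (g w)"
    have x: "0 \<le> x" "x < 1" "x \<le> norm w" using g1' gw by (auto simp: x_def)
    have n: "norm (1 - g w) \<le> 1 + x" "norm (1 - g w) > 0"
      unfolding x_def using norm_triangle_ineq4[of 1 "g w"] g1' by auto
    have "(1 - norm w) / 2 \<le> (1 - x) / (1 + x)"
      using x w(3) by (intro frac_le) auto
    also have "\<dots> = (1 - x\<^sup>2) / (1 + x)\<^sup>2"
    proof -
      have "1 - x\<^sup>2 = (1 - x) * (1 + x)" by (simp add: power2_eq_square algebra_simps)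
      then show ?thesis using x by (simp add: power2_eq_square)
    qed
    also have "\<dots> \<le> (1 - x\<^sup>2) / (norm (1 - g w))\<^sup>2"
      using x n by (intro divide_left_mono power_mono) (auto simp: power_le_one abs_square_le_1 zero_less_mult_iff)
    finally show "(1 - norm w) / 2 \<le> (1 - (norm (g w))\<^sup>2) / (norm (1 - g w))\<^sup>2" by (simp add: x_def)
  qed auto
  finally have "Re a * ((1 - norm w) / 2) * (4 * Re a) \<le> Re (k w) * (4 * Re a)"
    by (simp add: power2_eq_square field_simps)
  then have "Re a * ((1 - norm w) / 2) \<le> Re (k w)" using a by simp
  then show ?thesis using w by (simp add: k_def a_def)
qed

lemma divide_powr_left_mono:
  fixes a b p M :: real
  assumes "0 < a" "a \<le> b" "0 \<le> p" "0 \<le> M"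
  shows "M / b powr p \<le> M / a powr p"
  using assms by (intro divide_left_mono powr_mono2 mult_pos_pos) auto

text \<open>The half-height is pi so that translates of this same rectangle fill the strip |Im Y| <
  pi of the logarithmic coordinate at an endpoint. The width leaves room beyond |Re z| <= 1/2, where
  zeros are counted.\<close>

definition patch :: "complex set" where
  "patch = {z. \<bar>Re z\<bar> < 1 \<and> \<bar>Im z\<bar> < pi}"

lemma patch_eq_box: "patch = box (Complex (-1) (-pi)) (Complex 1 pi)"
  by (auto simp: patch_def in_box_complex_iff abs_less_iff)

lemma open_patch: "open patch" and convex_patch: "convex patch"
  by (simp_all add: patch_eq_box open_box convex_box)

lemma patch_riemann_map:
  obtains \<psi> \<phi> where "\<psi> holomorphic_on patch" "\<phi> holomorphic_on ball 0 1"
    "\<And>z. z \<in> patch \<Longrightarrow> norm (\<psi> z) < 1 \<and> \<phi> (\<psi> z) = z"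
    "\<And>w. norm w < 1 \<Longrightarrow> \<phi> w \<in> patch \<and> \<psi> (\<phi> w) = w"
proof -
  have "open patch \<and> simply_connected patch"
    using open_patch convex_patch convex_imp_simply_connected by blast
  moreover have "0 \<in> patch" "2 \<notin> patch" by (auto simp: patch_def)
  ultimately show ?thesis using that unfolding Riemann_mapping_theorem by auto
qed

text \<open>Two comparisons carry the disc estimate over: \<open>low\<close>, valid on the whole
  disc, converts the growth bound, and \<open>up\<close>, valid for |Re z| <= 1/2, converts the
  weight. The corners are avoided in \<open>up\<close>, since near the vertical sides 1 - |\<psi>|
  is not comparable to the distance from the horizontal ones.\<close>

lemma patch_zero_sum:
  fixes p \<epsilon> :: real
  assumes p: "p \<ge> 0" and \<epsilon>: "\<epsilon> > 0" and K: "compact K" "K \<subseteq> patch"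
  obtains C where "C > 0" and
    "\<And>F M c T m. F holomorphic_on patch \<Longrightarrow> M > 0 \<Longrightarrow> c \<in> K \<Longrightarrow> F c \<noteq> 0 \<Longrightarrow>
       ln (norm (F c)) \<ge> - M \<Longrightarrow>
       (\<And>z. z \<in> patch \<Longrightarrow> F z \<noteq> 0 \<Longrightarrow> ln (norm (F z)) \<le> M / (pi - \<bar>Im z\<bar>) powr p) \<Longrightarrow>
       finite T \<Longrightarrow> T \<subseteq> {z. \<bar>Re z\<bar> \<le> 1/2 \<and> \<bar>Im z\<bar> < pi} \<Longrightarrow>
       (\<And>z. z \<in> T \<Longrightarrow> vanishes_to F z (m z)) \<Longrightarrow>
       (\<Sum>z\<in>T. real (m z) * (pi - \<bar>Im z\<bar>) powr (p + 1 + \<epsilon>)) \<le> C * M"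
proof -
  obtain \<psi> \<phi> where \<psi>: "\<psi> holomorphic_on patch" and \<phi>: "\<phi> holomorphic_on ball 0 1"
    and \<psi>p: "\<And>z. z \<in> patch \<Longrightarrow> norm (\<psi> z) < 1 \<and> \<phi> (\<psi> z) = z"
    and \<phi>p: "\<And>w. norm w < 1 \<Longrightarrow> \<phi> w \<in> patch \<and> \<psi> (\<phi> w) = w"
    using patch_riemann_map by metis
  have bdd: "\<exists>\<rho>. 0 \<le> \<rho> \<and> \<rho> < 1 \<and> (\<forall>z\<in>Q. norm (\<psi> z) \<le> \<rho>)" if "compact Q" "Q \<subseteq> patch" for Q
  proof (cases "Q = {}")
    case False
    have "continuous_on Q (\<lambda>z. norm (\<psi> z))"
      by (intro continuous_on_norm continuous_on_subset[OF holomorphic_on_imp_continuous_on[OF \<psi>]] that)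
    from continuous_attains_sup[OF that(1) False this] obtain x where "x \<in> Q"
      "\<forall>z\<in>Q. norm (\<psi> z) \<le> norm (\<psi> x)" by blast
    then show ?thesis using \<psi>p[of x] that by (intro exI[of _ "norm (\<psi> x)"]) auto
  qed (auto intro: exI[of _ 0])
  define c1 where "c1 = min (pi - Im (\<phi> 0)) (pi + Im (\<phi> 0)) / 2"
  have c1: "c1 > 0" using \<phi>p[of 0] by (auto simp: c1_def patch_def)
  have Im\<phi>: "Im (\<phi> w) < pi" "- pi < Im (\<phi> w)" if "norm w < 1" for w
    using \<phi>p[OF that] by (auto simp: patch_def)
  have low: "c1 * (1 - norm w) \<le> pi - \<bar>Im (\<phi> w)\<bar>" if w: "norm w < 1" for w
  proof -
    \<comment> \<open>The real part is pi - Im (\<phi> w), a positive harmonic function; the next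
      inequality treats pi + Im (\<phi> w) in the same way.\<close>
    have "Re (pi + \<i> * \<phi> w) \<ge> Re (pi + \<i> * \<phi> 0) * (1 - dist 0 w / 1) / 2"
      using w by (intro harnack_ball holomorphic_intros \<phi>) (auto simp: less_diff_eq intro: Im\<phi> order_less_trans[OF _ Im\<phi>(2)] dest: Im\<phi>)
    moreover have "Re (pi - \<i> * \<phi> w) \<ge> Re (pi - \<i> * \<phi> 0) * (1 - dist 0 w / 1) / 2"
      using w by (intro harnack_ball holomorphic_intros \<phi>) (auto simp: less_diff_eq intro: Im\<phi> order_less_trans[OF _ Im\<phi>(2)] dest: Im\<phi>)
    moreover have "c1 * (1 - norm w) \<le> (pi - Im (\<phi> 0)) / 2 * (1 - norm w)"
      "c1 * (1 - norm w) \<le> (pi + Im (\<phi> 0)) / 2 * (1 - norm w)"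
      unfolding c1_def using w by (auto intro!: mult_right_mono)
    ultimately show ?thesis by (simp add: abs_if)
  qed
  \<comment> \<open>On this compact core |\<psi>| stays below some \<rho> < 1. Points closer to a
    horizontal side are compared with a point of the core.\<close>
  define Q where "Q = cbox (Complex (-1/2) (-(pi - 1/2))) (Complex (1/2) (pi - 1/2))"
  have "Q \<subseteq> patch" using pi_gt3 by (auto simp: Q_def patch_def in_cbox_complex_iff abs_less_iff)
  then obtain \<rho> where \<rho>: "0 \<le> \<rho>" "\<rho> < 1" "\<And>z. z \<in> Q \<Longrightarrow> norm (\<psi> z) \<le> \<rho>"
    using bdd[of Q] by (auto simp: Q_def compact_cbox)
  define c2 where "c2 = (1 - \<rho>) / pi"
  have c2: "c2 > 0" using \<rho> by (simp add: c2_def)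
  have c2le: "c2 * x \<le> (1 - \<rho>) * x" if "x \<ge> 0" for x
    using that \<rho> pi_gt3 by (intro mult_right_mono) (auto simp: c2_def divide_simps mult_le_cancel_left1)
  have up: "c2 * (pi - \<bar>Im z\<bar>) \<le> 1 - norm (\<psi> z)" if z: "\<bar>Re z\<bar> \<le> 1/2" "\<bar>Im z\<bar> < pi" for z
  proof (cases "\<bar>Im z\<bar> \<le> pi - 1/2")
    case True
    then have "z \<in> Q" using z by (auto simp: Q_def in_cbox_complex_iff)
    then have "norm (\<psi> z) \<le> \<rho>" by (rule \<rho>)
    moreover have "c2 * (pi - \<bar>Im z\<bar>) \<le> c2 * pi" using c2 by (intro mult_left_mono) auto
    ultimately show ?thesis by (simp add: c2_def)
  next
    case False
    \<comment> \<open>The disc of radius 1/2 about \<open>z0\<close> touches the nearer horizontal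
      side at the point closest to \<open>z\<close>, so Harnack's factor is a multiple of pi - |Im
      z|.\<close>
    define z0 where "z0 = Complex (Re z) (sgn (Im z) * (pi - 1/2))"
    have sg: "Im z = sgn (Im z) * \<bar>Im z\<bar>" "\<bar>sgn (Im z)\<bar> = 1"
      using False pi_gt3 by (auto simp: sgn_if)
    have z0: "z0 \<in> Q" using z pi_gt3 by (auto simp: z0_def Q_def in_cbox_complex_iff sgn_if)
    have d: "dist z0 z = \<bar>Im z\<bar> - (pi - 1/2)"
    proof -
      have "z - z0 = Complex 0 (sgn (Im z) * (\<bar>Im z\<bar> - (pi - 1/2)))"
        using sg(1) by (simp add: z0_def complex_eq_iff algebra_simps)
      moreover have "dist z0 z = norm (z - z0)" by (simp add: dist_norm norm_minus_commute)
      ultimately show ?thesis using False sg(2) by (simp add: complex_norm abs_mult)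
    qed
    have sub: "ball z0 (1/2) \<subseteq> patch"
    proof
      fix w assume w: "w \<in> ball z0 (1/2)"
      have "\<bar>Re (w - z0)\<bar> < 1/2" "\<bar>Im (w - z0)\<bar> < 1/2"
        using w abs_Re_le_cmod[of "w - z0"] abs_Im_le_cmod[of "w - z0"] by (auto simp: dist_norm norm_minus_commute)
      moreover have "\<bar>Re z0\<bar> \<le> 1/2" "\<bar>Im z0\<bar> \<le> pi - 1/2" using z0 by (auto simp: Q_def in_cbox_complex_iff)
      ultimately have "\<bar>Re w\<bar> < 1" "\<bar>Im w\<bar> < pi" unfolding minus_complex.simps by linarith+
      then show "w \<in> patch" by (simp add: patch_def)
    qed
    \<comment> \<open>1 - |\<psi>| is not harmonic. After this rotation 1 - Re (u \<psi>) is
      harmonic, dominates 1 - |\<psi>| everywhere and equals it at \<open>z\<close>.\<close>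
    define u where "u = cnj (sgn (\<psi> z))"
    have u: "norm u \<le> 1" "u * \<psi> z = norm (\<psi> z)"
    proof -
      show "norm u \<le> 1" by (simp add: u_def norm_sgn)
      have "u * \<psi> z = (\<psi> z * cnj (\<psi> z)) / norm (\<psi> z)"
        by (simp add: u_def sgn_eq mult.commute)
      also have "\<psi> z * cnj (\<psi> z) = of_real (norm (\<psi> z)) * of_real (norm (\<psi> z))"
        by (simp add: complex_norm_square[symmetric] power2_eq_square)
      finally show "u * \<psi> z = norm (\<psi> z)" by simp
    qed
    have hp: "Re (1 - u * \<psi> w) \<ge> 1 - norm (\<psi> w)" for w
    proof -
      have "Re (u * \<psi> w) \<le> norm u * norm (\<psi> w)" using complex_Re_le_cmod[of "u * \<psi> w"] by (simp add: norm_mult)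
      also have "\<dots> \<le> 1 * norm (\<psi> w)" using u by (intro mult_right_mono) auto
      finally show ?thesis by simp
    qed
    have "Re (1 - u * \<psi> z) \<ge> Re (1 - u * \<psi> z0) * (1 - dist z0 z / (1/2)) / 2"
    proof (rule harnack_ball)
      show "(\<lambda>w. 1 - u * \<psi> w) holomorphic_on ball z0 (1/2)"
        by (intro holomorphic_intros holomorphic_on_subset[OF \<psi> sub])
      show "Re (1 - u * \<psi> w) > 0" if "w \<in> ball z0 (1/2)" for w
        using hp[of w] \<psi>p[of w] that sub by force
      show "z \<in> ball z0 (1/2)" using d z by simp
    qed
    also have "1 - dist z0 z / (1/2) = 2 * (pi - \<bar>Im z\<bar>)" using d by simp
    also have "Re (1 - u * \<psi> z) = 1 - norm (\<psi> z)" using u by simp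
    also have "Re (1 - u * \<psi> z0) * (2 * (pi - \<bar>Im z\<bar>)) / 2 = Re (1 - u * \<psi> z0) * (pi - \<bar>Im z\<bar>)"
      by (simp only: mult.left_commute[of _ 2] nonzero_mult_div_cancel_left[OF zero_neq_numeral[symmetric]])
    finally have "Re (1 - u * \<psi> z0) * (pi - \<bar>Im z\<bar>) \<le> 1 - norm (\<psi> z)" .
    moreover have "(1 - \<rho>) * (pi - \<bar>Im z\<bar>) \<le> Re (1 - u * \<psi> z0) * (pi - \<bar>Im z\<bar>)"
      using hp[of z0] \<rho>(3)[OF z0] z by (intro mult_right_mono) auto
    ultimately show ?thesis using c2le[of "pi - \<bar>Im z\<bar>"] z by linarith
  qed
  obtain r where r: "0 \<le> r" "r < 1" "\<And>z. z \<in> K \<Longrightarrow> norm (\<psi> z) \<le> r" using bdd[OF K] by blast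
  obtain C where C: "C > 0" and disc:
    "\<And>F M w0 S m. F holomorphic_on ball 0 1 \<Longrightarrow> M > 0 \<Longrightarrow> norm w0 \<le> r \<Longrightarrow> F w0 \<noteq> 0 \<Longrightarrow>
       ln (norm (F w0)) \<ge> - M \<Longrightarrow>
       (\<And>w. norm w < 1 \<Longrightarrow> F w \<noteq> 0 \<Longrightarrow> ln (norm (F w)) \<le> M / (1 - norm w) powr p) \<Longrightarrow>
       finite S \<Longrightarrow> S \<subseteq> ball 0 1 \<Longrightarrow> (\<And>a. a \<in> S \<Longrightarrow> vanishes_to F a (m a)) \<Longrightarrow>
       (\<Sum>a\<in>S. real (m a) * (1 - norm a) powr (p + 1 + \<epsilon>)) \<le> C * M"
    using disc_zero_sum[OF p \<epsilon> r(1,2)] by blast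
  \<comment> \<open>One enlarged constant M A serves both the upper bound and the base
    point.\<close>
  define A where "A = max 1 (1 / c1 powr p)"
  define D where "D = c2 powr (p + 1 + \<epsilon>)"
  have D: "D > 0" using c2 by (simp add: D_def)
  have "(\<Sum>z\<in>T. real (m z) * (pi - \<bar>Im z\<bar>) powr (p + 1 + \<epsilon>)) \<le> (C * A / D) * M"
    if F: "F holomorphic_on patch" and M: "M > 0" and c: "c \<in> K" "F c \<noteq> 0" "ln (norm (F c)) \<ge> - M"
      and b: "\<And>z. z \<in> patch \<Longrightarrow> F z \<noteq> 0 \<Longrightarrow> ln (norm (F z)) \<le> M / (pi - \<bar>Im z\<bar>) powr p"
      and T: "finite T" "T \<subseteq> {z. \<bar>Re z\<bar> \<le> 1/2 \<and> \<bar>Im z\<bar> < pi}"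
      and m: "\<And>z. z \<in> T \<Longrightarrow> vanishes_to F z (m z)" for F M c T m
  proof -
    have Tp: "T \<subseteq> patch" using T by (auto simp: patch_def)
    have inj: "inj_on \<psi> T" using Tp \<psi>p by (metis inj_on_inverseI subsetD)
    have MA: "M * 1 \<le> M * A" "M * (1 / c1 powr p) \<le> M * A"
      using M by (intro mult_left_mono; simp add: A_def)+
    have "(\<Sum>a\<in>\<psi> ` T. real ((m \<circ> \<phi>) a) * (1 - norm a) powr (p + 1 + \<epsilon>)) \<le> C * (M * A)"
    proof (rule disc[of "\<lambda>w. F (\<phi> w)" _ "\<psi> c"])
      have "(F \<circ> \<phi>) holomorphic_on ball 0 1"
        by (rule holomorphic_on_compose_gen[OF \<phi> F]) (use \<phi>p in auto)
      then show "(\<lambda>w. F (\<phi> w)) holomorphic_on ball 0 1" by (simp add: o_def)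
      show "0 < M * A" using MA M by linarith
      show "norm (\<psi> c) \<le> r" using r c by auto
      have "c \<in> patch" using c K by auto
      then have pc: "\<phi> (\<psi> c) = c" using \<psi>p by auto
      show "F (\<phi> (\<psi> c)) \<noteq> 0" "- (M * A) \<le> ln (norm (F (\<phi> (\<psi> c))))"
        using c MA unfolding pc by auto
      fix w :: complex assume w: "norm w < 1" "F (\<phi> w) \<noteq> 0"
      have "ln (norm (F (\<phi> w))) \<le> M / (pi - \<bar>Im (\<phi> w)\<bar>) powr p" using b[of "\<phi> w"] \<phi>p w by auto
      also have "\<dots> \<le> M / (c1 * (1 - norm w)) powr p"
        using low[OF w(1)] w c1 p M by (intro divide_powr_left_mono) auto
      also have "\<dots> = M * (1 / c1 powr p) / (1 - norm w) powr p" by (simp add: powr_mult)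
      also have "\<dots> \<le> M * A / (1 - norm w) powr p" using MA by (intro divide_right_mono) auto
      finally show "ln (norm (F (\<phi> w))) \<le> M * A / (1 - norm w) powr p" .
    next
      fix a assume "a \<in> \<psi> ` T"
      then obtain z where z: "z \<in> T" "a = \<psi> z" by auto
      then have "\<phi> a = z" "norm a < 1" using Tp \<psi>p by auto
      then show "vanishes_to (\<lambda>w. F (\<phi> w)) a ((m \<circ> \<phi>) a)"
        using m[OF z(1)] by (intro vanishes_to_compose[OF _ \<phi>]) auto
    qed (use T Tp \<psi>p in auto)
    also have "(\<Sum>a\<in>\<psi> ` T. real ((m \<circ> \<phi>) a) * (1 - norm a) powr (p + 1 + \<epsilon>)) =
      (\<Sum>z\<in>T. real (m z) * (1 - norm (\<psi> z)) powr (p + 1 + \<epsilon>))"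
      unfolding sum.reindex[OF inj] using Tp \<psi>p by (intro sum.cong) auto
    finally have *: "\<dots> \<le> C * (M * A)" .
    have "(\<Sum>z\<in>T. real (m z) * (pi - \<bar>Im z\<bar>) powr (p + 1 + \<epsilon>)) * D =
      (\<Sum>z\<in>T. real (m z) * (c2 * (pi - \<bar>Im z\<bar>)) powr (p + 1 + \<epsilon>))"
      unfolding D_def sum_distrib_right by (intro sum.cong) (auto simp: powr_mult)
    also have "\<dots> \<le> (\<Sum>z\<in>T. real (m z) * (1 - norm (\<psi> z)) powr (p + 1 + \<epsilon>))"
    proof (intro sum_mono mult_left_mono powr_mono2)
      fix z assume "z \<in> T"
      then have "\<bar>Re z\<bar> \<le> 1/2" "\<bar>Im z\<bar> < pi" using T by auto
      then show "c2 * (pi - \<bar>Im z\<bar>) \<le> 1 - norm (\<psi> z)" "0 \<le> c2 * (pi - \<bar>Im z\<bar>)" using up c2 by auto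
    qed (use p \<epsilon> in auto)
    also note *
    finally show ?thesis using D by (simp add: field_simps)
  qed
  note main = this
  show ?thesis
  proof (rule that)
    have "A > 0" by (simp add: A_def)
    then show "C * A / D > 0" using C D by simp
  qed (rule main, assumption+)
qed

section \<open>Two constants theorem and large values on arcs\<close>

text \<open>\<open>b\<close> is the value at \<open>zb\<close> of a harmonic function that vanishes
  on three sides and is at most 1 on the left one. If ln |G| were below L = ln |G zb| / b all along
  the left side, the maximum principle would give ln |G zb| < L b.\<close>

lemma rectangle_two_constants:
  fixes G :: "complex \<Rightarrow> complex" and x0 x1 \<Theta> g b :: real and zb :: complex
  assumes G: "G holomorphic_on U" "open U" "cbox (Complex x1 (- \<Theta>)) (Complex x0 \<Theta>) \<subseteq> U"
    and le1: "\<And>z. z \<in> cbox (Complex x1 (- \<Theta>)) (Complex x0 \<Theta>) \<Longrightarrow> norm (G z) \<le> 1"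
    and \<Theta>: "\<Theta> > 0" and zb: "x1 < Re zb" "Re zb < x0" "\<bar>Im zb\<bar> < \<Theta>" "G zb \<noteq> 0"
    and g: "g = pi / (2 * \<Theta>)"
    and b: "b = cos (g * Im zb) * (exp (g * (x1 - Re zb)) - exp (g * (Re zb + x1 - 2 * x0)))"
  obtains z where "Re z = x1" "\<bar>Im z\<bar> \<le> \<Theta>" "G z \<noteq> 0" "ln (norm (G z)) \<ge> ln (norm (G zb)) / b"
proof (rule ccontr)
  assume "\<not> thesis"
  with that have neg: "\<And>z. Re z = x1 \<Longrightarrow> \<bar>Im z\<bar> \<le> \<Theta> \<Longrightarrow> G z \<noteq> 0 \<Longrightarrow> ln (norm (G z)) < ln (norm (G zb)) / b"
    by force
  define Q where "Q = cbox (Complex x1 (- \<Theta>)) (Complex x0 \<Theta>)"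
  have zbQ: "zb \<in> Q" using zb by (auto simp: Q_def in_cbox_complex_iff)
  have g0: "g > 0" using \<Theta> by (simp add: g)
  have gpi: "\<bar>g * y\<bar> < pi / 2 \<longleftrightarrow> \<bar>y\<bar> < \<Theta>" "\<bar>g * y\<bar> \<le> pi / 2 \<longleftrightarrow> \<bar>y\<bar> \<le> \<Theta>" for y
    using \<Theta> by (auto simp: g abs_mult field_simps)
  have "cos (g * Im zb) > 0" using gpi(1)[of "Im zb"] zb by (intro cos_gt_zero_pi) (auto simp: abs_less_iff)
  moreover have "g * (Re zb + x1 - 2 * x0) < g * (x1 - Re zb)" using g0 zb by (intro mult_strict_left_mono) auto
  ultimately have bpos: "b > 0" unfolding b by (intro mult_pos_pos) auto
  define L where "L = ln (norm (G zb)) / b"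
  have "norm (G zb) \<le> 1" using le1[OF zbQ[unfolded Q_def]] .
  then have L0: "L \<le> 0" unfolding L_def using bpos zb by (simp add: divide_nonpos_pos ln_le_zero_iff)
  define E where "E = cbox (Complex x1 (- \<Theta>)) (Complex x1 \<Theta>)"
  have EQ: "E \<subseteq> Q" using zb by (auto simp: E_def Q_def in_cbox_complex_iff)
  have "compact E" "E \<noteq> {}" "continuous_on E (\<lambda>z. norm (G z))"
    using \<Theta> EQ G unfolding Q_def[symmetric]
    by (auto simp: E_def compact_cbox box_ne_empty Basis_complex_def inner_complex_def
        intro!: continuous_on_norm continuous_on_subset[OF holomorphic_on_imp_continuous_on[OF G(1)]])
  from continuous_attains_sup[OF this] obtain zs where zs: "zs \<in> E" "\<And>z. z \<in> E \<Longrightarrow> norm (G z) \<le> norm (G zs)" by blast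
  \<comment> \<open>Compactness of the left side turns the pointwise strict inequality into a
    uniform one. If G vanishes identically there, any number below L will do.\<close>
  define L' where "L' = (if G zs = 0 then L - 1 else ln (norm (G zs)))"
  have Eiff: "z \<in> E \<longleftrightarrow> Re z = x1 \<and> \<bar>Im z\<bar> \<le> \<Theta>" for z by (auto simp: E_def in_cbox_complex_iff)
  have L': "L' < L" unfolding L'_def L_def using neg[of zs] zs by (auto simp: Eiff)
  have GE: "norm (G z) \<le> exp L'" if "z \<in> E" for z
    using zs(2)[OF that] by (auto simp: L'_def split: if_splits intro: order_trans)
  \<comment> \<open>The choice g = pi/(2 \<Theta>) makes the cosine in Re h vanish on the horizontal
    sides; the second exponential is the reflection in Re z = x0 that makes it vanish there
    too.\<close>
  define h where "h = (\<lambda>z::complex. exp (of_real g * (of_real x1 - z)) - exp (of_real g * (z + of_real x1 - 2 * of_real x0)))"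
  have Reh: "Re (h z) = cos (g * Im z) * (exp (g * (x1 - Re z)) - exp (g * (Re z + x1 - 2 * x0)))" for z
    unfolding h_def by (simp add: Re_exp algebra_simps)
  define H where "H = (\<lambda>z. G z * exp (- of_real L' * h z))"
  have nH: "norm (H z) = norm (G z) * exp (- L' * Re (h z))" for z by (simp add: H_def norm_mult)
  have "H holomorphic_on U" unfolding H_def h_def by (intro holomorphic_intros G)
  then have HQ: "H holomorphic_on Q" using G by (metis Q_def holomorphic_on_subset)
  have "norm (H zb) \<le> 1"
  proof (rule maximum_modulus_frontier[of H Q])
    show "H holomorphic_on interior Q" using HQ interior_subset holomorphic_on_subset by blast
    show "continuous_on (closure Q) H"
      using HQ holomorphic_on_imp_continuous_on by (simp add: Q_def)
    show "bounded Q" by (simp add: Q_def)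
    show "zb \<in> Q" by (rule zbQ)
    fix z assume "z \<in> frontier Q"
    then have zQ: "z \<in> Q" and "z \<notin> box (Complex x1 (- \<Theta>)) (Complex x0 \<Theta>)"
      by (auto simp: Q_def frontier_cbox)
    then consider "\<bar>Im z\<bar> = \<Theta>" | "Re z = x0" | "z \<in> E"
      by (auto simp: Q_def Eiff in_box_complex_iff in_cbox_complex_iff)
    then show "norm (H z) \<le> 1"
    proof cases
      case 1
      then have "g * Im z = pi / 2 \<or> g * Im z = - (pi / 2)" using \<Theta> by (auto simp: g abs_if split: if_splits)
      then have "cos (g * Im z) = 0" by (elim disjE) (simp_all only: cos_minus cos_pi_half)
      then show ?thesis using le1[of z] zQ by (simp add: nH Reh Q_def)
    next
      case 2
      then have "x1 - Re z = Re z + x1 - 2 * x0" by simp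
      then have "Re (h z) = 0" unfolding Reh by simp
      then show ?thesis using le1[of z] zQ by (simp add: nH Q_def)
    next
      case 3
      have "Re (h z) \<le> 1 * 1" unfolding Reh
      proof (rule mult_mono)
        show "exp (g * (x1 - Re z)) - exp (g * (Re z + x1 - 2 * x0)) \<le> 1" using 3 by (simp add: Eiff)
        have "g * (Re z + x1 - 2 * x0) \<le> g * (x1 - Re z)" using 3 zb g0 by (intro mult_left_mono) (auto simp: Eiff)
        then show "0 \<le> exp (g * (x1 - Re z)) - exp (g * (Re z + x1 - 2 * x0))" by simp
      qed auto
      then have "- L' * Re (h z) \<le> - L' * 1" using L' L0 by (intro mult_left_mono) auto
      then have "norm (H z) \<le> exp L' * exp (- L')" unfolding nH using GE[OF 3] by (intro mult_mono) auto
      then show ?thesis by (simp add: exp_minus)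
    qed
  qed
  then have "ln (norm (H zb)) \<le> 0" using zb by (simp add: nH ln_le_zero_iff)
  then have "ln (norm (G zb)) - L' * b \<le> 0" using zb unfolding nH by (simp add: ln_mult Reh b)
  moreover have "L' * b < L * b" using L' bpos by simp
  ultimately show False using bpos by (simp add: L_def)
qed

text \<open>The maximum principle gives a point \<open>ws\<close> at which the product over all
  rotations is at least |F c|^k. One rotation of \<open>ws\<close> falls near \<open>t\<close>, and
  the other k - 1 factors are at most exp L each. The loss depends on the arc length through k, but
  not on F.\<close>

lemma sphere_lower_bound_near:
  fixes F :: "complex \<Rightarrow> complex" and k :: nat and L :: real
  assumes F: "F holomorphic_on cball c r" and r: "r > 0" and Fc: "F c \<noteq> 0"
    and L: "\<And>w. dist c w = r \<Longrightarrow> F w \<noteq> 0 \<Longrightarrow> ln (norm (F w)) \<le> L"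
    and t: "dist c t = r" and k: "k > 0"
  obtains w where "dist c w = r" "dist t w \<le> 2 * pi * r / k" "F w \<noteq> 0"
    "ln (norm (F w)) \<ge> k * ln (norm (F c)) - (real k - 1) * L"
proof -
  define \<omega> where "\<omega> = (\<lambda>j::nat. cis (2 * pi * j / k))"
  define R where "R = (\<lambda>j w. c + \<omega> j * (w - c))"
  have dR: "dist c (R j w) = dist c w" for j w
    by (simp add: R_def dist_norm norm_mult \<omega>_def norm_minus_commute)
  define G where "G = (\<lambda>w. \<Prod>j<k. F (R j w))"
  have G: "G holomorphic_on cball c r" unfolding G_def
  proof (intro holomorphic_on_prod)
    fix j
    have "(F \<circ> R j) holomorphic_on cball c r"
      by (rule holomorphic_on_compose_gen[OF _ F]) (auto simp: dR, auto simp: R_def intro!: holomorphic_intros)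
    then show "(\<lambda>w. F (R j w)) holomorphic_on cball c r" by (simp add: o_def)
  qed
  have "compact (sphere c r)" "sphere c r \<noteq> {}" "continuous_on (sphere c r) (\<lambda>w. norm (G w))"
    using r t by (auto intro!: continuous_on_norm holomorphic_on_imp_continuous_on holomorphic_on_subset[OF G])
  from continuous_attains_sup[OF this] obtain ws where ws: "dist c ws = r"
    "\<And>w. w \<in> sphere c r \<Longrightarrow> norm (G w) \<le> norm (G ws)" by auto
  have "norm (G c) \<le> norm (G ws)"
  proof (rule maximum_modulus_frontier[of G "cball c r"])
    show "G holomorphic_on interior (cball c r)" using G interior_subset holomorphic_on_subset by blast
    show "continuous_on (closure (cball c r)) G" using G holomorphic_on_imp_continuous_on by simp
  qed (use ws r in \<open>auto simp: frontier_cball\<close>)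
  moreover have "G c = F c ^ k" by (simp add: G_def R_def)
  ultimately have Gws: "norm (F c) ^ k \<le> (\<Prod>j<k. norm (F (R j ws)))"
    by (simp add: norm_power G_def prod_norm)
  have Fne: "F (R j ws) \<noteq> 0" if "j < k" for j
  proof
    assume "F (R j ws) = 0"
    then have "(\<Prod>j<k. norm (F (R j ws))) = 0" using that by (intro prod_zero) auto
    moreover have "norm (F c) ^ k > 0" using Fc by simp
    ultimately show False using Gws by linarith
  qed
  have "ln (norm (F c) ^ k) \<le> ln (\<Prod>j<k. norm (F (R j ws)))"
    using Gws Fc by (intro ln_mono) auto
  also have "\<dots> = (\<Sum>j<k. ln (norm (F (R j ws))))" using Fne by (intro ln_prod) auto
  finally have s: "k * ln (norm (F c)) \<le> (\<Sum>j<k. ln (norm (F (R j ws))))" using Fc by (simp add: ln_realpow)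
  \<comment> \<open>The angle from \<open>ws\<close> to \<open>t\<close>. Rounding it down to a
    multiple of 2 pi / k selects the rotation, and the chord is no longer than the remaining
    arc.\<close>
  define \<theta> where "\<theta> = Arg2pi ((t - c) / (ws - c))"
  define i where "i = nat \<lfloor>\<theta> * k / (2 * pi)\<rfloor>"
  have \<theta>: "0 \<le> \<theta>" "\<theta> < 2 * pi" by (auto simp: \<theta>_def Arg2pi_ge_0 Arg2pi_lt_2pi)
  have n1: "norm ((t - c) / (ws - c)) = 1" using t ws r by (simp add: norm_divide dist_norm norm_minus_commute)
  have "(t - c) / (ws - c) = cis \<theta>"
    using Arg2pi_eq[of "(t - c) / (ws - c)"] n1 by (simp add: \<theta>_def cis_conv_exp)
  moreover have "ws \<noteq> c" using ws r by auto
  ultimately have te: "t - c = cis \<theta> * (ws - c)" by (simp add: field_simps)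
  have fl: "real i \<le> \<theta> * k / (2 * pi)" "\<theta> * k / (2 * pi) < real i + 1"
  proof -
    have "0 \<le> \<theta> * k / (2 * pi)" using \<theta> by simp
    then have "real i = of_int \<lfloor>\<theta> * k / (2 * pi)\<rfloor>" unfolding i_def by (simp only: zero_le_floor of_nat_nat)
    then show "real i \<le> \<theta> * k / (2 * pi)" "\<theta> * k / (2 * pi) < real i + 1" by linarith+
  qed
  have "\<theta> * k / (2 * pi) < k" using \<theta> k by (simp add: field_simps)
  then have ik: "i < k" using fl by linarith
  have "dist t (R i ws) = norm (\<omega> i * (ws - c) - cis \<theta> * (ws - c))"
  proof -
    have "R i ws - t = \<omega> i * (ws - c) - (t - c)" by (simp add: R_def)
    then show ?thesis unfolding te dist_norm by (metis norm_minus_commute)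
  qed
  also have "\<dots> = norm (cis \<theta> * (cis (2 * pi * i / k - \<theta>) - 1)) * r"
  proof -
    have "\<omega> i = cis \<theta> * cis (2 * pi * i / k - \<theta>)" by (simp add: \<omega>_def cis_mult)
    then have "\<omega> i * (ws - c) - cis \<theta> * (ws - c) = cis \<theta> * (cis (2 * pi * i / k - \<theta>) - 1) * (ws - c)"
      by (simp only: algebra_simps mult_1_left mult_1_right)
    moreover have "norm (ws - c) = r" using ws(1) by (simp add: dist_norm norm_minus_commute)
    ultimately show ?thesis by (simp only: norm_mult)
  qed
  also have "\<dots> = 2 * \<bar>sin ((2 * pi * i / k - \<theta>) / 2)\<bar> * r"
    using dist_exp_i_1[of "2 * pi * i / k - \<theta>"] by (simp add: norm_mult cis_conv_exp)
  also have "\<dots> \<le> 2 * \<bar>(2 * pi * i / k - \<theta>) / 2\<bar> * r"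
    using r by (intro mult_right_mono mult_left_mono abs_sin_x_le_abs_x) auto
  also have "\<dots> \<le> 2 * pi / k * r"
  proof (intro mult_right_mono)
    have "real i * (2 * pi / k) \<le> \<theta> * k / (2 * pi) * (2 * pi / k)"
      using fl by (intro mult_right_mono) auto
    moreover have "\<theta> * k / (2 * pi) * (2 * pi / k) \<le> (real i + 1) * (2 * pi / k)"
      using fl by (intro mult_right_mono) auto
    moreover have "\<theta> * k / (2 * pi) * (2 * pi / k) = \<theta>" using k by simp
    moreover have "2 * pi * i / k = real i * (2 * pi / k)"
      "(real i + 1) * (2 * pi / k) = real i * (2 * pi / k) + 2 * pi / k" by (simp, simp only: distrib_right mult_1_left)
    ultimately have "\<bar>2 * pi * i / k - \<theta>\<bar> \<le> 2 * pi / k" by argo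
    then show "2 * \<bar>(2 * pi * i / k - \<theta>) / 2\<bar> \<le> 2 * pi / k" by simp
  qed (use r in auto)
  finally have d: "dist t (R i ws) \<le> 2 * pi * r / k" by simp
  have "(\<Sum>j<k. ln (norm (F (R j ws)))) = ln (norm (F (R i ws))) + (\<Sum>j\<in>{..<k} - {i}. ln (norm (F (R j ws))))"
    using ik by (intro sum.remove) auto
  also have "(\<Sum>j\<in>{..<k} - {i}. ln (norm (F (R j ws)))) \<le> (\<Sum>j\<in>{..<k} - {i}. L)"
    using Fne L dR ws by (intro sum_mono) auto
  also have "\<dots> = (real k - 1) * L" using ik k by (simp add: of_nat_diff)
  finally show ?thesis using that[of "R i ws"] d dR ws Fne[OF ik] s by (simp add: of_nat_diff k)
qed

lemma ex_nat_divide_less: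
  fixes a \<eta> :: real
  assumes "a > 0" "\<eta> > 0" shows "\<exists>k::nat. k > 0 \<and> a / k < \<eta>"
proof -
  obtain k :: nat where k: "a / \<eta> < k" using reals_Archimedean2 by blast
  moreover have "a / \<eta> > 0" using assms by simp
  ultimately have "real k > 0" by linarith
  then show ?thesis using k assms by (intro exI[of _ k]) (auto simp: field_simps)
qed

section \<open>The bands, admissible functions and controlled sets\<close>

locale finite_bands =
  fixes n :: nat and \<alpha> \<beta> :: "nat \<Rightarrow> real" and p q \<epsilon> :: real
  assumes ab: "\<And>j. j \<le> n \<Longrightarrow> \<alpha> j < \<beta> j" and ba: "\<And>j. j < n \<Longrightarrow> \<beta> j < \<alpha> (Suc j)"
    and p0: "p \<ge> 0" and q0: "q \<ge> 0" and e0: "0 < \<epsilon>" and e1: "\<epsilon> < 1"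
begin

abbreviation E :: "complex set" where "E \<equiv> frak_e n \<alpha> \<beta>"
abbreviation V :: "complex set" where "V \<equiv> endpts n \<alpha> \<beta>"

definition wt :: "complex \<Rightarrow> real" where
  "wt z = infdist z E powr (p + 1 + \<epsilon>) * infdist z V powr exp_a p q \<epsilon> * (1 + norm z) powr exp_b p q \<epsilon>"

text \<open>Points with f z = 0 are exempt from the bound because \<open>ln 0\<close> is 0 in HOL,
  whereas log |f| is minus infinity there.\<close>

definition adm :: "(complex \<Rightarrow> complex) \<Rightarrow> real \<Rightarrow> bool" where
  "adm f K \<longleftrightarrow> (\<exists>c. analytic_ext_at_inf f E c \<and> norm c = 1) \<and> K > 0 \<and>
     (\<forall>z. z \<notin> E \<longrightarrow> f z \<noteq> 0 \<longrightarrow> ln (norm (f z)) \<le> K / (infdist z E powr p * infdist z V powr q))"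

text \<open>C is chosen before f and K. Finite sums avoid questions of summability, and points of S
  that are not zeros contribute order 0. The property passes to subsets and finite unions, which
  allows a compactness argument.\<close>

definition controlled :: "complex set \<Rightarrow> bool" where
  "controlled N \<longleftrightarrow> (\<exists>C. \<forall>f K S. adm f K \<longrightarrow> finite S \<longrightarrow> S \<subseteq> N - E \<longrightarrow>
     (\<Sum>z\<in>S. real (nat (zorder f z)) * wt z) \<le> C * K)"

lemma E_eq: "E = (\<Union>j\<le>n. complex_of_real ` {\<alpha> j..\<beta> j})"
  by (auto simp: frak_e_def)

lemma compact_E: "compact E"
  unfolding E_eq by (intro compact_UN compact_continuous_image continuous_intros) auto

lemma closed_E: "closed E" using compact_E compact_imp_closed by blast

lemma finite_V: "finite V" by (auto simp: endpts_def)

lemma V_subset_E: "V \<subseteq> E"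
  using ab less_imp_le by (fastforce simp: endpts_def frak_e_def)

lemma endpoints_in_V: "j \<le> n \<Longrightarrow> of_real (\<alpha> j) \<in> V" "j \<le> n \<Longrightarrow> of_real (\<beta> j) \<in> V"
  by (auto simp: endpts_def)

lemma V_nonempty: "V \<noteq> {}" and E_nonempty: "E \<noteq> {}"
  using endpoints_in_V[of 0] V_subset_E by auto

lemma E_real: "z \<in> E \<Longrightarrow> Im z = 0"
  by (auto simp: frak_e_def)

lemma infdist_E_pos: "z \<notin> E \<Longrightarrow> infdist z E > 0"
  using in_closed_iff_infdist_zero[OF closed_E E_nonempty] infdist_nonneg[of z E]
  by (metis less_eq_real_def)

lemma infdist_V_pos: "z \<notin> V \<Longrightarrow> infdist z V > 0"
  using in_closed_iff_infdist_zero[OF finite_imp_closed[OF finite_V] V_nonempty] infdist_nonneg[of z V]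
  by (metis less_eq_real_def)

lemma infdist_E_le_V: "infdist z E \<le> infdist z V"
  using infdist_mono[OF V_subset_E V_nonempty] by simp

lemma infdist_E_ge_Im: "\<bar>Im z\<bar> \<le> infdist z E"
proof -
  have "\<bar>Im z\<bar> \<le> dist z a" if "a \<in> E" for a
    using abs_Im_le_cmod[of "z - a"] E_real[OF that] by (simp add: dist_norm)
  then show ?thesis using E_nonempty by (simp add: infdist_def cINF_greatest)
qed

text \<open>The open half-planes are joined through a small disc about a real point outside
  \<open>E\<close>. All these unions contain the imaginary unit, so their union is connected; a real
  point outside \<open>E\<close> exists by boundedness.\<close>

lemma connected_compl_E: "connected (- E)"
proof (cases "\<exists>x. x \<in> - E \<and> Im x = 0")
  case True
  define A where "A = {z. Im z > 0}"
  define B where "B = {z. Im z < 0}"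
  have AB: "connected A" "connected B"
    by (auto simp: A_def B_def convex_connected convex_halfspace_Im_gt convex_halfspace_Im_lt)
  have "\<exists>r>0. ball x r \<subseteq> - E" if "x \<in> - E" for x
    using that closed_E open_contains_ball[of "- E"] by blast
  then obtain r where r: "\<And>x. x \<in> - E \<Longrightarrow> r x > 0 \<and> ball x (r x) \<subseteq> - E" by metis
  define I where "I = {x. x \<in> - E \<and> Im x = 0}"
  define W where "W = (\<lambda>x. A \<union> ball x (r x) \<union> B)"
  have W: "connected (W x)" if "x \<in> I" for x
  proof -
    have "r x > 0" using r that by (auto simp: I_def)
    then have "x + of_real (r x / 2) * \<i> \<in> A" "x - of_real (r x / 2) * \<i> \<in> B"
      using that by (auto simp: A_def B_def I_def)
    moreover have "x + of_real (r x / 2) * \<i> \<in> ball x (r x)" "x - of_real (r x / 2) * \<i> \<in> ball x (r x)"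
      unfolding mem_ball dist_norm using \<open>r x > 0\<close> by (simp_all add: norm_mult norm_divide)
    ultimately have ne: "A \<inter> ball x (r x) \<noteq> {}" "(A \<union> ball x (r x)) \<inter> B \<noteq> {}" by blast+
    then have "connected (A \<union> ball x (r x))" using AB by (intro connected_Un) auto
    then show ?thesis unfolding W_def using AB ne by (intro connected_Un) auto
  qed
  have "connected (\<Union>x\<in>I. W x)"
  proof (rule connected_Union)
    have "\<i> \<in> W x" for x by (auto simp: W_def A_def)
    then show "\<Inter> (W ` I) \<noteq> {}" by blast
  qed (use W in auto)
  moreover have "(\<Union>x\<in>I. W x) = - E"
  proof
    show "(\<Union>x\<in>I. W x) \<subseteq> - E" using r E_real by (fastforce simp: W_def I_def A_def B_def)
    show "- E \<subseteq> (\<Union>x\<in>I. W x)"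
    proof
      fix z assume z: "z \<in> - E"
      show "z \<in> (\<Union>x\<in>I. W x)"
      proof (cases "Im z = 0")
        case True
        then show ?thesis using z r[OF z] by (intro UN_I[of z]) (auto simp: I_def W_def)
      next
        case False
        obtain x where "x \<in> I" using \<open>\<exists>x. x \<in> - E \<and> Im x = 0\<close> by (auto simp: I_def)
        then show ?thesis using False by (intro UN_I[of x]) (auto simp: W_def A_def B_def)
      qed
    qed
  qed
  ultimately show ?thesis by simp
next
  case False
  obtain R where R: "\<And>z. z \<in> E \<Longrightarrow> norm z \<le> R"
    using compact_E compact_imp_bounded bounded_iff by metis
  have "of_real (\<bar>R\<bar> + 1) \<in> - E" using R[of "of_real (\<bar>R\<bar> + 1)"] by auto
  then show ?thesis using False by fastforce
qed

lemma adm_holomorphic: "adm f K \<Longrightarrow> f holomorphic_on - E"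
  by (auto simp: adm_def analytic_ext_at_inf_def)

lemma adm_pos: "adm f K \<Longrightarrow> K > 0"
  by (auto simp: adm_def)

lemma adm_le: "adm f K \<Longrightarrow> z \<notin> E \<Longrightarrow> f z \<noteq> 0 \<Longrightarrow>
    ln (norm (f z)) \<le> K / (infdist z E powr p * infdist z V powr q)"
  unfolding adm_def by blast

text \<open>The hypothesis provides an extension near w = 0 only, on a disc depending on f. Gluing
  it to f(1/w) gives a disc whose radius depends on \<open>E\<close> alone, as uniform constants
  require.\<close>

lemma adm_at_infinity:
  assumes f: "adm f K" and R: "R > 0" "E \<subseteq> ball 0 R"
  obtains F where "F holomorphic_on ball 0 (1 / R)" "norm (F 0) = 1"
    "\<And>w. w \<noteq> 0 \<Longrightarrow> norm w < 1 / R \<Longrightarrow> inverse w \<notin> E \<and> F w = f (inverse w)"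
proof -
  obtain c r g where c: "norm c = 1" and r: "r > 0" and g: "g holomorphic_on ball 0 r" "g 0 = c"
     "\<And>w. w \<in> ball 0 r - {0} \<Longrightarrow> g w = f (inverse w)"
    using f unfolding adm_def analytic_ext_at_inf_def by blast
  define F where "F = (\<lambda>w. if w = 0 then c else f (inverse w))"
  have nE: "inverse w \<notin> E" if "w \<noteq> 0" "norm w < 1 / R" for w
  proof
    assume "inverse w \<in> E"
    then have "inverse (norm w) < R" using R by (auto simp: norm_inverse)
    moreover have "norm w > 0" using that by simp
    ultimately show False using that R by (simp add: field_simps)
  qed
  have "F holomorphic_on ball 0 r"
    by (rule holomorphic_transform[OF g(1)]) (use g in \<open>auto simp: F_def\<close>)
  moreover have "F holomorphic_on (ball 0 (1 / R) - {0})"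
  proof -
    have "(f \<circ> inverse) holomorphic_on (ball 0 (1 / R) - {0})"
      by (rule holomorphic_on_compose_gen[OF _ adm_holomorphic[OF f]])
        (auto intro!: holomorphic_intros dest: nE)
    then show ?thesis by (rule holomorphic_transform) (auto simp: F_def)
  qed
  ultimately have "F holomorphic_on (ball 0 r \<union> (ball 0 (1 / R) - {0}))"
    by (intro holomorphic_on_Un) (auto simp: open_delete)
  then have "F holomorphic_on ball 0 (1 / R)"
    by (rule holomorphic_on_subset) (use r in auto)
  then show ?thesis by (rule that) (use c nE in \<open>auto simp: F_def\<close>)
qed

lemma E_bounded: obtains R where "R > 0" "E \<subseteq> ball 0 R"
proof -
  obtain R where "\<And>z. z \<in> E \<Longrightarrow> norm z \<le> R"
    using compact_E compact_imp_bounded bounded_iff by metis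
  then have "E \<subseteq> ball 0 (\<bar>R\<bar> + 1)" by force
  then show ?thesis using that[of "\<bar>R\<bar> + 1"] by simp
qed

lemma adm_nonzero:
  assumes "adm f K" shows "\<exists>z\<in>- E. f z \<noteq> 0"
proof -
  obtain R where R: "R > 0" "E \<subseteq> ball 0 R" by (rule E_bounded)
  obtain F where F: "F holomorphic_on ball 0 (1 / R)" "norm (F 0) = 1"
    "\<And>w. w \<noteq> 0 \<Longrightarrow> norm w < 1 / R \<Longrightarrow> inverse w \<notin> E \<and> F w = f (inverse w)"
    using adm_at_infinity[OF assms R] by blast
  have "continuous_on (ball 0 (1 / R)) F" using F holomorphic_on_imp_continuous_on by blast
  then have "continuous (at 0) F" using R by (simp add: continuous_on_eq_continuous_at)
  moreover have "F 0 \<noteq> 0" using F by auto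
  ultimately have "\<forall>\<^sub>F w in at 0. F w \<noteq> 0"
    by (simp add: continuous_at tendsto_imp_eventually_ne)
  then obtain d where d: "d > 0" "\<And>w. w \<noteq> 0 \<Longrightarrow> dist w 0 < d \<Longrightarrow> F w \<noteq> 0"
    unfolding eventually_at by auto
  define w :: complex where "w = of_real (min (d / 2) (1 / (2 * R)))"
  have "w \<noteq> 0" "norm w < d" "norm w < 1 / R" using d R by (auto simp: w_def min_def field_simps)
  then show ?thesis using d(2)[of w] F(3)[of w] by auto
qed

lemma adm_vanishes: "adm f K \<Longrightarrow> z \<notin> E \<Longrightarrow> vanishes_to f z (nat (zorder f z))"
  by (rule vanishes_to_zorder[OF adm_holomorphic _ connected_compl_E _ adm_nonzero])
    (auto intro: closed_E)

lemma adm_bounded_on_compact: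
  assumes Q: "compact Q" "Q \<subseteq> - E"
  obtains B where "B > 0" "\<And>f K z. adm f K \<Longrightarrow> z \<in> Q \<Longrightarrow> f z \<noteq> 0 \<Longrightarrow> ln (norm (f z)) \<le> B * K"
proof -
  define b where "b = (\<lambda>z. 1 / (infdist z E powr p * infdist z V powr q))"
  have ne: "infdist z E > 0" "infdist z V > 0" if "z \<in> Q" for z
    using that Q infdist_E_pos[of z] infdist_E_le_V[of z] by auto
  have "continuous_on Q b" unfolding b_def
    using ne by (intro continuous_intros) (auto simp: less_imp_neq[symmetric])
  then have "bounded (b ` Q)" using Q by (simp add: compact_continuous_image compact_imp_bounded)
  then obtain B where B: "B > 0" "\<And>z. z \<in> Q \<Longrightarrow> norm (b z) \<le> B" by (auto simp: bounded_pos)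
  show ?thesis
  proof (rule that[OF B(1)])
    fix f K z assume f: "adm f K" "z \<in> Q" "f z \<noteq> 0"
    have "ln (norm (f z)) \<le> b z * K" using adm_le[of f K z] f Q by (auto simp: b_def)
    also have "\<dots> \<le> B * K" using B(2)[of z] f adm_pos[of f K] by (intro mult_right_mono) auto
    finally show "ln (norm (f z)) \<le> B * K" .
  qed
qed

section \<open>Large values near every point of the domain\<close>

text \<open>f may vanish at \<open>z\<close> itself, so a large value is asked for only somewhere in
  each neighbourhood. C may depend on \<open>z\<close> and \<eta>, but not on f or K.\<close>

definition reach :: "complex \<Rightarrow> bool" where
  "reach z \<longleftrightarrow> (\<forall>\<eta>>0. \<exists>C>0. \<forall>f K. adm f K \<longrightarrow>
     (\<exists>w\<in>ball z \<eta>. w \<notin> E \<and> f w \<noteq> 0 \<and> ln (norm (f w)) \<ge> - (C * K)))"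

lemma reachD:
  assumes "reach z" "\<eta> > 0"
  obtains C where "C > 0" "\<And>f K. adm f K \<Longrightarrow>
     \<exists>w\<in>ball z \<eta>. w \<notin> E \<and> f w \<noteq> 0 \<and> ln (norm (f w)) \<ge> - (C * K)"
  using assms unfolding reach_def by blast

text \<open>In the coordinate w = 1/z the centre value has modulus 1, so its logarithm is 0; the arc
  estimate on |w| = 1/(2R) gives large values near the point 2R.\<close>

lemma reach_from_infinity: "\<exists>z. z \<notin> E \<and> reach z"
proof -
  obtain R where R: "R > 0" "E \<subseteq> ball 0 R" by (rule E_bounded)
  define t where "t = 1 / (2 * R)"
  have t: "t > 0" using R by (simp add: t_def)
  have sE: "sphere 0 (2 * R) \<subseteq> - E" using R by fastforce
  obtain B where B: "B > 0" "\<And>f K z. adm f K \<Longrightarrow> z \<in> sphere 0 (2 * R) \<Longrightarrow> f z \<noteq> 0 \<Longrightarrow> ln (norm (f z)) \<le> B * K"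
    using adm_bounded_on_compact[OF compact_sphere sE] by metis
  have "reach (of_real (2 * R))" unfolding reach_def
  proof (intro allI impI)
    fix \<eta> :: real assume \<eta>: "\<eta> > 0"
    obtain k :: nat where kp: "k > 0" "2 * pi / t / k < \<eta>"
      using ex_nat_divide_less[of "2 * pi / t" \<eta>] t \<eta> by auto
    show "\<exists>C>0. \<forall>f K. adm f K \<longrightarrow>
      (\<exists>w\<in>ball (of_real (2 * R)) \<eta>. w \<notin> E \<and> f w \<noteq> 0 \<and> ln (norm (f w)) \<ge> - (C * K))"
    proof (intro exI[of _ "k * B"] conjI allI impI)
      show "0 < real k * B" using kp B by simp
      fix f K assume f: "adm f K"
      obtain F where F: "F holomorphic_on ball 0 (1 / R)" "norm (F 0) = 1"
        "\<And>w. w \<noteq> 0 \<Longrightarrow> norm w < 1 / R \<Longrightarrow> inverse w \<notin> E \<and> F w = f (inverse w)"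
        using adm_at_infinity[OF f R] by blast
      have tR: "t < 1 / R" using R by (simp add: t_def field_simps)
      have ti: "inverse t = 2 * R" using R by (simp add: t_def)
      have on: "w \<noteq> 0 \<and> norm w < 1 / R \<and> inverse w \<in> sphere 0 (2 * R)" if "dist 0 w = t" for w :: complex
        using that tR t ti by (auto simp: norm_inverse)
      obtain w where w: "dist 0 w = t" "dist (of_real t) w \<le> 2 * pi * t / k" "F w \<noteq> 0"
        "ln (norm (F w)) \<ge> k * ln (norm (F 0)) - (real k - 1) * (B * K)"
      proof (rule sphere_lower_bound_near[of F 0 t "B * K" "of_real t" k])
        show "F holomorphic_on cball 0 t" using tR by (intro holomorphic_on_subset[OF F(1)]) auto
        show "ln (norm (F w)) \<le> B * K" if "dist 0 w = t" "F w \<noteq> 0" for w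
          using on[OF that(1)] F(3)[of w] B(2)[OF f, of "inverse w"] that by auto
      qed (use F t kp in auto)
      have Fw: "inverse w \<notin> E" "F w = f (inverse w)" using on[OF w(1)] F(3) by auto
      have w0: "w \<noteq> 0" "norm w = t" using w(1) t by auto
      have "dist (of_real (2 * R)) (inverse w) < \<eta>"
      proof -
        \<comment> \<open>Inversion stretches distances on this circle by 1/t^2, which is why k was
          chosen from 2 pi / t.\<close>
        have "of_real (2 * R) - inverse w = (w - of_real t) / (of_real t * w)"
          unfolding ti[symmetric] using t w0(1) by (simp add: field_simps)
        then have "dist (of_real (2 * R)) (inverse w) = dist (of_real t) w / (t * t)"
          using t w0(2) by (simp add: dist_norm norm_divide norm_mult norm_minus_commute)
        also have "\<dots> \<le> 2 * pi * t / k / (t * t)" using w(2) t by (intro divide_right_mono) auto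
        also have "\<dots> = 2 * pi / t / k" using t kp by (simp add: field_simps)
        finally show ?thesis using kp by simp
      qed
      moreover have "(real k - 1) * (B * K) \<le> k * (B * K)" using B adm_pos[OF f] by (intro mult_right_mono) auto
      then have "ln (norm (f (inverse w))) \<ge> - (k * B * K)" using w(4) F(2) Fw by simp
      ultimately show "\<exists>w\<in>ball (of_real (2 * R)) \<eta>. w \<notin> E \<and> f w \<noteq> 0 \<and> ln (norm (f w)) \<ge> - (k * B * K)"
        using Fw w(3) by (intro bexI[of _ "inverse w"]) auto
    qed
  qed
  moreover have "of_real (2 * R) \<notin> E" using sE R by auto
  ultimately show ?thesis by blast
qed

text \<open>The arc estimate is applied to the circle about a good point \<open>w0\<close> near
  \<open>z1\<close> that passes through \<open>z2\<close>. With the fractions \<rho>/8 its centre is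
  within \<rho>/4 of \<open>z0\<close> and its radius below 3 \<rho>/8, so it stays in the closed
  disc where f is bounded.\<close>

lemma reach_step:
  assumes \<rho>: "\<rho> > 0" "cball z0 \<rho> \<subseteq> - E" and z: "z1 \<in> ball z0 (\<rho>/8)" "z2 \<in> ball z0 (\<rho>/8)" and r: "reach z1"
  shows "reach z2"
  unfolding reach_def
proof (intro allI impI)
  fix \<eta> :: real assume \<eta>: "\<eta> > 0"
  obtain B where B: "B > 0" "\<And>f K z. adm f K \<Longrightarrow> z \<in> cball z0 \<rho> \<Longrightarrow> f z \<noteq> 0 \<Longrightarrow> ln (norm (f z)) \<le> B * K"
    using adm_bounded_on_compact[OF compact_cball \<rho>(2)] by metis
  obtain C where C: "C > 0" "\<And>f K. adm f K \<Longrightarrow>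
     \<exists>w\<in>ball z1 (\<rho>/8). w \<notin> E \<and> f w \<noteq> 0 \<and> ln (norm (f w)) \<ge> - (C * K)"
    using reachD[OF r, of "\<rho>/8"] \<rho> by auto
  obtain k :: nat where kp: "k > 0" "2 * pi * \<rho> / k < \<eta>"
    using ex_nat_divide_less[of "2 * pi * \<rho>" \<eta>] \<rho> \<eta> by auto
  show "\<exists>C>0. \<forall>f K. adm f K \<longrightarrow> (\<exists>w\<in>ball z2 \<eta>. w \<notin> E \<and> f w \<noteq> 0 \<and> ln (norm (f w)) \<ge> - (C * K))"
  proof (intro exI[of _ "k * (C + B)"] conjI allI impI)
    show "0 < k * (C + B)" using kp C B by simp
    fix f K assume f: "adm f K"
    obtain w0 where w0: "w0 \<in> ball z1 (\<rho>/8)" "w0 \<notin> E" "f w0 \<noteq> 0" "ln (norm (f w0)) \<ge> - (C * K)"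
      using C(2)[OF f] by blast
    have K: "K > 0" by (rule adm_pos[OF f])
    have d: "dist z0 w0 < \<rho>/4" using z w0 dist_triangle[of z0 w0 z1] by simp
    define s where "s = dist w0 z2"
    have s: "s < 3 * \<rho> / 8" using d z dist_triangle[of w0 z2 z0] by (simp add: s_def dist_commute)
    have sub: "cball w0 s \<subseteq> cball z0 \<rho>"
    proof
      fix w assume "w \<in> cball w0 s"
      then show "w \<in> cball z0 \<rho>" using d s \<rho>(1) dist_triangle[of z0 w w0] by simp
    qed
    show "\<exists>w\<in>ball z2 \<eta>. w \<notin> E \<and> f w \<noteq> 0 \<and> ln (norm (f w)) \<ge> - (k * (C + B) * K)"
    proof (cases "s = 0")
      case True
      then have "w0 = z2" by (simp add: s_def)
      moreover have "1 * (C * K) \<le> k * ((C + B) * K)" using kp C B K by (intro mult_mono) auto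
      ultimately show ?thesis using w0 \<eta> by (intro bexI[of _ w0]) auto
    next
      case False
      then have sp: "s > 0" by (simp add: s_def)
      obtain w where w: "dist w0 w = s" "dist z2 w \<le> 2 * pi * s / k" "f w \<noteq> 0"
        "ln (norm (f w)) \<ge> k * ln (norm (f w0)) - (real k - 1) * (B * K)"
      proof (rule sphere_lower_bound_near[of f w0 s "B * K" z2 k])
        show "f holomorphic_on cball w0 s"
          using sub \<rho> by (intro holomorphic_on_subset[OF adm_holomorphic[OF f]]) auto
        show "ln (norm (f w)) \<le> B * K" if "dist w0 w = s" "f w \<noteq> 0" for w
          using B(2)[OF f, of w] that sub by auto
      qed (use w0 sp kp in \<open>auto simp: s_def\<close>)
      have "2 * pi * s / k \<le> 2 * pi * \<rho> / k" using s \<rho> by (intro divide_right_mono mult_left_mono) auto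
      then have "dist z2 w < \<eta>" using w(2) kp by linarith
      moreover have "w \<notin> E" using w(1) sub \<rho> by auto
      moreover have "- (k * (C + B) * K) \<le> k * ln (norm (f w0)) - (real k - 1) * (B * K)"
      proof -
        have "k * (- (C * K)) \<le> k * ln (norm (f w0))" using w0 by (intro mult_left_mono) auto
        moreover have "(real k - 1) * (B * K) \<le> k * (B * K)" using B K by (intro mult_right_mono) auto
        ultimately show ?thesis by (simp add: algebra_simps)
      qed
      ultimately show ?thesis using w by (intro bexI[of _ w]) auto
    qed
  qed
qed

text \<open>\<open>reach\<close> is locally constant off \<open>E\<close> by
  \<open>reach_step\<close>, and the complement of \<open>E\<close> is connected.\<close>

lemma reach_all: assumes "z \<notin> E" shows "reach z"
proof -
  have nb: "\<exists>d>0. \<forall>z1\<in>ball z0 d. \<forall>z2\<in>ball z0 d. reach z1 \<longrightarrow> reach z2" if z0: "z0 \<notin> E" for z0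
  proof -
    obtain \<rho> where \<rho>: "\<rho> > 0" "cball z0 \<rho> \<subseteq> - E"
      using z0 closed_E open_contains_cball[of "- E"] by blast
    have "\<forall>z1\<in>ball z0 (\<rho>/8). \<forall>z2\<in>ball z0 (\<rho>/8). reach z1 \<longrightarrow> reach z2"
      by (intro ballI impI) (rule reach_step[OF \<rho>])
    moreover have "\<rho>/8 > 0" using \<rho> by simp
    ultimately show ?thesis by blast
  qed
  \<comment> \<open>The Boolean parameter covers the set and its complement at once.\<close>
  have op: "open {z. z \<notin> E \<and> (reach z \<longleftrightarrow> b)}" for b
    unfolding open_contains_ball
  proof (intro ballI)
    fix x assume "x \<in> {z. z \<notin> E \<and> (reach z \<longleftrightarrow> b)}"
    then have x: "x \<notin> E" "reach x \<longleftrightarrow> b" by auto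
    obtain d where d: "d > 0" "\<And>z1 z2. z1 \<in> ball x d \<Longrightarrow> z2 \<in> ball x d \<Longrightarrow> reach z1 \<Longrightarrow> reach z2"
      using nb[OF x(1)] by blast
    obtain s where s: "s > 0" "ball x s \<subseteq> - E" using x closed_E open_contains_ball[of "- E"] by blast
    show "\<exists>e>0. ball x e \<subseteq> {z. z \<notin> E \<and> (reach z \<longleftrightarrow> b)}"
    proof (intro exI[of _ "min d s"] conjI subsetI)
      fix y assume y: "y \<in> ball x (min d s)"
      then have "reach y \<longleftrightarrow> reach x" using d(2)[of x y] d(2)[of y x] d(1) by auto
      then show "y \<in> {z. z \<notin> E \<and> (reach z \<longleftrightarrow> b)}" using y s x by auto
    qed (use d s in auto)
  qed
  have "{z. z \<notin> E \<and> (reach z \<longleftrightarrow> True)} \<inter> - E = {} \<or> {z. z \<notin> E \<and> (reach z \<longleftrightarrow> False)} \<inter> - E = {}"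
    by (rule connectedD[OF connected_compl_E op op]) auto
  then show ?thesis using reach_from_infinity assms by auto
qed

section \<open>Stability of controlled sets\<close>

lemma controlled_subset: "controlled N \<Longrightarrow> M \<subseteq> N \<Longrightarrow> controlled M"
  unfolding controlled_def by (meson Diff_mono order_refl order_trans)

lemma wt_nonneg: "wt z \<ge> 0"
  by (simp add: wt_def)

lemma controlled_Un:
  assumes "controlled M" "controlled N" shows "controlled (M \<union> N)"
proof -
  obtain C D where C: "\<And>f K S. adm f K \<Longrightarrow> finite S \<Longrightarrow> S \<subseteq> M - E \<Longrightarrow> (\<Sum>z\<in>S. real (nat (zorder f z)) * wt z) \<le> C * K"
    and D: "\<And>f K S. adm f K \<Longrightarrow> finite S \<Longrightarrow> S \<subseteq> N - E \<Longrightarrow> (\<Sum>z\<in>S. real (nat (zorder f z)) * wt z) \<le> D * K"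
    using assms unfolding controlled_def by metis
  show ?thesis unfolding controlled_def
  proof (intro exI[of _ "C + D"] allI impI)
    fix f K S assume *: "adm f K" "finite S" "S \<subseteq> M \<union> N - E"
    have "(\<Sum>z\<in>(S \<inter> M) \<union> (S - M). real (nat (zorder f z)) * wt z) =
      (\<Sum>z\<in>S \<inter> M. real (nat (zorder f z)) * wt z) + (\<Sum>z\<in>S - M. real (nat (zorder f z)) * wt z)"
      using * by (intro sum.union_disjoint) auto
    also have "\<dots> \<le> C * K + D * K" using * by (intro add_mono C D) auto
    finally show "(\<Sum>z\<in>S. real (nat (zorder f z)) * wt z) \<le> (C + D) * K"
      by (simp add: Int_Diff_Un distrib_right)
  qed
qed

lemma controlled_empty: "controlled {}"
  unfolding controlled_def by (intro exI[of _ 0]) auto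

lemma controlled_UN: "finite I \<Longrightarrow> (\<And>i. i \<in> I \<Longrightarrow> controlled (N i)) \<Longrightarrow> controlled (\<Union>i\<in>I. N i)"
  by (induction I rule: finite_induct) (simp_all add: controlled_empty controlled_Un)

end

section \<open>Zero sums away from the endpoints\<close>

context finite_bands
begin

text \<open>\<tau> selects a preimage under \<phi> of each zero, so \<phi> need not be injective;
  \<tau> itself is, since \<phi> undoes it on S. The constant does not depend on \<phi>, which
  matters when infinitely many scales are used.\<close>

lemma patch_sum:
  assumes Q: "compact Q" "Q \<subseteq> patch"
  obtains C where "C > 0" and
    "\<And>f K \<phi> \<tau> M c S. adm f K \<Longrightarrow> \<phi> holomorphic_on patch \<Longrightarrow> (\<And>z. z \<in> patch \<Longrightarrow> \<phi> z \<notin> E) \<Longrightarrow>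
       M > 0 \<Longrightarrow> c \<in> Q \<Longrightarrow> f (\<phi> c) \<noteq> 0 \<Longrightarrow> ln (norm (f (\<phi> c))) \<ge> - M \<Longrightarrow>
       (\<And>z. z \<in> patch \<Longrightarrow> f (\<phi> z) \<noteq> 0 \<Longrightarrow> ln (norm (f (\<phi> z))) \<le> M / (pi - \<bar>Im z\<bar>) powr p) \<Longrightarrow>
       finite S \<Longrightarrow> (\<And>s. s \<in> S \<Longrightarrow> \<phi> (\<tau> s) = s \<and> \<bar>Re (\<tau> s)\<bar> \<le> 1/2 \<and> \<bar>Im (\<tau> s)\<bar> < pi) \<Longrightarrow>
       (\<Sum>s\<in>S. real (nat (zorder f s)) * (pi - \<bar>Im (\<tau> s)\<bar>) powr (p + 1 + \<epsilon>)) \<le> C * M"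
proof -
  obtain C where C: "C > 0" and sum:
    "\<And>F M c T m. F holomorphic_on patch \<Longrightarrow> M > 0 \<Longrightarrow> c \<in> Q \<Longrightarrow> F c \<noteq> 0 \<Longrightarrow>
       ln (norm (F c)) \<ge> - M \<Longrightarrow>
       (\<And>z. z \<in> patch \<Longrightarrow> F z \<noteq> 0 \<Longrightarrow> ln (norm (F z)) \<le> M / (pi - \<bar>Im z\<bar>) powr p) \<Longrightarrow>
       finite T \<Longrightarrow> T \<subseteq> {z. \<bar>Re z\<bar> \<le> 1/2 \<and> \<bar>Im z\<bar> < pi} \<Longrightarrow>
       (\<And>z. z \<in> T \<Longrightarrow> vanishes_to F z (m z)) \<Longrightarrow>
       (\<Sum>z\<in>T. real (m z) * (pi - \<bar>Im z\<bar>) powr (p + 1 + \<epsilon>)) \<le> C * M"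
    using patch_zero_sum[OF p0 e0 Q] by blast
  have "(\<Sum>s\<in>S. real (nat (zorder f s)) * (pi - \<bar>Im (\<tau> s)\<bar>) powr (p + 1 + \<epsilon>)) \<le> C * M"
    if f: "adm f K" and \<phi>: "\<phi> holomorphic_on patch" "\<And>z. z \<in> patch \<Longrightarrow> \<phi> z \<notin> E"
      and M: "M > 0" and c: "c \<in> Q" "f (\<phi> c) \<noteq> 0" "ln (norm (f (\<phi> c))) \<ge> - M"
      and up: "\<And>z. z \<in> patch \<Longrightarrow> f (\<phi> z) \<noteq> 0 \<Longrightarrow> ln (norm (f (\<phi> z))) \<le> M / (pi - \<bar>Im z\<bar>) powr p"
      and S: "finite S" "\<And>s. s \<in> S \<Longrightarrow> \<phi> (\<tau> s) = s \<and> \<bar>Re (\<tau> s)\<bar> \<le> 1/2 \<and> \<bar>Im (\<tau> s)\<bar> < pi"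
    for f K \<phi> \<tau> M c S
  proof -
    have inj: "inj_on \<tau> S" using S(2) by (metis inj_onI)
    have "(\<Sum>z\<in>\<tau> ` S. real (nat (zorder f (\<phi> z))) * (pi - \<bar>Im z\<bar>) powr (p + 1 + \<epsilon>)) \<le> C * M"
    proof (rule sum[of "\<lambda>z. f (\<phi> z)", OF _ M c up])
      have "(f \<circ> \<phi>) holomorphic_on patch"
        by (rule holomorphic_on_compose_gen[OF \<phi>(1) adm_holomorphic[OF f]]) (use \<phi> in auto)
      then show "(\<lambda>z. f (\<phi> z)) holomorphic_on patch" by (simp add: o_def)
      fix z assume "z \<in> \<tau> ` S"
      then have "z \<in> patch" using S(2) by (force simp: patch_def)
      then show "vanishes_to (\<lambda>z. f (\<phi> z)) z (nat (zorder f (\<phi> z)))"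
        using \<phi> f open_patch by (intro vanishes_to_compose[OF adm_vanishes]) auto
    qed (use S in auto)
    also have "(\<Sum>z\<in>\<tau> ` S. real (nat (zorder f (\<phi> z))) * (pi - \<bar>Im z\<bar>) powr (p + 1 + \<epsilon>)) =
      (\<Sum>s\<in>S. real (nat (zorder f s)) * (pi - \<bar>Im (\<tau> s)\<bar>) powr (p + 1 + \<epsilon>))"
      unfolding sum.reindex[OF inj] using S(2) by (intro sum.cong) auto
    finally show ?thesis .
  qed
  note main = this
  show ?thesis
    by (rule that[OF C]) (rule main, assumption+)
qed

text \<open>Reduces a local estimate to comparing both distances and the weight with powers of pi -
  |Im z|. The base point comes from \<open>reach_all\<close> in a disc about \<open>z0\<close> whose
  preimage lies in a fixed compact disc.\<close>

lemma controlled_affine_patch: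
  assumes t: "t > 0"
    and out: "\<And>z. z \<in> patch \<Longrightarrow> z0 + of_real t * z \<notin> E"
    and low: "\<And>z. z \<in> patch \<Longrightarrow> b * (pi - \<bar>Im z\<bar>) powr p \<le>
      infdist (z0 + of_real t * z) E powr p * infdist (z0 + of_real t * z) V powr q" and b: "b > 0"
    and N: "\<And>s. s \<in> N - E \<Longrightarrow> \<bar>Re (s - z0)\<bar> \<le> t/2 \<and> \<bar>Im (s - z0)\<bar> < pi * t \<and>
      wt s \<le> B * (pi - \<bar>Im (s - z0)\<bar> / t) powr (p + 1 + \<epsilon>)"
    and B: "B \<ge> 0"
  shows "controlled N"
proof -
  have c_patch: "cball 0 (1/2) \<subseteq> patch"
  proof
    fix z :: complex assume "z \<in> cball 0 (1/2)"
    then show "z \<in> patch" using abs_Re_le_cmod[of z] abs_Im_le_cmod[of z] pi_gt3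
      unfolding patch_def mem_cball_0 mem_Collect_eq by linarith
  qed
  obtain C where C: "C > 0" and sum:
    "\<And>f K \<phi> \<tau> M c S. adm f K \<Longrightarrow> \<phi> holomorphic_on patch \<Longrightarrow> (\<And>z. z \<in> patch \<Longrightarrow> \<phi> z \<notin> E) \<Longrightarrow>
       M > 0 \<Longrightarrow> c \<in> cball 0 (1/2) \<Longrightarrow> f (\<phi> c) \<noteq> 0 \<Longrightarrow> ln (norm (f (\<phi> c))) \<ge> - M \<Longrightarrow>
       (\<And>z. z \<in> patch \<Longrightarrow> f (\<phi> z) \<noteq> 0 \<Longrightarrow> ln (norm (f (\<phi> z))) \<le> M / (pi - \<bar>Im z\<bar>) powr p) \<Longrightarrow>
       finite S \<Longrightarrow> (\<And>s. s \<in> S \<Longrightarrow> \<phi> (\<tau> s) = s \<and> \<bar>Re (\<tau> s)\<bar> \<le> 1/2 \<and> \<bar>Im (\<tau> s)\<bar> < pi) \<Longrightarrow>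
       (\<Sum>s\<in>S. real (nat (zorder f s)) * (pi - \<bar>Im (\<tau> s)\<bar>) powr (p + 1 + \<epsilon>)) \<le> C * M"
    using patch_sum[OF compact_cball c_patch] by blast
  have "z0 \<notin> E" using out[of 0] by (auto simp: patch_def)
  then obtain C0 where C0: "C0 > 0" "\<And>f K. adm f K \<Longrightarrow>
     \<exists>w\<in>ball z0 (t/2). w \<notin> E \<and> f w \<noteq> 0 \<and> ln (norm (f w)) \<ge> - (C0 * K)"
    using reachD[OF reach_all, of z0 "t/2"] t by auto
  \<comment> \<open>C0 pays for the base point, 1/b for the growth bound.\<close>
  define D where "D = max C0 (1 / b)"
  have D: "D > 0" "C0 \<le> D" "1 / b \<le> D" using C0 by (auto simp: D_def)
  show ?thesis unfolding controlled_def
  proof (intro exI[of _ "B * (C * D)"] allI impI)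
    fix f K S assume f: "adm f K" and S: "finite S" "S \<subseteq> N - E"
    have K: "K > 0" by (rule adm_pos[OF f])
    define \<tau> where "\<tau> = (\<lambda>s. (s - z0) / of_real t)"
    have \<tau>: "z0 + of_real t * \<tau> s = s" "Re (\<tau> s) = Re (s - z0) / t" "Im (\<tau> s) = Im (s - z0) / t" for s
      using t by (auto simp: \<tau>_def Re_divide_of_real Im_divide_of_real)
    obtain w where w: "w \<in> ball z0 (t/2)" "f w \<noteq> 0" "ln (norm (f w)) \<ge> - (C0 * K)"
      using C0(2)[OF f] by blast
    have "(\<Sum>s\<in>S. real (nat (zorder f s)) * (pi - \<bar>Im (\<tau> s)\<bar>) powr (p + 1 + \<epsilon>)) \<le> C * (D * K)"
    proof (rule sum[of f K "\<lambda>z. z0 + of_real t * z" _ "\<tau> w"])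
      show "(\<lambda>z. z0 + of_real t * z) holomorphic_on patch" by (intro holomorphic_intros)
      show "\<tau> w \<in> cball 0 (1/2)"
        using w t by (simp add: \<tau>_def norm_divide dist_norm norm_minus_commute field_simps)
      have "C0 * K \<le> D * K" using D K by (intro mult_right_mono) auto
      then show "- (D * K) \<le> ln (norm (f (z0 + of_real t * \<tau> w)))" using w(3) unfolding \<tau> by linarith
      fix z assume z: "z \<in> patch" "f (z0 + of_real t * z) \<noteq> 0"
      have \<delta>: "pi - \<bar>Im z\<bar> > 0" using z by (simp add: patch_def)
      have "ln (norm (f (z0 + of_real t * z))) \<le>
        K / (infdist (z0 + of_real t * z) E powr p * infdist (z0 + of_real t * z) V powr q)"
        using adm_le[OF f out[OF z(1)] z(2)] .
      also have "\<dots> \<le> K / (b * (pi - \<bar>Im z\<bar>) powr p)"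
      proof (rule divide_left_mono[OF low[OF z(1)]])
        have "0 < b * (pi - \<bar>Im z\<bar>) powr p" using b \<delta> by simp
        then show "0 < infdist (z0 + of_real t * z) E powr p * infdist (z0 + of_real t * z) V powr q *
            (b * (pi - \<bar>Im z\<bar>) powr p)"
          using low[OF z(1)] by - (rule mult_pos_pos, linarith+)
      qed (use K in simp)
      also have "\<dots> = (1 / b * K) / (pi - \<bar>Im z\<bar>) powr p" by simp
      also have "\<dots> \<le> D * K / (pi - \<bar>Im z\<bar>) powr p"
        using D K by (intro divide_right_mono mult_right_mono) auto
      finally show "ln (norm (f (z0 + of_real t * z))) \<le> D * K / (pi - \<bar>Im z\<bar>) powr p" .
    next
      fix s assume "s \<in> S"
      then have "\<bar>Re (s - z0)\<bar> \<le> t/2 \<and> \<bar>Im (s - z0)\<bar> < pi * t" using N S by blast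
      then show "z0 + of_real t * \<tau> s = s \<and> \<bar>Re (\<tau> s)\<bar> \<le> 1/2 \<and> \<bar>Im (\<tau> s)\<bar> < pi"
        unfolding \<tau> using t by (simp add: field_simps)
    qed (use f out D K w S \<tau> in auto)
    then have *: "B * (\<Sum>s\<in>S. real (nat (zorder f s)) * (pi - \<bar>Im (\<tau> s)\<bar>) powr (p + 1 + \<epsilon>)) \<le> B * (C * (D * K))"
      using B by (intro mult_left_mono) auto
    have "(\<Sum>s\<in>S. real (nat (zorder f s)) * wt s) \<le>
      (\<Sum>s\<in>S. real (nat (zorder f s)) * (B * (pi - \<bar>Im (\<tau> s)\<bar>) powr (p + 1 + \<epsilon>)))"
    proof (intro sum_mono mult_left_mono)
      fix s assume "s \<in> S"
      then have "wt s \<le> B * (pi - \<bar>Im (s - z0)\<bar> / t) powr (p + 1 + \<epsilon>)" using N S by blast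
      moreover have "\<bar>Im (\<tau> s)\<bar> = \<bar>Im (s - z0)\<bar> / t" unfolding \<tau> using t by simp
      ultimately show "wt s \<le> B * (pi - \<bar>Im (\<tau> s)\<bar>) powr (p + 1 + \<epsilon>)" by simp
    qed auto
    also have "\<dots> = B * (\<Sum>s\<in>S. real (nat (zorder f s)) * (pi - \<bar>Im (\<tau> s)\<bar>) powr (p + 1 + \<epsilon>))"
      by (simp add: sum_distrib_left mult.left_commute)
    also note *
    finally show "(\<Sum>s\<in>S. real (nat (zorder f s)) * wt s) \<le> B * (C * D) * K" by (simp add: mult.assoc)
  qed
qed

lemma controlled_subset_E:
  assumes "N - E = {}" shows "controlled N"
  unfolding controlled_def
proof (intro exI[of _ 0] allI impI)
  fix f K S assume "S \<subseteq> N - E"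
  then have "S = {}" using assms by blast
  then show "(\<Sum>z\<in>S. real (nat (zorder f z)) * wt z) \<le> 0 * K" by simp
qed

text \<open>The exponent \<open>exp_a\<close> can be negative, so the set has to avoid the
  endpoints.\<close>

lemma weight_bounded_on_compact:
  assumes Q: "compact Q" "Q \<inter> V = {}"
  obtains B where "B > 0"
    "\<And>z. z \<in> Q \<Longrightarrow> infdist z V powr exp_a p q \<epsilon> * (1 + norm z) powr exp_b p q \<epsilon> \<le> B"
proof -
  define h where "h = (\<lambda>z. infdist z V powr exp_a p q \<epsilon> * (1 + norm z) powr exp_b p q \<epsilon>)"
  have "infdist z V \<noteq> 0" if "z \<in> Q" for z
  proof -
    have "z \<notin> V" using that Q by blast
    then show ?thesis using infdist_V_pos by force
  qed
  moreover have "1 + norm z \<noteq> 0" for z :: complex using norm_ge_zero[of z] by linarith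
  ultimately have "continuous_on Q h" unfolding h_def by (intro continuous_intros) auto
  then have "bounded (h ` Q)" using Q by (simp add: compact_continuous_image compact_imp_bounded)
  then obtain B where B: "B > 0" "\<And>z. z \<in> Q \<Longrightarrow> norm (h z) \<le> B" by (auto simp: bounded_pos)
  show ?thesis by (rule that[OF B(1)]) (use B(2) in \<open>force simp: h_def\<close>)
qed

lemma infdist_near: "infdist z0 A - dist z0 z \<le> infdist z A"
  using infdist_triangle[of z0 A z] by simp

lemma dist_patch_le:
  assumes "z \<in> patch" "t > 0" shows "norm (of_real t * z) \<le> 5 * t"
proof -
  have "norm z \<le> \<bar>Re z\<bar> + \<bar>Im z\<bar>" by (rule cmod_le)
  also have "\<dots> \<le> 5" using assms pi_less_4 by (simp add: patch_def)
  finally show ?thesis using assms by (simp add: norm_mult)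
qed

text \<open>At scale t, a tenth of the distance to \<open>E\<close>, the image of the rectangle lies
  within 5t of \<open>z0\<close> and so at least 5t away from \<open>E\<close>. All distances are
  then comparable to constants.\<close>

lemma controlled_regular:
  assumes z0: "z0 \<notin> E" shows "\<exists>r>0. controlled (ball z0 r)"
proof -
  define t where "t = infdist z0 E / 10"
  have t: "t > 0" using infdist_E_pos[OF z0] by (simp add: t_def)
  have far: "5 * t \<le> infdist z E" if "dist z0 z \<le> 5 * t" for z
    using infdist_near[of z0 E z] that by (simp add: t_def)
  have sub: "cball z0 (t/2) \<inter> V = {}"
  proof (rule equals0I)
    fix z assume z: "z \<in> cball z0 (t/2) \<inter> V"
    then have "infdist z E = 0" using V_subset_E by auto
    then show False using far[of z] z t by auto
  qed
  obtain B where B: "B > 0"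
    "\<And>z. z \<in> cball z0 (t/2) \<Longrightarrow> infdist z V powr exp_a p q \<epsilon> * (1 + norm z) powr exp_b p q \<epsilon> \<le> B"
    using weight_bounded_on_compact[OF compact_cball sub] by metis
  have "controlled (ball z0 (t/2))"
  proof (rule controlled_affine_patch[OF t])
    define b where "b = (5 * t) powr p * (5 * t) powr q / pi powr p"
    show "b > 0" using t by (simp add: b_def)
    fix z assume z: "z \<in> patch"
    have f: "5 * t \<le> infdist (z0 + of_real t * z) E"
      using dist_patch_le[OF z t] by (intro far) (simp add: dist_norm)
    then show "z0 + of_real t * z \<notin> E" using t by auto
    have "b * (pi - \<bar>Im z\<bar>) powr p \<le> b * pi powr p"
      using z p0 t by (intro mult_left_mono powr_mono2) (auto simp: patch_def b_def)
    also have "\<dots> = (5 * t) powr p * (5 * t) powr q" by (simp add: b_def)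
    also have "\<dots> \<le> infdist (z0 + of_real t * z) E powr p * infdist (z0 + of_real t * z) V powr q"
      using f infdist_E_le_V[of "z0 + of_real t * z"] t p0 q0 by (intro mult_mono powr_mono2) auto
    finally show "b * (pi - \<bar>Im z\<bar>) powr p \<le>
      infdist (z0 + of_real t * z) E powr p * infdist (z0 + of_real t * z) V powr q" .
  next
    define D where "D = (11 * t) powr (p + 1 + \<epsilon>)"
    show "D * B \<ge> 0" using B by (simp add: D_def)
    fix s assume "s \<in> ball z0 (t/2) - E"
    then have s: "norm (s - z0) < t/2" by (simp add: dist_norm norm_minus_commute)
    have ri: "\<bar>Re (s - z0)\<bar> < t/2" "\<bar>Im (s - z0)\<bar> < t/2"
      using s abs_Re_le_cmod[of "s - z0"] abs_Im_le_cmod[of "s - z0"] by linarith+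
    have "t / 2 \<le> pi * t" using t pi_gt3 by (simp add: mult_le_cancel_right)
    \<comment> \<open>Counted zeros sit well inside the rectangle, so the required power of this
      quantity is at least 1 and may be inserted freely.\<close>
    have one: "1 \<le> pi - \<bar>Im (s - z0)\<bar> / t"
    proof -
      have "\<bar>Im (s - z0)\<bar> / t < 1/2" using ri t by (simp add: field_simps)
      then show ?thesis using pi_gt3 by linarith
    qed
    have "infdist z0 E = 10 * t" by (simp add: t_def)
    then have "infdist s E \<le> 11 * t" using infdist_near[of s E z0] s t unfolding dist_norm by linarith
    then have "infdist s E powr (p + 1 + \<epsilon>) \<le> D"
      unfolding D_def using p0 e0 by (intro powr_mono2) (auto simp: infdist_nonneg)
    moreover have "infdist s V powr exp_a p q \<epsilon> * (1 + norm s) powr exp_b p q \<epsilon> \<le> B"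
      using s by (intro B) (simp add: dist_norm norm_minus_commute)
    ultimately have "wt s \<le> D * B"
      unfolding wt_def mult.assoc using B(1) by (intro mult_mono) (auto simp: D_def)
    also have "\<dots> \<le> D * B * (pi - \<bar>Im (s - z0)\<bar> / t) powr (p + 1 + \<epsilon>)"
      using mult_left_mono[OF ge_one_powr_ge_zero[OF one, of "p + 1 + \<epsilon>"], of "D * B"] B p0 e0
      by (simp add: D_def)
    finally show "\<bar>Re (s - z0)\<bar> \<le> t/2 \<and> \<bar>Im (s - z0)\<bar> < pi * t \<and>
      wt s \<le> D * B * (pi - \<bar>Im (s - z0)\<bar> / t) powr (p + 1 + \<epsilon>)"
      using ri \<open>t / 2 \<le> pi * t\<close> by linarith
  qed
  then show ?thesis using t by (intro exI[of _ "t/2"]) auto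
qed

text \<open>On each side of the cut one rectangle is placed with a horizontal side on the real line;
  there t (pi - |Im z|) is the distance to the line, hence to the interval. Real points of the small
  disc belong to \<open>E\<close>.\<close>

lemma controlled_interval_interior:
  assumes j: "j \<le> n" and x: "\<alpha> j < x" "x < \<beta> j" and nV: "of_real x \<notin> V"
  shows "\<exists>r>0. controlled (ball (of_real x) r)"
proof -
  define d0 where "d0 = infdist (of_real x) V"
  have d0: "d0 > 0" unfolding d0_def by (rule infdist_V_pos[OF nV])
  \<comment> \<open>The shifted rectangle stays within 4t + 5t of x, hence within d0/2, and so at
    distance at least d0/2 from the endpoints.\<close>
  define t where "t = d0 / 20"
  have t: "t > 0" using d0 by (simp add: t_def)
  have "infdist (of_real x) V \<le> dist (of_real x) (complex_of_real (\<alpha> j))"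
    "infdist (of_real x) V \<le> dist (of_real x) (complex_of_real (\<beta> j))"
    using infdist_le[OF endpoints_in_V(1)[OF j]] infdist_le[OF endpoints_in_V(2)[OF j]] by blast+
  then have xd: "d0 \<le> x - \<alpha> j" "d0 \<le> \<beta> j - x" using x by (auto simp: d0_def dist_of_real dist_real_def)
  have dV: "d0 / 2 \<le> infdist z V" if "norm (z - of_real x) \<le> 10 * t" for z
    using infdist_near[of "of_real x" V z] that by (simp add: t_def d0_def dist_norm norm_minus_commute)
  have sub: "cball (of_real x) (10 * t) \<inter> V = {}"
  proof (rule equals0I)
    fix z assume z: "z \<in> cball (of_real x) (10 * t) \<inter> V"
    then have "infdist z V = 0" by auto
    then show False using dV[of z] z d0 by (auto simp: dist_norm norm_minus_commute)
  qed
  obtain B where B: "B > 0" "\<And>z. z \<in> cball (of_real x) (10 * t) \<Longrightarrow>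
      infdist z V powr exp_a p q \<epsilon> * (1 + norm z) powr exp_b p q \<epsilon> \<le> B"
    using weight_bounded_on_compact[OF compact_cball sub] by metis
  have half: "controlled (ball (of_real x) (t/2) \<inter> {z. \<sigma> * Im z > 0})" if \<sigma>: "\<sigma> = 1 \<or> \<sigma> = -1" for \<sigma> :: real
  proof -
    define z0 where "z0 = Complex x (\<sigma> * pi * t)"
    show ?thesis
    proof (rule controlled_affine_patch[OF t])
      define b where "b = t powr p * (d0 / 2) powr q"
      show "b > 0" using t d0 by (simp add: b_def)
      fix z assume z: "z \<in> patch"
      define y where "y = z0 + of_real t * z"
      have Imy: "Im y = t * (\<sigma> * pi + Im z)" by (simp add: y_def z0_def algebra_simps)
      have "pi - \<bar>Im z\<bar> \<le> \<bar>\<sigma> * pi + Im z\<bar>" using \<sigma> z by (auto simp: patch_def abs_if)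
      then have "t * (pi - \<bar>Im z\<bar>) \<le> t * \<bar>\<sigma> * pi + Im z\<bar>" using t by (intro mult_left_mono) auto
      also have "\<dots> = \<bar>Im y\<bar>" using t by (simp add: Imy abs_mult)
      also have "\<dots> \<le> infdist y E" by (rule infdist_E_ge_Im)
      finally have yE: "t * (pi - \<bar>Im z\<bar>) \<le> infdist y E" .
      have \<delta>: "pi - \<bar>Im z\<bar> > 0" using z by (simp add: patch_def)
      have "y - of_real x = Complex 0 (\<sigma> * pi * t) + of_real t * z" by (simp add: y_def z0_def complex_eq_iff)
      then have "norm (y - of_real x) \<le> norm (Complex 0 (\<sigma> * pi * t)) + norm (of_real t * z)"
        by (metis norm_triangle_ineq)
      also have "\<dots> \<le> 4 * t + 5 * t"
        using dist_patch_le[OF z t] \<sigma> t pi_less_4 by (intro add_mono) (auto simp: complex_norm abs_mult)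
      finally have "d0 / 2 \<le> infdist y V" using t by (intro dV) auto
      then have "(t * (pi - \<bar>Im z\<bar>)) powr p * (d0 / 2) powr q \<le> infdist y E powr p * infdist y V powr q"
        using yE t \<delta> d0 p0 q0 by (intro mult_mono powr_mono2) auto
      then show "b * (pi - \<bar>Im z\<bar>) powr p \<le>
        infdist (z0 + of_real t * z) E powr p * infdist (z0 + of_real t * z) V powr q"
        unfolding y_def[symmetric] b_def by (simp add: powr_mult mult_ac)
      have "infdist y E > 0" using yE t \<delta> by (meson mult_pos_pos order_less_le_trans)
      then show "z0 + of_real t * z \<notin> E" unfolding y_def[symmetric] by auto
    next
      show "t powr (p + 1 + \<epsilon>) * B \<ge> 0" using B by simp
      fix s assume "s \<in> ball (of_real x) (t/2) \<inter> {z. \<sigma> * Im z > 0} - E"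
      then have s: "norm (s - of_real x) < t/2" "\<sigma> * Im s > 0" by (auto simp: dist_norm norm_minus_commute)
      have ri: "\<bar>Re s - x\<bar> < t/2" "\<bar>Im s\<bar> < t/2"
        using s abs_Re_le_cmod[of "s - of_real x"] abs_Im_le_cmod[of "s - of_real x"] by auto
      have "1 / 2 * t < pi * t" using t pi_gt3 by (intro mult_strict_right_mono) auto
      then have pt: "t / 2 < pi * t" by simp
      have Ims: "\<bar>Im (s - z0)\<bar> = pi * t - \<bar>Im s\<bar>" using \<sigma>
      proof
        assume "\<sigma> = 1"
        then have "Im (s - z0) = Im s - pi * t" "Im s > 0" using s(2) by (simp_all add: z0_def)
        then show ?thesis using ri(2) pt by argo
      next
        assume "\<sigma> = -1"
        then have "Im (s - z0) = Im s + pi * t" "Im s < 0" using s(2) by (simp_all add: z0_def)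
        then show ?thesis using ri(2) pt by argo
      qed
      then have \<delta>: "pi - \<bar>Im (s - z0)\<bar> / t = \<bar>Im s\<bar> / t" using t by (simp add: field_simps)
      have "of_real (Re s) \<in> E" unfolding frak_e_def
        using j ri xd t d0 by (intro imageI UN_I[of j]) (auto simp: t_def abs_if split: if_splits)
      then have "infdist s E \<le> dist s (of_real (Re s))" by (rule infdist_le)
      also have "\<dots> = \<bar>Im s\<bar>" by (simp add: dist_norm cmod_def)
      finally have "infdist s E powr (p + 1 + \<epsilon>) \<le> \<bar>Im s\<bar> powr (p + 1 + \<epsilon>)"
        using p0 e0 by (intro powr_mono2) (auto simp: infdist_nonneg)
      also have "\<dots> = t powr (p + 1 + \<epsilon>) * (\<bar>Im s\<bar> / t) powr (p + 1 + \<epsilon>)"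
        using t by (simp flip: powr_mult)
      finally have 1: "infdist s E powr (p + 1 + \<epsilon>) \<le> t powr (p + 1 + \<epsilon>) * (\<bar>Im s\<bar> / t) powr (p + 1 + \<epsilon>)" .
      have 2: "infdist s V powr exp_a p q \<epsilon> * (1 + norm s) powr exp_b p q \<epsilon> \<le> B"
        using s t by (intro B) (simp add: dist_norm norm_minus_commute)
      have "wt s \<le> (t powr (p + 1 + \<epsilon>) * (\<bar>Im s\<bar> / t) powr (p + 1 + \<epsilon>)) * B"
        unfolding wt_def mult.assoc[of "infdist s E powr (p + 1 + \<epsilon>)"] using 1 2 B(1) by (intro mult_mono) auto
      then have "wt s \<le> t powr (p + 1 + \<epsilon>) * B * (pi - \<bar>Im (s - z0)\<bar> / t) powr (p + 1 + \<epsilon>)"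
        unfolding \<delta> by (simp add: mult_ac)
      moreover have "\<bar>Im (s - z0)\<bar> < pi * t" unfolding Ims using s(2) by auto
      moreover have "\<bar>Re (s - z0)\<bar> \<le> t/2" using ri by (simp add: z0_def)
      ultimately show "\<bar>Re (s - z0)\<bar> \<le> t/2 \<and> \<bar>Im (s - z0)\<bar> < pi * t \<and>
        wt s \<le> t powr (p + 1 + \<epsilon>) * B * (pi - \<bar>Im (s - z0)\<bar> / t) powr (p + 1 + \<epsilon>)" by blast
    qed
  qed
  have "controlled (ball (of_real x) (t/2) \<inter> {z. Im z = 0})"
  proof -
    have "z \<in> E" if "z \<in> ball (of_real x) (t/2) \<inter> {z. Im z = 0}" for z
    proof -
      have "\<bar>Re z - x\<bar> < t/2" using that abs_Re_le_cmod[of "z - of_real x"] by (auto simp: dist_norm norm_minus_commute)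
      then have "Re z \<in> {\<alpha> j..\<beta> j}" using xd t d0 by (auto simp: t_def abs_if split: if_splits)
      moreover have "z = of_real (Re z)" using that by (simp add: complex_eq_iff)
      ultimately show ?thesis unfolding frak_e_def using j by blast
    qed
    then have "(ball (of_real x) (t/2) \<inter> {z. Im z = 0}) - E = {}" by blast
    then show ?thesis by (rule controlled_subset_E)
  qed
  with half[of 1] half[of "-1"] have "controlled (ball (of_real x) (t/2) \<inter> {z. 1 * Im z > 0} \<union>
     (ball (of_real x) (t/2) \<inter> {z. -1 * Im z > 0} \<union> ball (of_real x) (t/2) \<inter> {z. Im z = 0}))"
    by (intro controlled_Un) auto
  then have "controlled (ball (of_real x) (t/2))" by (rule controlled_subset) auto
  then show ?thesis using t by (intro exI[of _ "t/2"]) auto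
qed

end

section \<open>Geometry of the logarithmic coordinate at an endpoint\<close>

text \<open>With h = x/2, sin x = tan h * 2 cos(h)^2; tan h is at least h, and 2 cos(h)^2 = 1 + cos
  x is at least 1.\<close>

lemma sin_ge_half:
  assumes "0 \<le> x" "x \<le> pi/2" shows "x / 2 \<le> sin x"
proof -
  define h where "h = x / 2"
  have h: "0 \<le> h" "h < pi/2" "x = 2 * h" using assms pi_gt_zero unfolding h_def by linarith+
  have c: "cos h > 0" using h by (intro cos_gt_zero_pi) auto
  have "0 \<le> cos x" using assms by (intro cos_ge_zero) auto
  then have "1 \<le> 2 * (cos h)\<^sup>2" unfolding h(3) cos_double_cos by simp
  moreover have "h \<le> tan h" using abs_tan_ge[of h] h tan_pos_pi2_le[of h] by simp
  moreover have "sin x = tan h * (2 * (cos h)\<^sup>2)"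
    unfolding h(3) sin_double tan_def using c by (simp add: power2_eq_square)
  moreover have "h * 1 \<le> tan h * (2 * (cos h)\<^sup>2)"
    using calculation h by (intro mult_mono) auto
  ultimately show ?thesis by (simp add: h_def)
qed

text \<open>This is the distance from exp Y to the point -t of the slit. In the right half-plane it
  is at least |exp Y|; otherwise its imaginary part suffices, through
  \<open>sin_ge_half\<close>.\<close>

lemma norm_exp_add_real_ge:
  fixes t :: real
  assumes "t \<ge> 0" "\<bar>Im Y\<bar> < pi"
  shows "exp (Re Y) * (pi - \<bar>Im Y\<bar>) / 4 \<le> norm (exp Y + of_real t)"
proof (cases "\<bar>Im Y\<bar> \<le> pi / 2")
  case True
  then have "0 \<le> cos (Im Y)" by (intro cos_ge_zero) auto
  then have 0: "0 \<le> Re (exp Y)" by (simp add: Re_exp)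
  have "exp (Re Y) = norm (exp Y)" by simp
  also have "\<dots> \<le> norm (exp Y + of_real t)"
    unfolding cmod_def using 0 assms by (intro real_sqrt_le_mono add_right_mono power_mono) auto
  finally have "exp (Re Y) \<le> norm (exp Y + of_real t)" .
  moreover have "exp (Re Y) * ((pi - \<bar>Im Y\<bar>) / 4) \<le> exp (Re Y) * 1"
    using pi_less_4 by (intro mult_left_mono) auto
  ultimately show ?thesis unfolding times_divide_eq_right by linarith
next
  case False
  define \<delta> where "\<delta> = pi - \<bar>Im Y\<bar>"
  have \<delta>: "0 \<le> \<delta>" "\<delta> \<le> pi/2" using False assms by (auto simp: \<delta>_def field_simps)
  have "\<bar>sin (Im Y)\<bar> = \<bar>sin \<bar>Im Y\<bar>\<bar>" by (cases "Im Y \<ge> 0") auto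
  also have "sin \<bar>Im Y\<bar> = sin \<delta>" by (simp add: \<delta>_def)
  also have "\<bar>sin \<delta>\<bar> \<ge> \<delta> / 2" using sin_ge_half[OF \<delta>] by linarith
  finally have "exp (Re Y) * (\<delta> / 4) \<le> exp (Re Y) * \<bar>sin (Im Y)\<bar>" using \<delta> by (intro mult_left_mono) auto
  also have "\<dots> = \<bar>Im (exp Y + of_real t)\<bar>" by (simp add: Im_exp abs_mult)
  also have "\<dots> \<le> norm (exp Y + of_real t)" by (rule abs_Im_le_cmod)
  finally show ?thesis by (simp add: \<delta>_def)
qed

text \<open>The slit point of the same modulus is joined to exp Y by an arc of this length, and a
  chord is no longer than its arc.\<close>

lemma norm_exp_add_exp_Re_le:
  assumes "\<bar>Im Y\<bar> < pi"
  shows "norm (exp Y + of_real (exp (Re Y))) \<le> exp (Re Y) * (pi - \<bar>Im Y\<bar>)"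
proof -
  define \<theta> where "\<theta> = (if Im Y \<ge> 0 then Im Y - pi else Im Y + pi)"
  have "exp Y = of_real (exp (Re Y)) * cis (Im Y)" by (simp add: exp_eq_polar)
  also have "cis (Im Y) = - cis \<theta>" by (simp add: \<theta>_def complex_eq_iff)
  finally have "exp Y + of_real (exp (Re Y)) = of_real (exp (Re Y)) * (- (cis \<theta> - 1))"
    by (simp add: algebra_simps)
  then have "norm (exp Y + of_real (exp (Re Y))) = exp (Re Y) * norm (exp (\<i> * of_real \<theta>) - 1)"
    by (simp only: norm_mult norm_minus_cancel cis_conv_exp norm_of_real abs_exp_cancel)
  also have "norm (exp (\<i> * of_real \<theta>) - 1) = 2 * \<bar>sin (\<theta> / 2)\<bar>" by (rule dist_exp_i_1)
  also have "exp (Re Y) * (2 * \<bar>sin (\<theta> / 2)\<bar>) \<le> exp (Re Y) * (2 * \<bar>\<theta> / 2\<bar>)"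
    by (intro mult_left_mono abs_sin_x_le_abs_x) auto
  also have "2 * \<bar>\<theta> / 2\<bar> = pi - \<bar>Im Y\<bar>" using assms by (auto simp: \<theta>_def)
  finally show ?thesis .
qed

lemma le_infdistI: "A \<noteq> {} \<Longrightarrow> (\<And>a. a \<in> A \<Longrightarrow> c \<le> dist z a) \<Longrightarrow> c \<le> infdist z A"
  by (simp add: infdist_def cINF_greatest)

context finite_bands
begin

text \<open>The exponent of the distance to the endpoint in the weight, up to the angular factor.
  Simplified, it is max (p+q+\<epsilon>) ((p+1+\<epsilon>)/2), which explains the two lower bounds
  below.\<close>

definition gam :: real where "gam = p + 1 + \<epsilon> + exp_a p q \<epsilon>"

lemma gam_gt: "p + q < gam" "1 / 2 < gam"
  using p0 q0 e0 e1 by (auto simp: gam_def exp_a_def pos_part_def max_def field_simps)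

text \<open>\<sigma> points from the endpoint into its band. Within distance L the set
  \<open>E\<close> is just a straight slit issuing from \<omega>, with no other endpoint
  nearby.\<close>

definition slit_at :: "real \<Rightarrow> real \<Rightarrow> real \<Rightarrow> bool" where
  "slit_at \<omega> \<sigma> L \<longleftrightarrow> (\<sigma> = 1 \<or> \<sigma> = -1) \<and> L > 0 \<and> of_real \<omega> \<in> V \<and>
     (\<forall>z\<in>E. (\<exists>t\<ge>0. z = of_real (\<omega> + \<sigma> * t)) \<or> L \<le> dist (of_real \<omega>) z) \<and>
     (\<forall>t. 0 \<le> t \<longrightarrow> t \<le> L \<longrightarrow> of_real (\<omega> + \<sigma> * t) \<in> E) \<and>
     (\<forall>v\<in>V. v \<noteq> of_real \<omega> \<longrightarrow> L \<le> dist (of_real \<omega>) v)"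

lemma bands_ordered: "i < j \<Longrightarrow> j \<le> n \<Longrightarrow> \<beta> i < \<alpha> j"
proof (induction j)
  case (Suc j)
  show ?case
  proof (cases "i = j")
    case False
    then have "\<beta> i < \<alpha> j" using Suc by auto
    also have "\<dots> < \<beta> j" using ab Suc by auto
    also have "\<dots> < \<alpha> (Suc j)" using ba Suc by auto
    finally show ?thesis .
  qed (use ba Suc in auto)
qed auto

lemma ex_slit_at:
  assumes "v \<in> V" obtains \<omega> \<sigma> L where "v = of_real \<omega>" "slit_at \<omega> \<sigma> L"
proof -
  obtain j \<omega> where j: "j \<le> n" "\<omega> = \<alpha> j \<or> \<omega> = \<beta> j" "v = of_real \<omega>"
    using assms by (auto simp: endpts_def)
  define \<sigma> :: real where "\<sigma> = (if \<omega> = \<alpha> j then 1 else -1)"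
  define \<omega>' where "\<omega>' = (if \<omega> = \<alpha> j then \<beta> j else \<alpha> j)"
  define L where "L = infdist (of_real \<omega>) (V - {of_real \<omega> :: complex})"
  have abj: "\<alpha> j < \<beta> j" using ab j by auto
  have \<omega>': "\<omega>' = \<omega> + \<sigma> * \<bar>\<omega>' - \<omega>\<bar>" "of_real \<omega>' \<in> V - {of_real \<omega> :: complex}"
    using j abj endpoints_in_V[OF j(1)] by (auto simp: \<omega>'_def \<sigma>_def)
  have cl: "closed (V - {of_real \<omega>})" using finite_V by (simp add: finite_imp_closed)
  have L: "L > 0"
    using in_closed_iff_infdist_zero[OF cl] \<omega>'(2) infdist_nonneg[of "of_real \<omega>" "V - {of_real \<omega>}"]
    unfolding L_def by (metis Diff_iff empty_iff insertI1 less_eq_real_def)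
  have LV: "L \<le> dist (of_real \<omega>) v" if "v \<in> V" "v \<noteq> of_real \<omega>" for v
    unfolding L_def using that by (intro infdist_le) auto
  have LVr: "L \<le> \<bar>\<omega> - x\<bar>" if "of_real x \<in> V" "x \<noteq> \<omega>" for x
    using LV[of "of_real x"] that by (simp add: dist_of_real dist_real_def)
  have "slit_at \<omega> \<sigma> L" unfolding slit_at_def
  proof (intro conjI ballI allI impI)
    show "\<sigma> = 1 \<or> \<sigma> = -1" by (simp add: \<sigma>_def)
    show "complex_of_real \<omega> \<in> V" using assms j by simp
    fix z assume "z \<in> E"
    then obtain i x where x: "i \<le> n" "\<alpha> i \<le> x" "x \<le> \<beta> i" "z = of_real x" by (auto simp: frak_e_def)
    show "(\<exists>t\<ge>0. z = of_real (\<omega> + \<sigma> * t)) \<or> L \<le> dist (of_real \<omega>) z"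
    proof (cases "i = j")
      case True
      have "x = \<omega> + \<sigma> * \<bar>x - \<omega>\<bar>" using x True j by (auto simp: \<sigma>_def)
      then show ?thesis unfolding x(4) by (intro disjI1 exI[of _ "\<bar>x - \<omega>\<bar>"]) auto
    next
      case False
      \<comment> \<open>Another band lies entirely on one side of \<omega>, so its nearest point is
        one of its endpoints and has distance at least L.\<close>
      have "\<omega> < \<alpha> i \<or> \<beta> i < \<omega>"
        using False bands_ordered[of i j] bands_ordered[of j i] j x abj by (cases i j rule: linorder_cases) auto
      then have "L \<le> \<bar>\<omega> - x\<bar>"
        using LVr[of "\<alpha> i"] LVr[of "\<beta> i"] endpoints_in_V[OF x(1)] x by auto
      then show ?thesis by (simp add: x dist_of_real dist_real_def)
    qed
  next
    fix t assume t: "0 \<le> t" "t \<le> L"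
    have "L \<le> \<bar>\<omega> - \<omega>'\<bar>" using LVr[of \<omega>'] \<omega>'(2) by auto
    then have "\<alpha> j \<le> \<omega> + \<sigma> * t" "\<omega> + \<sigma> * t \<le> \<beta> j"
      using t abj j(2) by (auto simp: \<sigma>_def \<omega>'_def split: if_splits)
    then show "of_real (\<omega> + \<sigma> * t) \<in> E" unfolding frak_e_def using j(1)
      by (intro imageI UN_I[of j]) auto
  qed (use L LV in auto)
  then show ?thesis using that j by blast
qed

text \<open>Near an endpoint \<open>\<omega>\<close> we use logarithmic coordinates: the horizontal lines \<open>Im Y = \<plusminus>\<pi>\<close>
  are the two sides of the cut.\<close>

definition log_chart :: "real \<Rightarrow> real \<Rightarrow> complex \<Rightarrow> complex" where
  "log_chart \<omega> \<sigma> Y = of_real \<omega> - of_real \<sigma> * exp Y"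

text \<open>The bound L/2 makes \<omega> the nearest endpoint and puts the rest of \<open>E\<close>,
  at distance at least L from \<omega>, no closer than exp (Re Y). What remains is the distance to a
  straight slit.\<close>

lemma log_chart_dist:
  assumes s: "slit_at \<omega> \<sigma> L" and Y: "\<bar>Im Y\<bar> < pi" "exp (Re Y) \<le> L / 2"
  shows "infdist (log_chart \<omega> \<sigma> Y) V = exp (Re Y)"
    and "exp (Re Y) * (pi - \<bar>Im Y\<bar>) / 4 \<le> infdist (log_chart \<omega> \<sigma> Y) E"
    and "infdist (log_chart \<omega> \<sigma> Y) E \<le> exp (Re Y) * (pi - \<bar>Im Y\<bar>)"
    and "log_chart \<omega> \<sigma> Y \<notin> E"
proof -
  define z where "z = log_chart \<omega> \<sigma> Y"
  have \<sigma>: "\<bar>\<sigma>\<bar> = 1" "\<sigma> * \<sigma> = 1" using s by (auto simp: slit_at_def)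
  have dz: "dist (of_real \<omega>) z = exp (Re Y)"
    using \<sigma> by (simp add: z_def log_chart_def dist_norm norm_mult)
  have far: "exp (Re Y) \<le> dist z v" if "L \<le> dist (of_real \<omega>) v" for v
    using dist_triangle[of "of_real \<omega>" v z] dz that Y(2) by linarith
  have slit: "norm (z - of_real (\<omega> + \<sigma> * t)) = norm (exp Y + of_real t)" for t
  proof -
    have "z - of_real (\<omega> + \<sigma> * t) = - (of_real \<sigma> * (exp Y + of_real t))"
      by (simp add: z_def log_chart_def algebra_simps)
    then show ?thesis using \<sigma> by (simp only: norm_minus_cancel norm_mult norm_of_real mult_1_left)
  qed
  have "exp (Re Y) \<le> dist z v" if "v \<in> V" for v
    using far[of v] that s dz by (cases "v = of_real \<omega>") (auto simp: slit_at_def dist_commute)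
  then have "exp (Re Y) \<le> infdist z V" using V_nonempty by (simp add: infdist_def cINF_greatest)
  moreover have "infdist z V \<le> exp (Re Y)"
    using s dz by (metis slit_at_def infdist_le dist_commute)
  ultimately show "infdist (log_chart \<omega> \<sigma> Y) V = exp (Re Y)" by (simp add: z_def)
  have "exp (Re Y) * (pi - \<bar>Im Y\<bar>) / 4 \<le> dist z a" if "a \<in> E" for a
  proof (cases "L \<le> dist (of_real \<omega>) a")
    case True
    have "exp (Re Y) * ((pi - \<bar>Im Y\<bar>) / 4) \<le> exp (Re Y) * 1"
      using pi_less_4 by (intro mult_left_mono) auto
    then show ?thesis using far[OF True] unfolding times_divide_eq_right by linarith
  next
    case False
    then obtain t where t: "t \<ge> 0" "a = of_real (\<omega> + \<sigma> * t)" using s \<open>a \<in> E\<close> unfolding slit_at_def by blast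
    then show ?thesis using norm_exp_add_real_ge[OF t(1) Y(1)] slit[of t] by (simp add: dist_norm)
  qed
  then have low: "exp (Re Y) * (pi - \<bar>Im Y\<bar>) / 4 \<le> infdist z E" by (rule le_infdistI[OF E_nonempty])
  then show "exp (Re Y) * (pi - \<bar>Im Y\<bar>) / 4 \<le> infdist (log_chart \<omega> \<sigma> Y) E" by (simp add: z_def)
  have "of_real (\<omega> + \<sigma> * exp (Re Y)) \<in> E" using s Y unfolding slit_at_def by force
  then have "infdist z E \<le> dist z (of_real (\<omega> + \<sigma> * exp (Re Y)))" by (rule infdist_le)
  also have "\<dots> \<le> exp (Re Y) * (pi - \<bar>Im Y\<bar>)"
    unfolding dist_norm slit by (rule norm_exp_add_exp_Re_le[OF Y(1)])
  finally show "infdist (log_chart \<omega> \<sigma> Y) E \<le> exp (Re Y) * (pi - \<bar>Im Y\<bar>)" by (simp add: z_def)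
  have "exp (Re Y) * (pi - \<bar>Im Y\<bar>) / 4 > 0" using Y by simp
  then show "log_chart \<omega> \<sigma> Y \<notin> E" using low unfolding z_def[symmetric] by auto
qed

lemma log_chart_upper:
  assumes s: "slit_at \<omega> \<sigma> L" and f: "adm f K" and Y: "\<bar>Im Y\<bar> < pi" "exp (Re Y) \<le> L / 2"
    and nz: "f (log_chart \<omega> \<sigma> Y) \<noteq> 0"
  shows "ln (norm (f (log_chart \<omega> \<sigma> Y))) \<le> 4 powr p * K * exp (- (p + q) * Re Y) / (pi - \<bar>Im Y\<bar>) powr p"
proof -
  define \<delta> where "\<delta> = pi - \<bar>Im Y\<bar>"
  have \<delta>: "\<delta> > 0" using Y by (simp add: \<delta>_def)
  have K: "K > 0" by (rule adm_pos[OF f])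
  note D = log_chart_dist[OF s Y]
  have "ln (norm (f (log_chart \<omega> \<sigma> Y))) \<le> K / exp (Re Y) powr q / infdist (log_chart \<omega> \<sigma> Y) E powr p"
    using adm_le[OF f D(4) nz] unfolding D(1) by (simp add: mult.commute)
  also have "\<dots> \<le> K / exp (Re Y) powr q / (exp (Re Y) * \<delta> / 4) powr p"
    using D(2) \<delta> p0 K by (intro divide_powr_left_mono) (auto simp: \<delta>_def)
  also have "\<dots> = 4 powr p * K * exp (- (p + q) * Re Y) / \<delta> powr p"
  proof -
    have "(exp (Re Y) * \<delta> / 4) powr p = exp (p * Re Y) * \<delta> powr p / 4 powr p"
      by (simp only: powr_mult powr_divide) (simp add: powr_def[of "exp _"])
    moreover have "exp (Re Y) powr q = exp (q * Re Y)" by (simp add: powr_def)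
    moreover have "exp (- (p + q) * Re Y) = 1 / (exp (p * Re Y) * exp (q * Re Y))"
      by (simp add: exp_minus exp_add field_simps flip: exp_add)
    ultimately show ?thesis by (simp add: mult_ac)
  qed
  finally show ?thesis by (simp add: \<delta>_def)
qed

lemma log_chart_holomorphic: "log_chart \<omega> \<sigma> holomorphic_on A"
  unfolding log_chart_def by (intro holomorphic_intros)

text \<open>The principal logarithm inverts the chart: its branch cut corresponds to the slit, which
  lies in \<open>E\<close> up to distance L.\<close>

lemma log_chart_inverse:
  assumes s: "slit_at \<omega> \<sigma> L" and z: "z \<notin> E" "dist (of_real \<omega>) z \<le> L"
  obtains Y where "log_chart \<omega> \<sigma> Y = z" "\<bar>Im Y\<bar> < pi" "exp (Re Y) = dist (of_real \<omega>) z"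
proof -
  have \<sigma>: "\<bar>\<sigma>\<bar> = 1" "\<sigma> * \<sigma> = 1" using s by (auto simp: slit_at_def)
  define u where "u = - of_real \<sigma> * (z - of_real \<omega>)"
  have zu: "z = of_real \<omega> - of_real \<sigma> * u"
  proof -
    have "of_real \<sigma> * u = - (of_real (\<sigma> * \<sigma>) * (z - of_real \<omega>))" by (simp add: u_def)
    then show ?thesis unfolding \<sigma> by simp
  qed
  have nu: "norm u = dist (of_real \<omega>) z" using \<sigma> by (simp add: u_def norm_mult dist_norm norm_minus_commute)
  have u: "u \<notin> \<real>\<^sub>\<le>\<^sub>0"
  proof
    assume "u \<in> \<real>\<^sub>\<le>\<^sub>0"
    then obtain t where t: "u = - of_real t" "t \<ge> 0"
      by (metis nonpos_Reals_cases of_real_minus neg_0_le_iff_le minus_minus)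
    then have "t \<le> L" using nu z by simp
    then have "of_real (\<omega> + \<sigma> * t) \<in> E" using s t by (simp add: slit_at_def)
    then show False using z zu t by simp
  qed
  then have u0: "u \<noteq> 0" by auto
  show ?thesis
  proof (rule that[of "Ln u"])
    show "log_chart \<omega> \<sigma> (Ln u) = z" using u0 zu by (simp add: log_chart_def)
    show "\<bar>Im (Ln u)\<bar> < pi" using Im_Ln_less_pi[OF u] mpi_less_Im_Ln[OF u0] by auto
    have "exp (Re (Ln u)) = norm u" using u0 by simp
    then show "exp (Re (Ln u)) = dist (of_real \<omega>) z" using nu by (rule trans)
  qed
qed

end

section \<open>Base points at every scale near an endpoint\<close>

context finite_bands
begin

text \<open>The limiting exponent of the lower bound at small scales: p+q from the growth of f, 1/2
  from harmonic measure near the tip of the slit. The exponent obtained for a given g is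
  \<open>base_exp\<close> - 1/2 + g, with g > 1/2.\<close>

definition base_exp :: real where "base_exp = max (p + q) (1/2)"

lemma base_exp_bounds: "p + q \<le> base_exp" "1/2 \<le> base_exp" "base_exp < gam"
  using gam_gt by (auto simp: base_exp_def)

text \<open>A large value at one fixed scale, from \<open>reach_all\<close>. Continuity of
  \<open>Ln\<close> at 1 translates a small disc about the image point into a small set in the
  logarithmic coordinate.\<close>

lemma log_chart_base_far:
  assumes s: "slit_at \<omega> \<sigma> L" and y: "exp y \<le> L / 2"
  obtains C where "C > 0" "\<And>f K. adm f K \<Longrightarrow> \<exists>Y. \<bar>Im Y\<bar> \<le> 1/2 \<and> \<bar>Re Y - y\<bar> \<le> 1/2 \<and>
      f (log_chart \<omega> \<sigma> Y) \<noteq> 0 \<and> ln (norm (f (log_chart \<omega> \<sigma> Y))) \<ge> - (C * K)"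
proof -
  have \<sigma>: "\<bar>\<sigma>\<bar> = 1" "\<sigma> * \<sigma> = 1" using s by (auto simp: slit_at_def)
  have "continuous (at 1) Ln" by (intro continuous_at_Ln) auto
  then obtain \<eta> where \<eta>: "\<eta> > 0" "\<And>u. dist u 1 < \<eta> \<Longrightarrow> dist (Ln u) (Ln 1) < 1/2"
    unfolding continuous_at_eps_delta by (metis half_gt_zero zero_less_one)
  define z0 where "z0 = log_chart \<omega> \<sigma> (of_real y)"
  have "z0 \<notin> E" unfolding z0_def using y by (intro log_chart_dist(4)[OF s]) auto
  moreover have "min \<eta> 1 * exp y > 0" using \<eta> by simp
  ultimately obtain C where C: "C > 0" "\<And>f K. adm f K \<Longrightarrow>
     \<exists>w\<in>ball z0 (min \<eta> 1 * exp y). w \<notin> E \<and> f w \<noteq> 0 \<and> ln (norm (f w)) \<ge> - (C * K)"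
    using reachD[OF reach_all] by metis
  have "\<exists>Y. \<bar>Im Y\<bar> \<le> 1/2 \<and> \<bar>Re Y - y\<bar> \<le> 1/2 \<and>
    f (log_chart \<omega> \<sigma> Y) \<noteq> 0 \<and> ln (norm (f (log_chart \<omega> \<sigma> Y))) \<ge> - (C * K)" if f: "adm f K" for f K
  proof -
    obtain w where w: "dist z0 w < min \<eta> 1 * exp y" "f w \<noteq> 0" "ln (norm (f w)) \<ge> - (C * K)"
      using C(2)[OF f] by auto
    define u where "u = - of_real \<sigma> * (w - of_real \<omega>) / of_real (exp y)"
    have wu: "w = of_real \<omega> - of_real \<sigma> * (u * of_real (exp y))"
    proof -
      have "of_real \<sigma> * (u * of_real (exp y)) = - (of_real (\<sigma> * \<sigma>) * (w - of_real \<omega>))" by (simp add: u_def)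
      then show ?thesis unfolding \<sigma> by simp
    qed
    have "z0 - w = of_real \<sigma> * (u - 1) * of_real (exp y)"
      unfolding wu z0_def log_chart_def exp_of_real by (simp add: algebra_simps)
    then have "dist z0 w = dist u 1 * exp y"
      using \<sigma> by (simp add: dist_norm norm_mult)
    then have du: "dist u 1 < \<eta>" "dist u 1 < 1" using w(1) by auto
    then have u0: "u \<noteq> 0" by auto
    have nL: "norm (Ln u) < 1/2" using \<eta>(2)[OF du(1)] by simp
    define Y where "Y = of_real y + Ln u"
    have "log_chart \<omega> \<sigma> Y = w"
      unfolding Y_def log_chart_def wu exp_add exp_of_real using u0 by (simp add: mult.commute)
    moreover have "\<bar>Im Y\<bar> \<le> 1/2" "\<bar>Re Y - y\<bar> \<le> 1/2"
      using nL abs_Re_le_cmod[of "Ln u"] abs_Im_le_cmod[of "Ln u"] by (auto simp: Y_def)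
    ultimately show ?thesis using w by blast
  qed
  then show ?thesis using that C by blast
qed

text \<open>The point \<open>x1 + \<i> y\<close> plays the role of a base point for the patch at scale \<open>exp x1\<close>.  The factor
  \<open>exp (- A exp (- Y/2))\<close> in the proof absorbs the growth of \<open>f\<close> near the endpoint, so that the
  two constants theorem applies with the bound 1.\<close>

lemma log_chart_base:
  assumes s: "slit_at \<omega> \<sigma> L" and g: "1/2 < g" "g < 1" and X: "exp (X + 1) = L / 2"
  obtains C where "C > 0" "\<And>f K x1. adm f K \<Longrightarrow> x1 \<le> X - 2 \<Longrightarrow>
     \<exists>Y. Re Y = x1 \<and> \<bar>Im Y\<bar> \<le> pi / (2 * g) \<and> f (log_chart \<omega> \<sigma> Y) \<noteq> 0 \<and>
       ln (norm (f (log_chart \<omega> \<sigma> Y))) \<ge> - (C * K * exp (- (base_exp - 1/2 + g) * x1))"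
proof -
  define \<Theta> where "\<Theta> = pi / (2 * g)"
  \<comment> \<open>The strict inequality \<Theta> < pi keeps both the distance d to the cut and the
    cosine bound c2 positive.\<close>
  have \<Theta>: "pi / 2 < \<Theta>" "\<Theta> < pi" "g = pi / (2 * \<Theta>)" using g by (auto simp: \<Theta>_def field_simps)
  then have \<Theta>1: "1/2 < \<Theta>" "\<Theta> > 0" using pi_gt3 by linarith+
  define d where "d = pi - \<Theta>"
  have d: "d > 0" using \<Theta> by (simp add: d_def)
  define c1 where "c1 = exp ((base_exp - p - q) * X)"
  define c2 where "c2 = cos (\<Theta> / 2)"
  have c2: "c2 > 0" unfolding c2_def using \<Theta> \<Theta>1 by (intro cos_gt_zero_pi) auto
  define A0 where "A0 = 4 powr p / d powr p * c1 / c2"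
  have A0: "A0 > 0" using d c2 by (simp add: A0_def c1_def)
  have exX: "exp Z \<le> L / 2" if "Z \<le> X + 1" for Z using that unfolding X[symmetric] by simp
  obtain C0 where C0: "C0 > 0" "\<And>f K. adm f K \<Longrightarrow> \<exists>Y. \<bar>Im Y\<bar> \<le> 1/2 \<and> \<bar>Re Y - (X - 1)\<bar> \<le> 1/2 \<and>
      f (log_chart \<omega> \<sigma> Y) \<noteq> 0 \<and> ln (norm (f (log_chart \<omega> \<sigma> Y))) \<ge> - (C0 * K)"
    using log_chart_base_far[OF s exX[of "X - 1"]] by auto
  define D where "D = C0 * exp ((base_exp - 1/2) * X) + A0 * exp (- (X - 3/2) / 2)"
  have D: "D > 0" using C0 A0 by (simp add: D_def add_pos_pos)
  define b0 where "b0 = cos (1/2) * (exp (- g * X) * (exp (g/2) - exp (- g/2)))"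
  have cos_half: "cos (1/2) > (0::real)" using pi_gt3 by (intro cos_gt_zero_pi) auto
  have b0: "b0 > 0" unfolding b0_def using cos_half g by (intro mult_pos_pos) auto
  show ?thesis
  proof (rule that[of "D / b0"])
    show "D / b0 > 0" using D b0 by simp
    fix f K x1 assume f: "adm f K" and x1: "x1 \<le> X - 2"
    have K: "K > 0" by (rule adm_pos[OF f])
    define e1 where "e1 = exp (- (base_exp - 1/2) * x1)"
    define A where "A = A0 * K * e1"
    have A: "A > 0" using A0 K by (simp add: A_def e1_def)
    define F where "F = (\<lambda>Y. f (log_chart \<omega> \<sigma> Y))"
    define G where "G = (\<lambda>Y. F Y * exp (- of_real A * exp (- Y / 2)))"
    define U where "U = {Y. \<bar>Im Y\<bar> < pi \<and> Re Y < X + 1}"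
    define Q where "Q = cbox (Complex x1 (- \<Theta>)) (Complex X \<Theta>)"
    have U_eq: "U = {Y. Im Y < pi} \<inter> {Y. Im Y > - pi} \<inter> {Y. Re Y < X + 1}"
      by (auto simp: U_def)
    have U: "open U" unfolding U_eq
      by (intro open_Int open_halfspace_Im_lt open_halfspace_Im_gt open_halfspace_Re_lt)
    have QU: "Q \<subseteq> U" using \<Theta> by (auto simp: Q_def U_def in_cbox_complex_iff)
    have UE: "log_chart \<omega> \<sigma> ` U \<subseteq> - E"
      using log_chart_dist(4)[OF s] exX by (auto simp: U_def)
    have "(f \<circ> log_chart \<omega> \<sigma>) holomorphic_on U"
      by (rule holomorphic_on_compose_gen[OF log_chart_holomorphic adm_holomorphic[OF f] UE])
    then have "F holomorphic_on U" by (simp add: F_def o_def)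
    then have G: "G holomorphic_on U" unfolding G_def by (intro holomorphic_intros) auto
    have Ree: "Re (exp (- Y / 2)) = exp (- Re Y / 2) * cos (Im Y / 2)" for Y
      by (simp add: Re_exp)
    have nG: "norm (G Y) = norm (F Y) * exp (- A * Re (exp (- Y / 2)))" for Y
      by (simp add: G_def norm_mult)
    have lnG: "ln (norm (G Y)) = ln (norm (F Y)) - A * Re (exp (- Y / 2))" if "F Y \<noteq> 0" for Y
      unfolding nG using that by (simp add: ln_mult)
    have cospos: "c2 \<le> cos (Im Y / 2)" if "\<bar>Im Y\<bar> \<le> \<Theta>" for Y
    proof -
      have "cos (\<Theta> / 2) \<le> cos (\<bar>Im Y\<bar> / 2)" using that \<Theta> by (intro cos_monotone_0_pi_le) auto
      then show ?thesis by (cases "Im Y \<ge> 0") (simp_all add: c2_def)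
    qed
    have G1: "norm (G Y) \<le> 1" if Y: "Y \<in> Q" for Y
    proof (cases "F Y = 0")
      case False
      have Y': "x1 \<le> Re Y" "Re Y \<le> X" "\<bar>Im Y\<bar> \<le> \<Theta>" using Y by (auto simp: Q_def in_cbox_complex_iff)
      then have Im: "\<bar>Im Y\<bar> < pi" using \<Theta> by linarith
      have "ln (norm (F Y)) \<le> 4 powr p * K * exp (- (p + q) * Re Y) / (pi - \<bar>Im Y\<bar>) powr p"
        unfolding F_def using False Y' by (intro log_chart_upper[OF s f Im] exX) (auto simp: F_def)
      also have "\<dots> \<le> 4 powr p * K * exp (- (p + q) * Re Y) / d powr p"
        using d K p0 Y' by (intro divide_powr_left_mono) (auto simp: d_def)
      also have "exp (- (p + q) * Re Y) \<le> c1 * (e1 * exp (- Re Y / 2))"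
      proof -
        \<comment> \<open>Three parts: the first is largest at Re Y = X, the second at Re Y = x1,
          and the third is what the auxiliary exponential absorbs.\<close>
        have "- (p + q) * Re Y = (base_exp - p - q) * Re Y + (- (base_exp - 1/2) * Re Y + - Re Y / 2)"
          by (simp add: field_simps)
        moreover have "(base_exp - p - q) * Re Y \<le> (base_exp - p - q) * X"
          using base_exp_bounds Y' by (intro mult_left_mono) auto
        moreover have "(base_exp - 1/2) * x1 \<le> (base_exp - 1/2) * Re Y"
          using base_exp_bounds Y' by (intro mult_left_mono) auto
        ultimately have "- (p + q) * Re Y \<le> (base_exp - p - q) * X + (- (base_exp - 1/2) * x1 + - Re Y / 2)"
          unfolding mult_minus_left by linarith
        then show ?thesis unfolding c1_def e1_def exp_add[symmetric] by simp
      qed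
      also have "c1 * (e1 * exp (- Re Y / 2)) \<le> c1 * (e1 * (Re (exp (- Y / 2)) / c2))"
      proof -
        have "exp (- Re Y / 2) * c2 \<le> Re (exp (- Y / 2))"
          unfolding Ree using cospos[OF Y'(3)] by (intro mult_left_mono) auto
        then have "exp (- Re Y / 2) \<le> Re (exp (- Y / 2)) / c2" using c2 by (simp add: field_simps)
        then show ?thesis by (intro mult_left_mono) (auto simp: c1_def e1_def)
      qed
      finally have "ln (norm (F Y)) \<le> 4 powr p * K * (c1 * (e1 * (Re (exp (- Y / 2)) / c2))) / d powr p"
        using K by (simp add: divide_right_mono mult_left_mono)
      also have "\<dots> = A * Re (exp (- Y / 2))" by (simp add: A_def A0_def mult_ac)
      finally have "ln (norm (G Y)) \<le> 0" using lnG[OF False] by simp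
      then show ?thesis using False by (simp add: ln_le_zero_iff nG)
    qed (simp add: nG)
    obtain Yb where Yb: "\<bar>Im Yb\<bar> \<le> 1/2" "\<bar>Re Yb - (X - 1)\<bar> \<le> 1/2" "F Yb \<noteq> 0" "ln (norm (F Yb)) \<ge> - (C0 * K)"
      using C0(2)[OF f] unfolding F_def by blast
    \<comment> \<open>The gap 1/2 to the right side Re Y = X, where the comparison function
      vanishes, gives the lower bound for b; the other inequality separates Yb from the left
      side.\<close>
    then have ReYb: "X - 3/2 \<le> Re Yb" "Re Yb \<le> X - 1/2" by argo+
    define b where "b = cos (g * Im Yb) * (exp (g * (x1 - Re Yb)) - exp (g * (Re Yb + x1 - 2 * X)))"
    obtain z where z: "Re z = x1" "\<bar>Im z\<bar> \<le> \<Theta>" "G z \<noteq> 0" "ln (norm (G z)) \<ge> ln (norm (G Yb)) / b"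
    proof (rule rectangle_two_constants[OF G U _ _ _ _ _ _ _ \<Theta>(3) b_def])
      show "cbox (Complex x1 (- \<Theta>)) (Complex X \<Theta>) \<subseteq> U" using QU by (simp add: Q_def)
      show "norm (G z) \<le> 1" if "z \<in> cbox (Complex x1 (- \<Theta>)) (Complex X \<Theta>)" for z
        using G1 that by (simp add: Q_def)
      show "\<Theta> > 0" by (rule \<Theta>1)
      show "x1 < Re Yb" "Re Yb < X" using ReYb x1 by linarith+
      show "\<bar>Im Yb\<bar> < \<Theta>" using Yb \<Theta>1 by linarith
      show "G Yb \<noteq> 0" using Yb by (simp add: G_def)
    qed
    \<comment> \<open>The influence of the left side decays like exp (g x1). Division by b therefore
      adds g to the exponent of the loss.\<close>
    have b: "b0 * exp (g * x1) \<le> b"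
    proof -
      have "cos (1/2) \<le> cos (g * Im Yb)"
      proof -
        have "\<bar>g * Im Yb\<bar> \<le> 1 * (1/2)" unfolding abs_mult using g Yb by (intro mult_mono) auto
        then have "cos (1/2) \<le> cos \<bar>g * Im Yb\<bar>" using pi_gt3 by (intro cos_monotone_0_pi_le) auto
        then show ?thesis by (cases "g * Im Yb \<ge> 0") simp_all
      qed
      moreover have "exp (g * x1) * (exp (- g * X) * (exp (g/2) - exp (- g/2))) \<le>
         exp (g * (x1 - Re Yb)) - exp (g * (Re Yb + x1 - 2 * X))"
      proof -
        have "g * (x1 - X + 1/2) \<le> g * (x1 - Re Yb)" "g * (Re Yb + x1 - 2 * X) \<le> g * (x1 - X - 1/2)"
          using g ReYb by (intro mult_left_mono; simp)+
        then have "exp (g * (x1 - X + 1/2)) - exp (g * (x1 - X - 1/2)) \<le>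
          exp (g * (x1 - Re Yb)) - exp (g * (Re Yb + x1 - 2 * X))"
          by (intro diff_mono) simp_all
        moreover have "g * (x1 - X + 1/2) = g * x1 + (- g * X + g/2)" "g * (x1 - X - 1/2) = g * x1 + (- g * X + - g/2)"
          by (simp_all add: field_simps)
        ultimately show ?thesis by (simp only: exp_add right_diff_distrib)
      qed
      moreover have "0 \<le> exp (g * x1) * (exp (- g * X) * (exp (g/2) - exp (- g/2)))" using g by simp
      ultimately have "cos (1/2) * (exp (g * x1) * (exp (- g * X) * (exp (g/2) - exp (- g/2)))) \<le> b"
        unfolding b_def using cos_half by (intro mult_mono) auto
      then show ?thesis by (simp add: b0_def mult_ac)
    qed
    have lnGb: "- (D * K * e1) \<le> ln (norm (G Yb))"
    proof -
      have "1 \<le> exp ((base_exp - 1/2) * X) * e1"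
      proof -
        have "(base_exp - 1/2) * x1 \<le> (base_exp - 1/2) * X" using base_exp_bounds x1 by (intro mult_left_mono) auto
        then show ?thesis unfolding e1_def exp_add[symmetric] mult_minus_left one_le_exp_iff by linarith
      qed
      then have "C0 * K * 1 \<le> C0 * K * (exp ((base_exp - 1/2) * X) * e1)"
        using C0 K by (intro mult_left_mono) auto
      moreover have "A * Re (exp (- Yb / 2)) \<le> A * exp (- (X - 3/2) / 2)"
      proof (rule mult_left_mono)
        have "exp (- Re Yb / 2) * cos (Im Yb / 2) \<le> exp (- (X - 3/2) / 2) * 1"
          using ReYb cospos[of Yb] Yb(1) \<Theta>1 c2 by (intro mult_mono') (auto simp: field_simps)
        then show "Re (exp (- Yb / 2)) \<le> exp (- (X - 3/2) / 2)" unfolding Ree by simp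
      qed (use A in simp)
      ultimately show ?thesis using Yb(4) lnG[OF Yb(3)] by (simp add: D_def A_def algebra_simps)
    qed
    have bpos: "b > 0" using b b0 by (meson exp_gt_zero mult_pos_pos order_less_le_trans)
    \<comment> \<open>The factor e1 stems from the auxiliary exponential, the denominator from b;
      removing that exponential at the end only helps, as its modulus is at most 1.\<close>
    have "- (D / b0 * K * exp (- (base_exp - 1/2 + g) * x1)) = - (D * K * e1) / (b0 * exp (g * x1))"
    proof -
      have "exp (- (base_exp - 1/2 + g) * x1) = e1 / exp (g * x1)"
        by (simp add: e1_def exp_diff[symmetric] algebra_simps)
      then show ?thesis by simp
    qed
    also have "\<dots> \<le> - (D * K * e1) / b"
    proof -
      have "D * K * e1 / b \<le> D * K * e1 / (b0 * exp (g * x1))"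
        using b b0 bpos D K by (intro divide_left_mono) (auto simp: e1_def)
      then show ?thesis by simp
    qed
    also have "\<dots> \<le> ln (norm (G Yb)) / b" using lnGb bpos by (intro divide_right_mono) auto
    also have "\<dots> \<le> ln (norm (G z))" by (rule z)
    also have "\<dots> \<le> ln (norm (F z))"
    proof -
      have "F z \<noteq> 0" using z(3) by (auto simp: G_def)
      moreover have "0 \<le> Re (exp (- z / 2))" unfolding Ree using cospos[OF z(2)] c2 by simp
      ultimately show ?thesis using lnG[of z] A by simp
    qed
    finally have "- (D / b0 * K * exp (- (base_exp - 1/2 + g) * x1)) \<le> ln (norm (F z))" .
    moreover have "F z \<noteq> 0" using z(3) by (auto simp: G_def)
    ultimately show "\<exists>Y. Re Y = x1 \<and> \<bar>Im Y\<bar> \<le> pi / (2 * g) \<and> f (log_chart \<omega> \<sigma> Y) \<noteq> 0 \<and>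
       ln (norm (f (log_chart \<omega> \<sigma> Y))) \<ge> - (D / b0 * K * exp (- (base_exp - 1/2 + g) * x1))"
      using z by (intro exI[of _ z]) (simp add: F_def \<Theta>_def)
  qed
qed

end

section \<open>Zero sums near an endpoint\<close>

context finite_bands
begin

lemma log_chart_weight:
  assumes s: "slit_at \<omega> \<sigma> L"
  obtains B where "B > 0" "\<And>Y. \<bar>Im Y\<bar> < pi \<Longrightarrow> exp (Re Y) \<le> L / 2 \<Longrightarrow>
     wt (log_chart \<omega> \<sigma> Y) \<le> B * exp (gam * Re Y) * (pi - \<bar>Im Y\<bar>) powr (p + 1 + \<epsilon>)"
proof -
  have "1 + norm z \<noteq> 0" for z :: complex using norm_ge_zero[of z] by linarith
  then have "continuous_on (cball (of_real \<omega>) L) (\<lambda>z::complex. (1 + norm z) powr exp_b p q \<epsilon>)"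
    by (intro continuous_intros) auto
  then have "bounded ((\<lambda>z::complex. (1 + norm z) powr exp_b p q \<epsilon>) ` cball (of_real \<omega>) L)"
    using compact_cball by (intro compact_imp_bounded compact_continuous_image) auto
  then obtain B where B: "B > 0"
    "\<And>z::complex. z \<in> cball (of_real \<omega>) L \<Longrightarrow> (1 + norm z) powr exp_b p q \<epsilon> \<le> B"
    by (fastforce simp: bounded_pos)
  show ?thesis
  proof (rule that[OF B(1)])
    fix Y assume Y: "\<bar>Im Y\<bar> < pi" "exp (Re Y) \<le> L / 2"
    define z where "z = log_chart \<omega> \<sigma> Y"
    define \<delta> where "\<delta> = pi - \<bar>Im Y\<bar>"
    have \<delta>: "\<delta> > 0" using Y by (simp add: \<delta>_def)
    note D = log_chart_dist[OF s Y, folded z_def \<delta>_def]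
    have \<sigma>: "\<bar>\<sigma>\<bar> = 1" "L > 0" using s by (auto simp: slit_at_def)
    have "dist (of_real \<omega>) z \<le> L"
      using \<sigma> Y(2) by (simp add: z_def log_chart_def dist_norm norm_mult)
    then have 1: "(1 + norm z) powr exp_b p q \<epsilon> \<le> B" by (intro B) simp
    have "infdist z E powr (p + 1 + \<epsilon>) \<le> (exp (Re Y) * \<delta>) powr (p + 1 + \<epsilon>)"
      using D p0 e0 by (intro powr_mono2) (auto simp: infdist_nonneg)
    also have "\<dots> = exp ((p + 1 + \<epsilon>) * Re Y) * \<delta> powr (p + 1 + \<epsilon>)"
      by (simp only: powr_mult) (simp add: powr_def[of "exp _"])
    finally have "infdist z E powr (p + 1 + \<epsilon>) * infdist z V powr exp_a p q \<epsilon> \<le>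
      exp ((p + 1 + \<epsilon>) * Re Y) * \<delta> powr (p + 1 + \<epsilon>) * exp (exp_a p q \<epsilon> * Re Y)"
      unfolding D(1) by (simp add: powr_def[of "exp _"])
    also have "\<dots> = exp (gam * Re Y) * \<delta> powr (p + 1 + \<epsilon>)"
      by (simp add: gam_def distrib_right exp_add)
    finally have "wt z \<le> exp (gam * Re Y) * \<delta> powr (p + 1 + \<epsilon>) * B"
      unfolding wt_def using 1 by (rule mult_mono) auto
    then show "wt (log_chart \<omega> \<sigma> Y) \<le> B * exp (gam * Re Y) * (pi - \<bar>Im Y\<bar>) powr (p + 1 + \<epsilon>)"
      by (simp add: z_def \<delta>_def mult_ac)
  qed
qed

text \<open>At scale exp (x k) the weight contributes exp (gam * x k) and the function exp (-b * x
  k). Since b < \<open>gam\<close> and x k decreases by 1 at each step, the contributions decay with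
  ratio exp (-(gam - b)).\<close>

lemma controlled_endpoint:
  assumes s: "slit_at \<omega> \<sigma> L" shows "\<exists>r>0. controlled (ball (of_real \<omega>) r)"
proof -
  have L: "L > 0" using s by (simp add: slit_at_def)
  \<comment> \<open>The excess over 1/2 uses at most half of the gap between \<open>base_exp\<close>
    and \<open>gam\<close>, which keeps b below \<open>gam\<close>; the cap 1/4 keeps g below
    1.\<close>
  define g where "g = 1/2 + min ((gam - base_exp) / 2) (1/4)"
  define b where "b = base_exp - 1/2 + g"
  define h where "h = min ((gam - base_exp) / 2) (1/4)"
  have h: "0 < h" "h \<le> 1/4" using base_exp_bounds(3) by (auto simp: h_def)
  have "h \<le> (gam - base_exp) / 2" unfolding h_def by (rule min.cobounded1)
  note h = h this
  have gh: "g = 1/2 + h" by (simp add: g_def h_def)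
  have g: "1/2 < g" "g < 1" unfolding gh using h by argo+
  have b: "b < gam" "p + q \<le> b" unfolding b_def gh using h base_exp_bounds by argo+
  define \<Theta> where "\<Theta> = pi / (2 * g)"
  have \<Theta>: "\<Theta> < pi" "\<Theta> > 0" using g by (auto simp: \<Theta>_def field_simps)
  define X where "X = ln (L / 2) - 1"
  have X: "exp (X + 1) = L / 2" using L by (simp add: X_def)
  have exX: "exp Z \<le> L / 2" if "Z \<le> X + 1" for Z using that unfolding X[symmetric] by simp
  \<comment> \<open>Unit steps match the slabs |Re z| <= 1/2 of the rectangle, and starting at X - 2
    keeps every shifted rectangle within the range of the chart.\<close>
  define x where "x = (\<lambda>k::nat. X - 2 - real k)"
  obtain C1 where C1: "C1 > 0" "\<And>f K x1. adm f K \<Longrightarrow> x1 \<le> X - 2 \<Longrightarrow>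
     \<exists>Y. Re Y = x1 \<and> \<bar>Im Y\<bar> \<le> \<Theta> \<and> f (log_chart \<omega> \<sigma> Y) \<noteq> 0 \<and>
       ln (norm (f (log_chart \<omega> \<sigma> Y))) \<ge> - (C1 * K * exp (- b * x1))"
    using log_chart_base[OF s g X] unfolding b_def \<Theta>_def by blast
  obtain B where B: "B > 0" "\<And>Y. \<bar>Im Y\<bar> < pi \<Longrightarrow> exp (Re Y) \<le> L / 2 \<Longrightarrow>
     wt (log_chart \<omega> \<sigma> Y) \<le> B * exp (gam * Re Y) * (pi - \<bar>Im Y\<bar>) powr (p + 1 + \<epsilon>)"
    using log_chart_weight[OF s] by blast
  \<comment> \<open>The possible base points after translation: one compact segment for all scales,
    because \<Theta> < pi is fixed.\<close>
  define Q where "Q = cbox (Complex 0 (- \<Theta>)) (Complex 0 \<Theta>)"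
  have Q: "compact Q" "Q \<subseteq> patch" using \<Theta> by (auto simp: Q_def compact_cbox patch_def in_cbox_complex_iff)
  obtain C2 where C2: "C2 > 0" and sum:
    "\<And>f K \<phi> \<tau> M c S. adm f K \<Longrightarrow> \<phi> holomorphic_on patch \<Longrightarrow> (\<And>z. z \<in> patch \<Longrightarrow> \<phi> z \<notin> E) \<Longrightarrow>
       M > 0 \<Longrightarrow> c \<in> Q \<Longrightarrow> f (\<phi> c) \<noteq> 0 \<Longrightarrow> ln (norm (f (\<phi> c))) \<ge> - M \<Longrightarrow>
       (\<And>z. z \<in> patch \<Longrightarrow> f (\<phi> z) \<noteq> 0 \<Longrightarrow> ln (norm (f (\<phi> z))) \<le> M / (pi - \<bar>Im z\<bar>) powr p) \<Longrightarrow>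
       finite S \<Longrightarrow> (\<And>s. s \<in> S \<Longrightarrow> \<phi> (\<tau> s) = s \<and> \<bar>Re (\<tau> s)\<bar> \<le> 1/2 \<and> \<bar>Im (\<tau> s)\<bar> < pi) \<Longrightarrow>
       (\<Sum>s\<in>S. real (nat (zorder f s)) * (pi - \<bar>Im (\<tau> s)\<bar>) powr (p + 1 + \<epsilon>)) \<le> C2 * M"
    using patch_sum[OF Q] by blast
  \<comment> \<open>C1 serves the base point; the other entry serves the growth bound, with exp (p +
    q) for the variation of Re over a rectangle and the last factor for replacing p + q by the
    larger exponent b.\<close>
  define D where "D = max C1 (4 powr p * exp (p + q) * exp ((b - (p + q)) * (X - 2)))"
  have D: "D > 0" "C1 \<le> D" "4 powr p * exp (p + q) * exp ((b - (p + q)) * (X - 2)) \<le> D"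
    using C1 by (auto simp: D_def)
  have "\<exists>Y. log_chart \<omega> \<sigma> Y = z \<and> \<bar>Im Y\<bar> < pi \<and> exp (Re Y) = dist (of_real \<omega>) z"
    if "z \<in> ball (of_real \<omega>) (exp (X - 2)) - E" for z
  proof -
    have "exp (X - 2) \<le> L / 2" by (intro exX) simp
    then have "dist (of_real \<omega>) z \<le> L" using that L by auto
    then show ?thesis using log_chart_inverse[OF s, of z] that by blast
  qed
  then obtain Y where Y: "\<And>z. z \<in> ball (of_real \<omega>) (exp (X - 2)) - E \<Longrightarrow>
     log_chart \<omega> \<sigma> (Y z) = z \<and> \<bar>Im (Y z)\<bar> < pi \<and> exp (Re (Y z)) = dist (of_real \<omega>) z"
    by metis
  \<comment> \<open>Adding 1/2 before the floor picks the nearest x k, at distance at most 1/2. The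
    argument is positive since Re (Y z) lies below X - 2.\<close>
  define \<kappa> where "\<kappa> = (\<lambda>z. nat \<lfloor>X - 2 - Re (Y z) + 1/2\<rfloor>)"
  define \<theta> where "\<theta> = exp (- (gam - b))"
  have \<theta>: "0 \<le> \<theta>" "\<theta> < 1" using b by (auto simp: \<theta>_def)
  define A where "A = B * exp (gam / 2) * exp ((gam - b) * (X - 2)) * (C2 * D)"
  have "controlled (ball (of_real \<omega>) (exp (X - 2)))" unfolding controlled_def
  proof (intro exI[of _ "A / (1 - \<theta>)"] allI impI)
    fix f K S assume f: "adm f K" and S: "finite S" "S \<subseteq> ball (of_real \<omega>) (exp (X - 2)) - E"
    have K: "K > 0" by (rule adm_pos[OF f])
    have "(\<Sum>z\<in>S. real (nat (zorder f z)) * wt z) \<le> A * K / (1 - \<theta>)"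
    proof (rule sum_le_geometric[OF S(1) _ \<theta>])
      show "0 \<le> A * K" using K B D C2 by (simp add: A_def)
      fix k
      define T where "T = {z\<in>S. \<kappa> z = k}"
      have T: "log_chart \<omega> \<sigma> (Y z) = z" "\<bar>Im (Y z)\<bar> < pi" "\<bar>Re (Y z) - x k\<bar> \<le> 1/2" "Re (Y z) \<le> X - 2"
        if "z \<in> T" for z
      proof -
        have z: "z \<in> ball (of_real \<omega>) (exp (X - 2)) - E" "\<kappa> z = k" using that S by (auto simp: T_def)
        then show "log_chart \<omega> \<sigma> (Y z) = z" "\<bar>Im (Y z)\<bar> < pi" using Y by auto
        have "exp (Re (Y z)) < exp (X - 2)" using z(1) Y[OF z(1)] by simp
        then show le: "Re (Y z) \<le> X - 2" by simp
        then have "\<lfloor>X - 2 - Re (Y z) + 1/2\<rfloor> = int k" using z(2) by (auto simp: \<kappa>_def)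
        then have "real k \<le> X - 2 - Re (Y z) + 1/2" "X - 2 - Re (Y z) + 1/2 < real k + 1" by linarith+
        then show "\<bar>Re (Y z) - x k\<bar> \<le> 1/2" unfolding x_def by argo
      qed
      define \<phi> where "\<phi> = (\<lambda>Z. log_chart \<omega> \<sigma> (Z + of_real (x k)))"
      define M where "M = D * K * exp (- b * x k)"
      have xk: "x k \<le> X - 2" by (simp add: x_def)
      have M: "M > 0" using D K by (simp add: M_def)
      have low: "exp (Re (Z + of_real (x k))) \<le> L / 2" "\<bar>Im (Z + of_real (x k))\<bar> < pi" if "Z \<in> patch" for Z
      proof -
        show "exp (Re (Z + of_real (x k))) \<le> L / 2"
          using that xk by (intro exX) (auto simp: patch_def)
        show "\<bar>Im (Z + of_real (x k))\<bar> < pi" using that by (simp add: patch_def)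
      qed
      obtain Yc where Yc: "Re Yc = x k" "\<bar>Im Yc\<bar> \<le> \<Theta>" "f (log_chart \<omega> \<sigma> Yc) \<noteq> 0"
        "ln (norm (f (log_chart \<omega> \<sigma> Yc))) \<ge> - (C1 * K * exp (- b * x k))"
        using C1(2)[OF f xk] by blast
      have *: "(\<Sum>z\<in>T. real (nat (zorder f z)) * (pi - \<bar>Im (Y z - of_real (x k))\<bar>) powr (p + 1 + \<epsilon>)) \<le> C2 * M"
      proof (rule sum[OF f])
        have "(log_chart \<omega> \<sigma> \<circ> (\<lambda>Z. Z + of_real (x k))) holomorphic_on patch"
          by (rule holomorphic_on_compose_gen[OF _ log_chart_holomorphic subset_UNIV]) (intro holomorphic_intros)
        then show "\<phi> holomorphic_on patch" by (simp add: \<phi>_def o_def)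
        show "\<phi> z \<notin> E" if "z \<in> patch" for z
          unfolding \<phi>_def using low[OF that] by (intro log_chart_dist(4)[OF s])
        show "0 < M" by (rule M)
        show "Complex 0 (Im Yc) \<in> Q" using Yc by (auto simp: Q_def in_cbox_complex_iff)
        have "Complex 0 (Im Yc) + of_real (x k) = Yc" using Yc(1) by (simp add: complex_eq_iff)
        then have e: "\<phi> (Complex 0 (Im Yc)) = log_chart \<omega> \<sigma> Yc" by (simp add: \<phi>_def)
        show "f (\<phi> (Complex 0 (Im Yc))) \<noteq> 0" unfolding e by (rule Yc)
        have "C1 * K * exp (- b * x k) \<le> M" unfolding M_def using D K by (intro mult_right_mono) auto
        then show "- M \<le> ln (norm (f (\<phi> (Complex 0 (Im Yc)))))" unfolding e using Yc(4) by linarith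
        show "finite T" using S by (simp add: T_def)
        fix z assume z: "z \<in> patch" "f (\<phi> z) \<noteq> 0"
        have \<delta>: "pi - \<bar>Im z\<bar> > 0" using z by (simp add: patch_def)
        have "ln (norm (f (\<phi> z))) \<le> 4 powr p * K * exp (- (p + q) * Re (z + of_real (x k))) / (pi - \<bar>Im z\<bar>) powr p"
          using log_chart_upper[OF s f low(2,1)[OF z(1)]] z(2) by (simp add: \<phi>_def)
        also have "\<dots> \<le> M / (pi - \<bar>Im z\<bar>) powr p"
        proof (rule divide_right_mono)
          have "exp (- (p + q) * Re (z + of_real (x k))) \<le>
            exp (p + q) * exp ((b - (p + q)) * (X - 2)) * exp (- b * x k)"
          proof -
            have e: "- (p + q) * Re (z + of_real (x k)) = (p + q) * - Re z + (b - (p + q)) * x k + - b * x k"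
              by (simp add: algebra_simps)
            have "(p + q) * - Re z \<le> (p + q) * 1"
              using z p0 q0 by (intro mult_left_mono) (auto simp: patch_def)
            moreover have "(b - (p + q)) * x k \<le> (b - (p + q)) * (X - 2)" using b xk by (intro mult_left_mono) auto
            ultimately show ?thesis unfolding exp_add[symmetric] exp_le_cancel_iff e
              by (intro add_mono) simp_all
          qed
          then have "4 powr p * K * exp (- (p + q) * Re (z + of_real (x k))) \<le>
            4 powr p * K * (exp (p + q) * exp ((b - (p + q)) * (X - 2)) * exp (- b * x k))"
            using K by (intro mult_left_mono) auto
          also have "\<dots> = (4 powr p * exp (p + q) * exp ((b - (p + q)) * (X - 2))) * (K * exp (- b * x k))"
            by (simp only: mult_ac)
          also have "\<dots> \<le> D * (K * exp (- b * x k))" using D K by (intro mult_right_mono) auto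
          finally show "4 powr p * K * exp (- (p + q) * Re (z + of_real (x k))) \<le> M"
            by (simp add: M_def mult_ac)
        qed simp
        finally show "ln (norm (f (\<phi> z))) \<le> M / (pi - \<bar>Im z\<bar>) powr p" .
      next
        fix z assume "z \<in> T"
        then show "\<phi> (Y z - of_real (x k)) = z \<and> \<bar>Re (Y z - of_real (x k))\<bar> \<le> 1/2 \<and> \<bar>Im (Y z - of_real (x k))\<bar> < pi"
          using T[of z] by (simp add: \<phi>_def)
      qed
      define B' where "B' = B * exp (gam * (x k + 1/2))"
      have "(\<Sum>z\<in>T. real (nat (zorder f z)) * wt z) \<le>
        (\<Sum>z\<in>T. real (nat (zorder f z)) * (B' * (pi - \<bar>Im (Y z - of_real (x k))\<bar>) powr (p + 1 + \<epsilon>)))"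
      proof (intro sum_mono mult_left_mono)
        fix z assume z: "z \<in> T"
        have "wt z \<le> B * exp (gam * Re (Y z)) * (pi - \<bar>Im (Y z)\<bar>) powr (p + 1 + \<epsilon>)"
          using B(2)[of "Y z"] T[OF z] exX[of "Re (Y z)"] by simp
        also have "\<dots> \<le> B' * (pi - \<bar>Im (Y z)\<bar>) powr (p + 1 + \<epsilon>)"
        proof -
          have "Re (Y z) \<le> x k + 1/2" using T(3)[OF z] by argo
          then show ?thesis unfolding B'_def using B gam_gt by (intro mult_right_mono mult_left_mono) auto
        qed
        finally show "wt z \<le> B' * (pi - \<bar>Im (Y z - of_real (x k))\<bar>) powr (p + 1 + \<epsilon>)" by simp
      qed auto
      also have "\<dots> = B' * (\<Sum>z\<in>T. real (nat (zorder f z)) * (pi - \<bar>Im (Y z - of_real (x k))\<bar>) powr (p + 1 + \<epsilon>))"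
        by (simp add: sum_distrib_left mult.left_commute)
      also have "\<dots> \<le> B' * (C2 * M)" using * B by (intro mult_left_mono) (auto simp: B'_def)
      also have "\<dots> = A * K * \<theta> ^ k"
      proof -
        have "\<theta> ^ k = exp (real k * (- (gam - b)))" unfolding \<theta>_def by (simp only: exp_of_nat_mult)
        moreover have "exp (gam * (x k + 1/2)) * exp (- b * x k) =
          exp (gam / 2) * exp ((gam - b) * (X - 2)) * exp (real k * (- (gam - b)))"
          unfolding exp_add[symmetric] x_def by (simp add: algebra_simps)
        ultimately show ?thesis by (simp add: B'_def M_def A_def mult_ac)
      qed
      finally show "(\<Sum>z\<in>{z\<in>S. \<kappa> z = k}. real (nat (zorder f z)) * wt z) \<le> A * K * \<theta> ^ k"
        by (simp add: T_def)
    qed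
    then show "(\<Sum>z\<in>S. real (nat (zorder f z)) * wt z) \<le> A / (1 - \<theta>) * K" by simp
  qed
  then show ?thesis by (intro exI[of _ "exp (X - 2)"]) auto
qed

end

section \<open>Zero sums near infinity\<close>

lemma powr_comparable:
  fixes x y a :: real
  assumes "x > 0" "x / 2 \<le> y" "y \<le> 2 * x"
  shows "y powr a \<le> 2 powr \<bar>a\<bar> * x powr a"
proof (cases "a \<ge> 0")
  case True
  then have "y powr a \<le> (2 * x) powr a" using assms by (intro powr_mono2) auto
  then show ?thesis using True by (simp only: powr_mult abs_of_nonneg)
next
  case False
  then have "y powr a \<le> (x / 2) powr a" using assms by (intro powr_mono2') auto
  also have "\<dots> = 2 powr - a * x powr a" by (simp only: powr_divide) (simp add: powr_minus field_simps)
  finally show ?thesis using False by simp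
qed

lemma infdist_far:
  assumes A: "A \<subseteq> ball 0 R" "A \<noteq> {}" and z: "2 * R \<le> norm z"
  shows "norm z / 2 \<le> infdist z A" "infdist z A \<le> 2 * norm z"
proof -
  obtain a where a: "a \<in> A" using A by blast
  have "norm a < R" using a A by auto
  moreover have "infdist z A \<le> dist z a" by (rule infdist_le[OF a])
  moreover have "dist z a \<le> norm z + norm a" unfolding dist_norm by (rule norm_triangle_ineq4)
  ultimately show "infdist z A \<le> 2 * norm z" using z norm_ge_zero[of a] by linarith
  have "norm z / 2 \<le> dist z b" if "b \<in> A" for b
  proof -
    have "norm b < R" using that A by auto
    then show ?thesis using norm_triangle_ineq2[of z b] z unfolding dist_norm by linarith
  qed
  then show "norm z / 2 \<le> infdist z A" by (rule le_infdistI[OF A(2)])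
qed

context finite_bands
begin

text \<open>The exponent of |z| in the weight at infinity, where both distances and 1 + |z| are
  comparable to |z|.\<close>

definition inf_exp :: real where "inf_exp = p + 1 + \<epsilon> + exp_a p q \<epsilon> + exp_b p q \<epsilon>"

lemma inf_exp_eq: "inf_exp = max (p + q - 1 + \<epsilon>) 0"
  by (simp add: inf_exp_def exp_a_def exp_b_def pos_part_def field_simps)

text \<open>In w = 1/z, Jensen on |w| = r with base point 0 loses nothing, since |F 0| = 1. The
  zeros with |z| >= 2/r therefore number at most a constant times K r^s, s = p + q. This beats the
  weight, of order r^(-inf_exp), when s > \<open>inf_exp\<close>.\<close>

lemma controlled_infinity:
  obtains R where "controlled {z. R < norm z}"
proof -
  obtain R0 where R0: "R0 > 0" "E \<subseteq> ball 0 R0" by (rule E_bounded)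
  define R where "R = max (2 * R0) 1"
  have R: "R \<ge> 1" "2 * R0 \<le> R" by (auto simp: R_def)
  define s where "s = p + q"
  have s: "s \<ge> 0" using p0 q0 by (simp add: s_def)
  have far: "norm z / 2 \<le> infdist z E" "infdist z E \<le> 2 * norm z"
    "norm z / 2 \<le> infdist z V" "infdist z V \<le> 2 * norm z" if "R \<le> norm z" for z
    using that R infdist_far[OF R0(2) E_nonempty, of z] infdist_far[of V R0 z] R0 V_subset_E V_nonempty by auto
  have upper: "ln (norm (f z)) \<le> 2 powr s * K * norm z powr (- s)"
    if f: "adm f K" and z: "R \<le> norm z" "f z \<noteq> 0" "z \<notin> E" for f K z
  proof -
    have K: "K > 0" by (rule adm_pos[OF f])
    have zp: "norm z / 2 > 0" using z R by linarith
    have "(norm z / 2) powr p * (norm z / 2) powr q \<le> infdist z E powr p * infdist z V powr q"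
      using far[OF z(1)] p0 q0 by (intro mult_mono powr_mono2) auto
    moreover have "(norm z / 2) powr p * (norm z / 2) powr q = (norm z / 2) powr s"
      by (simp add: s_def powr_add)
    ultimately have le: "(norm z / 2) powr s \<le> infdist z E powr p * infdist z V powr q" by simp
    have "ln (norm (f z)) \<le> K / (infdist z E powr p * infdist z V powr q)"
      by (rule adm_le[OF f z(3,2)])
    also have "\<dots> \<le> K / (norm z / 2) powr s"
    proof (rule divide_left_mono[OF le])
      have "0 < (norm z / 2) powr s" using zp by simp
      then show "0 < infdist z E powr p * infdist z V powr q * (norm z / 2) powr s"
        using le by - (rule mult_pos_pos, linarith+)
    qed (use K in simp)
    also have "\<dots> = 2 powr s * K * norm z powr (- s)"
      by (simp only: powr_divide powr_minus) (simp add: field_simps)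
    finally show ?thesis .
  qed
  define Cw where "Cw = 2 powr (p + 1 + \<epsilon>) * (2 powr \<bar>exp_a p q \<epsilon>\<bar> * 2 powr \<bar>exp_b p q \<epsilon>\<bar>)"
  have Cw: "Cw > 0" by (simp add: Cw_def)
  have weight: "wt z \<le> Cw * norm z powr inf_exp" if z: "R \<le> norm z" for z
  proof -
    have zp: "norm z > 0" using z R by linarith
    have "infdist z E powr (p + 1 + \<epsilon>) \<le> 2 powr (p + 1 + \<epsilon>) * norm z powr (p + 1 + \<epsilon>)"
      using powr_comparable[OF zp far(1,2)[OF z], of "p + 1 + \<epsilon>"] p0 e0 by simp
    moreover have "infdist z V powr exp_a p q \<epsilon> \<le> 2 powr \<bar>exp_a p q \<epsilon>\<bar> * norm z powr exp_a p q \<epsilon>"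
      by (rule powr_comparable[OF zp far(3,4)[OF z]])
    moreover have "(1 + norm z) powr exp_b p q \<epsilon> \<le> 2 powr \<bar>exp_b p q \<epsilon>\<bar> * norm z powr exp_b p q \<epsilon>"
      by (rule powr_comparable[OF zp]) (use z R in linarith)+
    ultimately have "wt z \<le> 2 powr (p + 1 + \<epsilon>) * norm z powr (p + 1 + \<epsilon>) *
      (2 powr \<bar>exp_a p q \<epsilon>\<bar> * norm z powr exp_a p q \<epsilon>) * (2 powr \<bar>exp_b p q \<epsilon>\<bar> * norm z powr exp_b p q \<epsilon>)"
      unfolding wt_def by (intro mult_mono) auto
    also have "\<dots> = Cw * norm z powr inf_exp"
      unfolding Cw_def inf_exp_def powr_add by (simp only: mult_ac)
    finally show ?thesis .
  qed
  \<comment> \<open>The constant 16 is Jensen's 8 times the 2 from |1/z| <= r/2.\<close>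
  have count: "(\<Sum>z\<in>T. real (nat (zorder f z))) \<le> 16 * 2 powr s * K * r powr s"
    if f: "adm f K" and r: "0 < r" "r \<le> 1 / R" and T: "finite T" "\<And>z. z \<in> T \<Longrightarrow> 2 / r \<le> norm z" for f K r T
  proof -
    have R1: "1 / R < 1 / R0" using R R0 by (intro divide_strict_left_mono) auto
    obtain F where F: "F holomorphic_on ball 0 (1 / R0)" "norm (F 0) = 1"
      "\<And>w. w \<noteq> 0 \<Longrightarrow> norm w < 1 / R0 \<Longrightarrow> inverse w \<notin> E \<and> F w = f (inverse w)"
      using adm_at_infinity[OF f R0] by blast
    have Tz: "z \<noteq> 0" "norm (inverse z) \<le> r / 2" if "z \<in> T" for z
    proof -
      have z: "2 / r \<le> norm z" "0 < 2 / r" using T(2)[OF that] r by auto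
      then show "z \<noteq> 0" by auto
      have "inverse (norm z) \<le> inverse (2 / r)" using z by (intro le_imp_inverse_le)
      then show "norm (inverse z) \<le> r / 2" by (simp add: norm_inverse)
    qed
    have "(\<Sum>a\<in>inverse ` T. real (nat (zorder f (inverse a))) * ((r - norm a) * (r - norm (0::complex)) / (8 * r\<^sup>2)))
      \<le> 2 powr s * K * r powr s - ln (norm (F 0))"
    proof (rule jensen_bound[OF F(1)])
      show "cball 0 r \<subseteq> ball 0 (1 / R0)" using r R1 by auto
      show "inverse ` T \<subseteq> ball 0 r" using Tz(2) r by fastforce
      fix a assume "a \<in> inverse ` T"
      then have a: "a \<noteq> 0" "norm a \<le> r / 2" using Tz by auto
      define U where "U = ball 0 (1 / R0) - {0 :: complex}"
      have U: "open U" "a \<in> U" using a r R1 by (auto simp: U_def open_delete)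
      have "vanishes_to (\<lambda>w. f (inverse w)) a (nat (zorder f (inverse a)))"
      proof (rule vanishes_to_compose[of f inverse, OF _ _ U])
        show "vanishes_to f (inverse a) (nat (zorder f (inverse a)))"
          using F(3)[of a] U by (intro adm_vanishes[OF f]) (simp add: U_def)
        show "inverse holomorphic_on U" by (intro holomorphic_intros) (simp add: U_def)
      qed
      \<comment> \<open>Exponent 0 in the cofactor lemma: \<open>F\<close> and f(1/w) agree on the
        punctured disc.\<close>
      then show "vanishes_to F a (nat (zorder f (inverse a)))"
        by (rule vanishes_to_cofactor[OF U, of _ _ 0 0]) (use a(1) F(3) in \<open>simp_all add: U_def\<close>)
    next
      fix w :: complex assume w: "norm w = r" "F w \<noteq> 0"
      have w': "w \<noteq> 0" "norm w < 1 / R0" using w r R1 by auto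
      have "R \<le> inverse r" using r R by (simp add: field_simps)
      then have "ln (norm (f (inverse w))) \<le> 2 powr s * K * norm (inverse w) powr (- s)"
        using F(3)[OF w'] w by (intro upper[OF f]) (auto simp: norm_inverse)
      also have "norm (inverse w) powr (- s) = r powr s"
        using r w by (simp add: norm_inverse inverse_powr powr_minus)
      finally show "ln (norm (F w)) \<le> 2 powr s * K * r powr s" using F(3)[OF w'] by simp
    qed (use r T R0 F(2) in auto)
    also have "ln (norm (F 0)) = 0" using F(2) by simp
    also have "(\<Sum>a\<in>inverse ` T. real (nat (zorder f (inverse a))) * ((r - norm a) * (r - norm (0::complex)) / (8 * r\<^sup>2))) =
      (\<Sum>z\<in>T. real (nat (zorder f z)) * ((r - norm (inverse z)) * r / (8 * r\<^sup>2)))"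
      by (subst sum.reindex) (auto simp: inj_on_def)
    finally have "(\<Sum>z\<in>T. real (nat (zorder f z)) * ((r - norm (inverse z)) * r / (8 * r\<^sup>2))) \<le> 2 powr s * K * r powr s"
      by simp
    moreover have "(\<Sum>z\<in>T. real (nat (zorder f z)) * (1 / 16)) \<le>
      (\<Sum>z\<in>T. real (nat (zorder f z)) * ((r - norm (inverse z)) * r / (8 * r\<^sup>2)))"
    proof (intro sum_mono mult_left_mono)
      fix z assume "z \<in> T"
      then have "r / 2 \<le> r - norm (inverse z)" using Tz(2) by fastforce
      then have "r / 2 * r / (8 * r\<^sup>2) \<le> (r - norm (inverse z)) * r / (8 * r\<^sup>2)"
        using r by (intro divide_right_mono mult_right_mono) auto
      then show "1 / 16 \<le> (r - norm (inverse z)) * r / (8 * r\<^sup>2)" using r by (simp add: power2_eq_square)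
    qed auto
    moreover have "(\<Sum>z\<in>T. real (nat (zorder f z)) * (1 / 16)) = (\<Sum>z\<in>T. real (nat (zorder f z))) * (1 / 16)"
      by (rule sum_distrib_right[symmetric])
    ultimately show ?thesis by linarith
  qed
  \<comment> \<open>The condition bounds the power of |z| rather than |z| itself, so that for
    \<open>inf_exp\<close> = 0 it also admits an unbounded T.\<close>
  have shell: "(\<Sum>z\<in>T. real (nat (zorder f z)) * wt z) \<le> Cw * 4 powr inf_exp * (16 * 2 powr s) * K * r powr (s - inf_exp)"
    if f: "adm f K" and r: "0 < r" "r \<le> 1 / R"
      and T: "finite T" "\<And>z. z \<in> T \<Longrightarrow> 2 / r \<le> norm z \<and> norm z powr inf_exp \<le> (4 / r) powr inf_exp" for f K r T
  proof -
    have "(\<Sum>z\<in>T. real (nat (zorder f z)) * wt z) \<le> (\<Sum>z\<in>T. real (nat (zorder f z)) * (Cw * (4 / r) powr inf_exp))"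
    proof (intro sum_mono mult_left_mono)
      fix z assume z: "z \<in> T"
      have "R \<le> 1 / r" using r R by (simp add: field_simps)
      also have "1 / r \<le> 2 / r" using r by (intro divide_right_mono) auto
      finally have "wt z \<le> Cw * norm z powr inf_exp" using T(2)[OF z] by (intro weight) linarith
      also have "\<dots> \<le> Cw * (4 / r) powr inf_exp" using T(2)[OF z] Cw by (intro mult_left_mono) auto
      finally show "wt z \<le> Cw * (4 / r) powr inf_exp" .
    qed auto
    also have "\<dots> = (\<Sum>z\<in>T. real (nat (zorder f z))) * (Cw * (4 / r) powr inf_exp)"
      by (simp add: sum_distrib_right)
    also have "\<dots> \<le> 16 * 2 powr s * K * r powr s * (Cw * (4 / r) powr inf_exp)"
      using Cw count[OF f r T(1)] T(2) by (intro mult_right_mono) auto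
    also have "\<dots> = Cw * 4 powr inf_exp * (16 * 2 powr s) * K * r powr (s - inf_exp)"
      by (simp only: powr_divide powr_diff) (simp add: mult_ac)
    finally show ?thesis .
  qed
  define A where "A = Cw * 4 powr inf_exp * (16 * 2 powr s)"
  have A: "A > 0" using Cw by (simp add: A_def)
  have "controlled {z. 2 * R < norm z}"
  \<comment> \<open>For s = 0 there is no decay to sum, but then \<open>inf_exp\<close> = 0 and a
    single Jensen estimate covers all large zeros. For s > 0 the inequality \<epsilon> < 1 gives s >
    \<open>inf_exp\<close>.\<close>
  proof (cases "s = 0")
    case True
    then have ie: "inf_exp = 0" using e1 by (simp add: inf_exp_eq s_def[symmetric])
    show ?thesis unfolding controlled_def
    proof (intro exI[of _ A] allI impI)
      fix f K S assume f: "adm f K" and S: "finite S" "S \<subseteq> {z. 2 * R < norm z} - E"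
      have "(\<Sum>z\<in>S. real (nat (zorder f z)) * wt z) \<le>
        Cw * 4 powr inf_exp * (16 * 2 powr s) * K * (1 / R) powr (s - inf_exp)"
      proof (rule shell[OF f _ _ S(1)])
        fix z assume "z \<in> S"
        then have z: "2 * R < norm z" using S by auto
        then have "z \<noteq> 0" using R by auto
        then show "2 / (1 / R) \<le> norm z \<and> norm z powr inf_exp \<le> (4 / (1 / R)) powr inf_exp" using z ie R by simp
      qed (use R in auto)
      then show "(\<Sum>z\<in>S. real (nat (zorder f z)) * wt z) \<le> A * K" using True ie R by (simp add: A_def)
    qed
  next
    case False
    then have sp: "s > 0" using s by simp
    then have d: "s - inf_exp > 0" using e1 by (simp add: inf_exp_eq s_def[symmetric])
    have ie: "inf_exp \<ge> 0" by (simp add: inf_exp_eq)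
    define \<theta> where "\<theta> = (2::real) powr (- (s - inf_exp))"
    have \<theta>: "0 \<le> \<theta>" "\<theta> < 1" using d by (auto simp: \<theta>_def intro!: powr_less_one)
    define \<kappa> where "\<kappa> = (\<lambda>z::complex. nat \<lfloor>log 2 (norm z / (2 * R))\<rfloor>)"
    define D where "D = A * (1 / R) powr (s - inf_exp)"
    show ?thesis unfolding controlled_def
    proof (intro exI[of _ "D / (1 - \<theta>)"] allI impI)
      fix f K S assume f: "adm f K" and S: "finite S" "S \<subseteq> {z. 2 * R < norm z} - E"
      have K: "K > 0" by (rule adm_pos[OF f])
      have "(\<Sum>z\<in>S. real (nat (zorder f z)) * wt z) \<le> D * K / (1 - \<theta>)"
      proof (rule sum_le_geometric[OF S(1) _ \<theta>])
        show "0 \<le> D * K" using A K by (simp add: D_def)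
        fix k
        define r where "r = 1 / R * 2 powr (- real k)"
        have "2 powr (- real k) \<le> (1::real)" by (simp add: powr_minus ge_one_powr_ge_zero inverse_le_1_iff)
        then have "1 / R * 2 powr (- real k) \<le> 1 / R * 1" using R by (intro mult_left_mono) auto
        then have r: "0 < r" "r \<le> 1 / R" using R by (auto simp: r_def)
        have ri: "1 / r = R * 2 powr real k" by (simp add: r_def powr_minus field_simps)
        have "(\<Sum>z\<in>{z\<in>S. \<kappa> z = k}. real (nat (zorder f z)) * wt z) \<le> A * K * r powr (s - inf_exp)"
          unfolding A_def
        proof (rule shell[OF f r])
          fix z assume "z \<in> {z\<in>S. \<kappa> z = k}"
          then have z: "2 * R < norm z" "\<kappa> z = k" using S by auto
          define x where "x = norm z / (2 * R)"
          have x: "x > 1" using z R by (simp add: x_def field_simps)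
          have "log 2 x \<ge> 0" using x by simp
          then have "\<lfloor>log 2 x\<rfloor> = int k" using z by (auto simp: \<kappa>_def x_def)
          then have "real k \<le> log 2 x" "log 2 x < real k + 1" by linarith+
          then have "2 powr real k \<le> x" "x < 2 powr (real k + 1)"
            using x by (simp_all add: le_log_iff log_less_iff)
          then have "2 * R * 2 powr real k \<le> 2 * R * x" "2 * R * x < 2 * R * 2 powr (real k + 1)"
            using R by (intro mult_left_mono mult_strict_left_mono; simp)+
          moreover have "2 * R * x = norm z" using R by (simp add: x_def)
          moreover have "2 / r = 2 * R * 2 powr real k" "4 / r = 2 * R * 2 powr (real k + 1)"
            using ri by (simp_all add: powr_add field_simps)
          ultimately have "2 / r \<le> norm z" "norm z < 4 / r" by simp_all
          then show "2 / r \<le> norm z \<and> norm z powr inf_exp \<le> (4 / r) powr inf_exp"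
            using ie by (auto intro: powr_mono2)
        qed (use S in auto)
        also have "r powr (s - inf_exp) = (1 / R) powr (s - inf_exp) * \<theta> ^ k"
        proof -
          have "(2 powr (- real k)) powr (s - inf_exp) = \<theta> ^ k"
            unfolding \<theta>_def by (simp add: powr_powr powr_realpow[symmetric] algebra_simps)
          then show ?thesis unfolding r_def by (simp only: powr_mult)
        qed
        finally show "(\<Sum>z\<in>{z\<in>S. \<kappa> z = k}. real (nat (zorder f z)) * wt z) \<le> D * K * \<theta> ^ k"
          by (simp add: D_def mult_ac)
      qed
      then show "(\<Sum>z\<in>S. real (nat (zorder f z)) * wt z) \<le> D / (1 - \<theta>) * K" by simp
    qed
  qed
  then show ?thesis by (rule that)
qed

section \<open>From local to global\<close>

text \<open>Every point is an endpoint, an inner point of a band or a point of the domain, and has a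
  controlled disc in each case. Finitely many discs cover a closed disc whose complement is
  controlled as well.\<close>

lemma controlled_everywhere: "controlled UNIV"
proof -
  obtain R where R: "controlled {z. R < norm z}" by (rule controlled_infinity)
  have "\<exists>r>0. controlled (ball z r)" for z
  proof (cases "z \<in> E")
    case True
    show ?thesis
    proof (cases "z \<in> V")
      case True
      then show ?thesis using ex_slit_at controlled_endpoint by metis
    next
      case False
      obtain j x where x: "j \<le> n" "\<alpha> j \<le> x" "x \<le> \<beta> j" "z = of_real x"
        using \<open>z \<in> E\<close> by (auto simp: frak_e_def)
      then have "x \<noteq> \<alpha> j" "x \<noteq> \<beta> j" using False endpoints_in_V[OF x(1)] by auto
      then show ?thesis using controlled_interval_interior[of j x] x False by simp
    qed
  qed (rule controlled_regular)
  then obtain r where r: "\<And>z. r z > 0" "\<And>z. controlled (ball z (r z))" by metis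
  obtain D where D: "D \<subseteq> cball 0 R" "finite D" "cball 0 R \<subseteq> (\<Union>z\<in>D. ball z (r z))"
    using compactE_image[OF compact_cball, of "cball 0 R" "\<lambda>z. ball z (r z)"] r(1)
    by (metis (no_types, lifting) UN_I centre_in_ball open_ball subsetI)
  have "controlled ((\<Union>z\<in>D. ball z (r z)) \<union> {z. R < norm z})"
    using R r D by (intro controlled_Un controlled_UN) auto
  then show ?thesis by (rule controlled_subset) (use D in force)
qed

end

theorem theorem0p1:
  fixes n :: nat and \<alpha> \<beta> :: "nat \<Rightarrow> real" and p q \<epsilon> :: real
  assumes "\<forall>j\<le>n. \<alpha> j < \<beta> j"
    and "\<forall>j<n. \<beta> j < \<alpha> (Suc j)"
    and "p \<ge> 0" and "q \<ge> 0"
    and "0 < \<epsilon>" and "\<epsilon> < 1"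
  shows "\<exists>C>0. \<forall>(f :: complex \<Rightarrow> complex) (K\<^sub>1 :: real).
     (\<exists>c. analytic_ext_at_inf f (frak_e n \<alpha> \<beta>) c \<and> norm c = 1) \<and> K\<^sub>1 > 0 \<and>
     (\<forall>z. z \<notin> frak_e n \<alpha> \<beta> \<longrightarrow> f z \<noteq> 0 \<longrightarrow>
        ln (norm (f z)) \<le> K\<^sub>1 / (infdist z (frak_e n \<alpha> \<beta>) powr p * infdist z (endpts n \<alpha> \<beta>) powr q))
     \<longrightarrow>
     (let w = (\<lambda>z. real (nat (zorder f z)) * infdist z (frak_e n \<alpha> \<beta>) powr (p + 1 + \<epsilon>)
                   * infdist z (endpts n \<alpha> \<beta>) powr (exp_a p q \<epsilon>)
                   * (1 + norm z) powr (exp_b p q \<epsilon>));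
          Z = {z. z \<notin> frak_e n \<alpha> \<beta> \<and> f z = 0}
      in w summable_on Z \<and> (\<Sum>\<^sub>\<infinity>z\<in>Z. w z) \<le> C * K\<^sub>1)"
proof -
  interpret finite_bands n \<alpha> \<beta> p q \<epsilon> using assms by unfold_locales auto
  obtain C where C: "\<And>f K S. adm f K \<Longrightarrow> finite S \<Longrightarrow> S \<subseteq> - E \<Longrightarrow>
     (\<Sum>z\<in>S. real (nat (zorder f z)) * wt z) \<le> C * K"
    using controlled_everywhere unfolding controlled_def Compl_eq_Diff_UNIV by blast
  have main: "(\<lambda>z. real (nat (zorder f z)) * wt z) summable_on Z \<and>
      (\<Sum>\<^sub>\<infinity>z\<in>Z. real (nat (zorder f z)) * wt z) \<le> max C 1 * K"
    if f: "adm f K" and Z: "Z \<subseteq> - E" for f K Z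
  proof -
    have le: "(\<Sum>z\<in>S. real (nat (zorder f z)) * wt z) \<le> max C 1 * K" if "finite S" "S \<subseteq> Z" for S
    proof -
      have "C * K \<le> max C 1 * K" using adm_pos[OF f] by (intro mult_right_mono) auto
      then show ?thesis using C[OF f that(1)] that(2) Z by force
    qed
    have sm: "(\<lambda>z. real (nat (zorder f z)) * wt z) summable_on Z"
      \<comment> \<open>The terms are nonnegative, so the uniform bound on finite sums yields
        summability and the bound for the infinite sum.\<close>
      by (rule nonneg_bdd_above_summable_on) (auto simp: wt_nonneg intro!: bdd_aboveI2 le)
    then show ?thesis using infsum_le_finite_sums[OF sm] le by blast
  qed
  show ?thesis
  \<comment> \<open>\<open>controlled\<close> does not assert a positive constant, hence the maximum
    with 1.\<close>
  proof (intro exI[of _ "max C 1"] conjI allI impI)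
    fix f K
    assume "(\<exists>c. analytic_ext_at_inf f E c \<and> norm c = 1) \<and> K > 0 \<and>
     (\<forall>z. z \<notin> E \<longrightarrow> f z \<noteq> 0 \<longrightarrow> ln (norm (f z)) \<le> K / (infdist z E powr p * infdist z V powr q))"
    then have "adm f K" unfolding adm_def .
    from main[OF this, of "{z. z \<notin> E \<and> f z = 0}"]
    show "let w = (\<lambda>z. real (nat (zorder f z)) * infdist z E powr (p + 1 + \<epsilon>) * infdist z V powr (exp_a p q \<epsilon>)
                   * (1 + norm z) powr (exp_b p q \<epsilon>));
          Z = {z. z \<notin> E \<and> f z = 0}
      in w summable_on Z \<and> (\<Sum>\<^sub>\<infinity>z\<in>Z. w z) \<le> max C 1 * K"
      unfolding Let_def wt_def by (simp add: mult.assoc subset_eq)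
  qed simp
qed

end
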